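(* Let $\tau\in\mathbb R$ and $T>\tau$ with $T>0$. Assume $a$ is globally Lipschitz with constant $L_a$ and $m\le a(s)\le\tilde m$; $f\in C(\mathbb R)$ satisfies $|f(s)-f(r)|\le\eta|s-r|$, $-\kappa-\alpha_1|s|^2\le f(s)s\le\kappa-\alpha_2|s|^2$ and $|f(s)|\le C_f(|s|+1)$; $l\in L^2(\mathcal O)$; and Hypothesis 1.1 holds. For $u_0\in H$ let $u(t,u_0)$ solve $\partial_tu-a(l(u))\Delta u=f(u)$, $u|_{\partial\mathcal O}=0$, $u(\tau)=u_0$; let $u_{0,\epsilon}(t,\omega,u_0)$ solve the Stratonovich equation $\partial_tu_{0,\epsilon}-a(l(u_{0,\epsilon}))\Delta u_{0,\epsilon}=f(u_{0,\epsilon})+\epsilon u_{0,\epsilon}\circ\frac{dW}{dt}$, $u_{0,\epsilon}|_{\partial\mathcal O}=0$, $u_{0,\epsilon}(\tau)=u_0$; and let $u_{\delta,\epsilon}(t,\omega,u_0)$ solve $\partial_tu_{\delta,\epsilon}-a(l(u_{\delta,\epsilon}))\Delta u_{\delta,\epsilon}=f(u_{\delta,\epsilon})+\epsilon u_{\delta,\epsilon}\zeta_\delta(\theta_t\omega)$, $u_{\delta,\epsilon}|_{\partial\mathcal O}=0$, $u_{\delta,\epsilon}(\tau)=u_0$. Set $v_{0,\epsilon}(t)=e^{-\epsilon W_t}u_{0,\epsilon}(t,\omega,u_0)$ and $v_{\delta,\epsilon}(t)=e^{-\epsilon\int_0^t\zeta_\delta(\theta_s\omega)ds}u_{\delta,\epsilon}(t,\omega,u_0)$.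 Assume there is $\alpha>0$ with $\sup_{\tau\le t\le T}\|v_{0,\epsilon}(t)\|^2\le\alpha$ for all $\epsilon>0$ and $\sup_{\tau\le t\le T}\|v_{\delta,\epsilon}(t)\|^2\le\alpha$ for all $\epsilon>0,\delta>0$, and $$m>(\alpha+2)L_a|l|\lambda_1^{-1}+L_a|l|(\alpha+2)+4\eta\lambda_1^{-1}.$$ Then for each $\omega\in\Omega$ and $u_0\in H$, $$\lim_{\delta\to0^+,\ \epsilon\to0^+}\sup_{t\in[\tau,T]}|u_{\delta,\epsilon}(t,\omega,u_0)-u(t,u_0)|^2=0.$$
   Context: $\mathcal O\subset\mathbb R^N$ bounded open of class $C^k$, $k\ge2$; $H=L^2(\mathcal O)$ with norm $|\cdot|$; $V=H_0^1(\mathcal O)$ with norm $\|v\|=|\nabla v|$; $\lambda_1$ first Dirichlet eigenvalue of $-\Delta$. $a\in C(\mathbb R;\mathbb R^+)$, constants $0<m\le\tilde m$. $l\in L^2(\mathcal O)$ acts as $l(u)=\int_{\mathcal O}lu$, norm $|l|$. $\Omega$: continuous $\omega:\mathbb R\to\mathbb R$ with $\omega(0)=0$, $\omega(t)/t\to0$ at $\pm\infty$, Wiener measure; $W_t(\omega)=\omega(t)$; $\theta_t\omega(\cdot)=\omega(t+\cdot)-\omega(t)$; $C_\omega=\sup_{s\in\mathbb Q}|\omega(s)|/(|s|+1)$. Hypothesis 1.1: for each $\delta>0$, $\zeta_\delta:\Omega\to\mathbb R$ measurable, $t\mapsto\zeta_\delta(\theta_t\omega)$ stationary and continuous, $|\zeta_\delta(\theta_t\omega)|\le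 K_\delta C_\omega(|t|+1)$ with $K_\delta>0$ a function of $1/\delta$, $K_\delta\to\infty$ as $\delta\to0^+$, and $\lim_{\delta\to0^+}\sup_{|t|\le T}|\int_0^t\zeta_\delta(\theta_r\omega)dr-\omega(t)|=0$ for all $T>0$. *)

theory Defs
  imports "HOL-Analysis.Analysis" "HOL-Probability.Probability"
begin

primrec Ck_on :: "nat \<Rightarrow> 'a::euclidean_space set \<Rightarrow> ('a \<Rightarrow> real) \<Rightarrow> bool" where
  "Ck_on 0 S f = continuous_on S f"
| "Ck_on (Suc k) S f = ((\<forall>x\<in>S. f differentiable (at x)) \<and>
      (\<forall>v. Ck_on k S (\<lambda>x. frechet_derivative f (at x) v)))"

text \<open>Boundary of class C^k: near every boundary point, after choosing a direction e
  (i.e. orienting the coordinates), D lies above the graph of a C^k function of the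
  coordinates orthogonal to e.\<close>
definition Ck_boundary :: "nat \<Rightarrow> 'a::euclidean_space set \<Rightarrow> bool" where
  "Ck_boundary k D \<longleftrightarrow> (\<forall>x\<in>frontier D. \<exists>r>0. \<exists>e \<gamma>. norm e = 1 \<and>
      Ck_on k UNIV \<gamma> \<and> (\<forall>y. \<gamma> y = \<gamma> (y - (y \<bullet> e) *\<^sub>R e)) \<and>
      D \<inter> ball x r = {y \<in> ball x r. y \<bullet> e > \<gamma> y})"

definition L2 :: "'a::euclidean_space set \<Rightarrow> ('a \<Rightarrow> real) \<Rightarrow> bool" where
  "L2 D u \<longleftrightarrow> set_borel_measurable lebesgue D u \<and> set_integrable lebesgue D (\<lambda>x. (u x)^2)"

definition l2inner :: "'a::euclidean_space set \<Rightarrow> ('a \<Rightarrow> real) \<Rightarrow> ('a \<Rightarrow> real) \<Rightarrow> real" where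
  "l2inner D u v = (LINT x:D|lebesgue. u x * v x)"

definition l2norm :: "'a::euclidean_space set \<Rightarrow> ('a \<Rightarrow> real) \<Rightarrow> real" where
  "l2norm D u = sqrt (LINT x:D|lebesgue. (u x)^2)"

definition test_fun :: "'a::euclidean_space set \<Rightarrow> ('a \<Rightarrow> real) \<Rightarrow> bool" where
  "test_fun D \<phi> \<longleftrightarrow> (\<forall>k. Ck_on k UNIV \<phi>) \<and>
     compact (closure {x. \<phi> x \<noteq> 0}) \<and> closure {x. \<phi> x \<noteq> 0} \<subseteq> D"

definition cgrad :: "('a::euclidean_space \<Rightarrow> real) \<Rightarrow> 'a \<Rightarrow> 'a" where
  "cgrad \<phi> x = (\<Sum>i\<in>Basis. frechet_derivative \<phi> (at x) i *\<^sub>R i)"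

definition weak_grad :: "'a::euclidean_space set \<Rightarrow> ('a \<Rightarrow> real) \<Rightarrow> ('a \<Rightarrow> 'a) \<Rightarrow> bool" where
  "weak_grad D u g \<longleftrightarrow> set_borel_measurable lebesgue D g \<and>
     set_integrable lebesgue D (\<lambda>x. (norm (g x))^2) \<and>
     (\<forall>\<phi>. test_fun D \<phi> \<longrightarrow> (\<forall>i\<in>Basis.
        (LINT x:D|lebesgue. u x * frechet_derivative \<phi> (at x) i) =
        - (LINT x:D|lebesgue. (g x \<bullet> i) * \<phi> x)))"

definition in_V :: "'a::euclidean_space set \<Rightarrow> ('a \<Rightarrow> real) \<Rightarrow> bool" where
  "in_V D u \<longleftrightarrow> L2 D u \<and> (\<exists>g. weak_grad D u g \<and>
     (\<exists>\<phi>s. (\<forall>n. test_fun D (\<phi>s n)) \<and>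
        (\<lambda>n. l2norm D (\<lambda>x. \<phi>s n x - u x)) \<longlonglongrightarrow> 0 \<and>
        (\<lambda>n. sqrt (LINT x:D|lebesgue. (norm (cgrad (\<phi>s n) x - g x))^2)) \<longlonglongrightarrow> 0))"

definition wgrad :: "'a::euclidean_space set \<Rightarrow> ('a \<Rightarrow> real) \<Rightarrow> 'a \<Rightarrow> 'a" where
  "wgrad D u = (SOME g. weak_grad D u g)"

definition Vnorm :: "'a::euclidean_space set \<Rightarrow> ('a \<Rightarrow> real) \<Rightarrow> real" where
  "Vnorm D u = sqrt (LINT x:D|lebesgue. (norm (wgrad D u x))^2)"

definition dform :: "'a::euclidean_space set \<Rightarrow> ('a \<Rightarrow> real) \<Rightarrow> ('a \<Rightarrow> real) \<Rightarrow> real" where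
  "dform D u v = (LINT x:D|lebesgue. wgrad D u x \<bullet> wgrad D v x)"

definition lambda1 :: "'a::euclidean_space set \<Rightarrow> real" where
  "lambda1 D = Inf {lam. \<exists>v. in_V D v \<and> l2norm D v \<noteq> 0 \<and>
       (\<forall>w. in_V D w \<longrightarrow> dform D v w = lam * l2inner D v w)}"

text \<open>u is a weak solution on [tau,T] of  u_t - A(t,u) Laplace u = F(t,u),
  u = 0 on the boundary, u(tau) = u0; i.e. u in C([tau,T];H) \<inter> L^2(tau,T;V) and
  (u(t),v) = (u0,v) + int_tau^t (-A(s,u(s)) ((u(s),v)) + (F(s,u(s)),v)) ds for all v in V.\<close>
definition weak_sol :: "'a::euclidean_space set \<Rightarrow> (real \<Rightarrow> ('a \<Rightarrow> real) \<Rightarrow> real) \<Rightarrow>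
    (real \<Rightarrow> ('a \<Rightarrow> real) \<Rightarrow> 'a \<Rightarrow> real) \<Rightarrow> real \<Rightarrow> real \<Rightarrow> ('a \<Rightarrow> real) \<Rightarrow>
    (real \<Rightarrow> 'a \<Rightarrow> real) \<Rightarrow> bool" where
  "weak_sol D A F \<tau> T u0 u \<longleftrightarrow>
     (\<forall>t\<in>{\<tau>..T}. L2 D (u t)) \<and>
     (\<forall>t\<in>{\<tau>..T}. ((\<lambda>s. l2norm D (\<lambda>x. u s x - u t x)) \<longlongrightarrow> 0) (at t within {\<tau>..T})) \<and>
     l2norm D (\<lambda>x. u \<tau> x - u0 x) = 0 \<and>
     (AE t in lborel. t \<in> {\<tau>..T} \<longrightarrow> in_V D (u t)) \<and>
     set_integrable lborel {\<tau>..T} (\<lambda>t. (Vnorm D (u t))^2) \<and>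
     (\<forall>v. in_V D v \<longrightarrow> (\<forall>t\<in>{\<tau>..T}.
        set_integrable lborel {\<tau>..t}
          (\<lambda>s. - A s (u s) * dform D (u s) v + l2inner D (F s (u s)) v) \<and>
        l2inner D (u t) v = l2inner D u0 v +
          (LINT s:{\<tau>..t}|lborel. - A s (u s) * dform D (u s) v + l2inner D (F s (u s)) v)))"

definition Omega :: "(real \<Rightarrow> real) set" where
  "Omega = {w. continuous_on UNIV w \<and> w 0 = 0 \<and>
      ((\<lambda>t. w t / t) \<longlongrightarrow> 0) at_top \<and> ((\<lambda>t. w t / t) \<longlongrightarrow> 0) at_bot}"

definition Omega_M :: "(real \<Rightarrow> real) measure" where
  "Omega_M = restrict_space (PiM UNIV (\<lambda>_. borel)) Omega"

definition wiener_measure :: "(real \<Rightarrow> real) measure \<Rightarrow> bool" where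
  "wiener_measure P \<longleftrightarrow> prob_space P \<and> sets P = sets Omega_M \<and> space P = Omega \<and>
     (\<forall>(t::nat \<Rightarrow> real) n. (\<forall>i<n. t i < t (Suc i)) \<longrightarrow>
        prob_space.indep_vars P (\<lambda>_. borel) (\<lambda>i w. w (t (Suc i)) - w (t i)) {..<n} \<and>
        (\<forall>i<n. distributed P lborel (\<lambda>w. w (t (Suc i)) - w (t i))
                 (\<lambda>x. ennreal (normal_density 0 (sqrt (t (Suc i) - t i)) x))))"

definition shift :: "real \<Rightarrow> (real \<Rightarrow> real) \<Rightarrow> (real \<Rightarrow> real)" ("\<theta>") where
  "\<theta> t w = (\<lambda>s. w (t + s) - w t)"

definition C_om :: "(real \<Rightarrow> real) \<Rightarrow> real" where
  "C_om w = (SUP s\<in>\<rat>. \<bar>w s\<bar> / (\<bar>s\<bar> + 1))"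

definition oint :: "real \<Rightarrow> real \<Rightarrow> (real \<Rightarrow> real) \<Rightarrow> real" where
  "oint a b g = (if a \<le> b then integral {a..b} g else - integral {b..a} g)"

definition stationary :: "(real \<Rightarrow> real) measure \<Rightarrow> (real \<Rightarrow> (real \<Rightarrow> real) \<Rightarrow> real) \<Rightarrow> bool" where
  "stationary P X \<longleftrightarrow> (\<forall>h (J::real set). finite J \<longrightarrow>
     distr P (PiM J (\<lambda>_. borel)) (\<lambda>w. \<lambda>j\<in>J. X (j + h) w) =
     distr P (PiM J (\<lambda>_. borel)) (\<lambda>w. \<lambda>j\<in>J. X j w))"

definition hyp11 :: "(real \<Rightarrow> real) measure \<Rightarrow> (real \<Rightarrow> (real \<Rightarrow> real) \<Rightarrow> real) \<Rightarrow> (real \<Rightarrow> real) \<Rightarrow> bool" where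
  "hyp11 P \<zeta> K \<longleftrightarrow>
     (\<forall>\<delta>>0. \<zeta> \<delta> \<in> borel_measurable Omega_M \<and>
        stationary P (\<lambda>t w. \<zeta> \<delta> (\<theta> t w)) \<and>
        (\<forall>w\<in>Omega. continuous_on UNIV (\<lambda>t. \<zeta> \<delta> (\<theta> t w))) \<and>
        K \<delta> > 0 \<and>
        (\<forall>w\<in>Omega. \<forall>t. \<bar>\<zeta> \<delta> (\<theta> t w)\<bar> \<le> K \<delta> * C_om w * (\<bar>t\<bar> + 1))) \<and>
     filterlim K at_top (at_right 0) \<and>
     (\<forall>w\<in>Omega. \<forall>T>0. ((\<lambda>\<delta>. SUP t\<in>{-T..T}. \<bar>oint 0 t (\<lambda>r. \<zeta> \<delta> (\<theta> r w)) - w t\<bar>)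
                          \<longlongrightarrow> 0) (at_right 0))"

text \<open>Solution of the Stratonovich equation u_t - a(l(u)) Laplace u = f(u) + eps u o dW/dt,
  defined pathwise through v(t) = exp(-eps W_t) u(t), which solves the random equation
  v_t - a(l(e^{eps W_t} v)) Laplace v = e^{-eps W_t} f(e^{eps W_t} v).\<close>
definition strat_sol :: "'a::euclidean_space set \<Rightarrow> (real \<Rightarrow> real) \<Rightarrow> ('a \<Rightarrow> real) \<Rightarrow> (real \<Rightarrow> real) \<Rightarrow>
    real \<Rightarrow> (real \<Rightarrow> real) \<Rightarrow> real \<Rightarrow> real \<Rightarrow> ('a \<Rightarrow> real) \<Rightarrow> (real \<Rightarrow> 'a \<Rightarrow> real) \<Rightarrow> bool" where
  "strat_sol D a l f \<epsilon> w \<tau> T u0 u \<longleftrightarrow>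
     weak_sol D (\<lambda>s z. a (l2inner D l (\<lambda>x. exp (\<epsilon> * w s) * z x)))
               (\<lambda>s z x. exp (- \<epsilon> * w s) * f (exp (\<epsilon> * w s) * z x))
               \<tau> T (\<lambda>x. exp (- \<epsilon> * w \<tau>) * u0 x) (\<lambda>t x. exp (- \<epsilon> * w t) * u t x)"

end

theory Submission
  imports Defs
begin

text \<open>
  Put \<open>v = exp (- \<epsilon> Z) u\<^sub>\<delta>\<^sub>\<epsilon>\<close> with \<open>Z(t) = \<integral>\<^sub>0\<^sup>t \<zeta>\<^sub>\<delta>\<close> and \<open>y = v - u\<close>. Since \<open>Z\<close> stays bounded on
  \<open>[\<tau>, T]\<close> as \<open>\<delta> \<rightarrow> 0\<close>, the exponent \<open>\<epsilon> Z\<close> is bounded by some \<open>q = O(\<epsilon>)\<close>. The bound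
  \<open>\<parallel>v\<parallel>\<^sup>2 \<le> \<alpha>\<close> controls the nonlocal term \<open>(a(l(u\<^sub>\<delta>\<^sub>\<epsilon>)) - a(l(u))) ((v, y))\<close>, so Young's inequality
  in the energy inequality for \<open>y\<close> gives \<open>d/dt |y|\<^sup>2 \<le> C (|y|\<^sup>2 + q)\<close>, and Gronwall's lemma gives
  \<open>|y|\<^sup>2 = O(q)\<close> uniformly in \<open>t\<close>.

  The energy inequality for weak solutions is obtained without vector-valued integration. The functional
  \<open>\<Phi>(y) = sup {2 (y, z) - |z|\<^sup>2 - \<lambda> \<parallel>z\<parallel>\<^sup>2 | z \<in> V}\<close> increases to \<open>|y|\<^sup>2\<close> on \<open>V\<close> as \<open>\<lambda> \<rightarrow> 0\<close>. If \<open>z\<close>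
  nearly maximises it at \<open>y(t)\<close>, then \<open>\<Phi>(y(t)) - \<Phi>(y(s))\<close> is at most \<open>2 (y(t) - y(s), z)\<close> up to a
  small error, which the weak formulation with the fixed test function \<open>z\<close> evaluates. The approximate
  Euler-Lagrange equation \<open>y - z \<approx> - \<lambda> Laplace z\<close>, valid at all nearby times, yields
  \<open>((y, z)) \<ge> \<parallel>z\<parallel>\<^sup>2\<close> up to a small error. Summing over a fine partition and letting \<open>\<lambda> \<rightarrow> 0\<close> gives
  the inequality at almost every time, hence at all times by continuity.
\<close>

subsection \<open>Square integrable functions\<close>

text \<open>The coefficient \<open>\<zeta> \<delta>\<close> may blow up as \<open>\<delta>\<close>
  tends to 0; only its time integral converges. The exponential factor removes
  \<open>\<zeta> \<delta>\<close> from the equation, so \<open>v\<close>, and not the perturbed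
  solution itself, is compared with \<open>u\<close>. Then \<open>\<delta>\<close> enters only
  through a bound \<open>W\<close> on the integral that holds for all small \<open>\<delta>\<close>.
  Hence \<open>q = \<epsilon> * W\<close>, no relation between \<open>\<delta>\<close> and
  \<open>\<epsilon>\<close> is used, and the squared error is of order \<open>\<epsilon>\<close>.
  The main obstacle: a weak solution offers, for each fixed \<open>z\<close> in V, an identity
  integrated in time, into which the moving function \<open>y(t)\<close> cannot be inserted.
  Freezing \<open>z\<close> on a short interval costs an error of the size of the tolerance divided
  by \<open>\<lambda>\<close>, so the mesh is refined with \<open>\<lambda>\<close> fixed, and only
  then does \<open>\<lambda>\<close> tend to 0. A second obstacle lies in the definitions:
  \<open>wgrad\<close> chooses some weak gradient, so even the linearity of \<open>dform\<close>
  rests on uniqueness almost everywhere, and this on a supply of smooth functions supported in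
  boxes.\<close>

definition sqint :: "'a measure \<Rightarrow> ('a \<Rightarrow> 'b::euclidean_space) \<Rightarrow> bool" where
  "sqint M g \<longleftrightarrow> g \<in> borel_measurable M \<and> integrable M (\<lambda>x. (norm (g x))\<^sup>2)"

text \<open>Values in a Euclidean space let scalar functions and gradient fields share one theory.
  This is only a semi-inner product, as functions that agree almost everywhere are not
  identified.\<close>

definition ip :: "'a measure \<Rightarrow> ('a \<Rightarrow> 'b::euclidean_space) \<Rightarrow> ('a \<Rightarrow> 'b) \<Rightarrow> real" where
  "ip M f g = (\<integral>x. f x \<bullet> g x \<partial>M)"

lemma sqint_inner:
  assumes "sqint M f" "sqint M g"
  shows "integrable M (\<lambda>x. f x \<bullet> g x)"
proof (rule Bochner_Integration.integrable_bound)
  show "integrable M (\<lambda>x. (norm (f x))\<^sup>2 + (norm (g x))\<^sup>2)"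
    using assms by (auto simp: sqint_def)
  show "(\<lambda>x. f x \<bullet> g x) \<in> borel_measurable M"
    using assms by (auto simp: sqint_def)
  show "AE x in M. norm (f x \<bullet> g x) \<le> norm ((norm (f x))\<^sup>2 + (norm (g x))\<^sup>2)"
  proof (rule AE_I2)
    fix x
    have "\<bar>f x \<bullet> g x\<bar> \<le> norm (f x) * norm (g x)" by (rule Cauchy_Schwarz_ineq2)
    also have "\<dots> \<le> (norm (f x))\<^sup>2 + (norm (g x))\<^sup>2"
    proof -
      have "0 \<le> (norm (f x) - norm (g x))\<^sup>2" by simp
      moreover have "0 \<le> norm (f x) * norm (g x)" by simp
      ultimately show ?thesis unfolding power2_diff by linarith
    qed
    finally show "norm (f x \<bullet> g x) \<le> norm ((norm (f x))\<^sup>2 + (norm (g x))\<^sup>2)" by simp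
  qed
qed

lemma sqint_scale: "sqint M f \<Longrightarrow> sqint M (\<lambda>x. c *\<^sub>R f x)"
  by (auto simp: sqint_def power_mult_distrib)

lemma sqint_add:
  assumes "sqint M f" "sqint M g"
  shows "sqint M (\<lambda>x. f x + g x)"
proof -
  have "integrable M (\<lambda>x. (norm (f x))\<^sup>2 + 2 * (f x \<bullet> g x) + (norm (g x))\<^sup>2)"
    using sqint_inner[OF assms] assms by (auto simp: sqint_def)
  moreover have "(\<lambda>x. (norm (f x))\<^sup>2 + 2 * (f x \<bullet> g x) + (norm (g x))\<^sup>2) = (\<lambda>x. (norm (f x + g x))\<^sup>2)"
    by (auto simp: power2_norm_eq_inner inner_add inner_commute)
  ultimately show ?thesis using assms by (auto simp: sqint_def)
qed

lemma sqint_diff: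
  assumes "sqint M f" "sqint M g"
  shows "sqint M (\<lambda>x. f x - g x)"
  using sqint_add[OF assms(1) sqint_scale[OF assms(2), of "-1"]] by simp

lemma ip_cong_AE:
  assumes "sqint M f" "sqint M g" "sqint M f'" "sqint M g'"
    "AE x in M. f x = f' x" "AE x in M. g x = g' x"
  shows "ip M f g = ip M f' g'"
  unfolding ip_def
proof (rule integral_cong_AE)
  show "AE x in M. f x \<bullet> g x = f' x \<bullet> g' x" using assms(5,6) by eventually_elim simp
qed (use assms in \<open>auto simp: sqint_def\<close>)

lemma ip_commute: "ip M f g = ip M g f"
  by (simp add: ip_def inner_commute)

lemma ip_add_left:
  assumes "sqint M f" "sqint M g" "sqint M h"
  shows "ip M (\<lambda>x. f x + g x) h = ip M f h + ip M g h"
  unfolding ip_def inner_add_left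
  by (rule Bochner_Integration.integral_add) (use assms sqint_inner in auto)

lemma ip_diff_left:
  assumes "sqint M f" "sqint M g" "sqint M h"
  shows "ip M (\<lambda>x. f x - g x) h = ip M f h - ip M g h"
  unfolding ip_def inner_diff_left
  by (rule Bochner_Integration.integral_diff) (use assms sqint_inner in auto)

lemma ip_scale_left: "ip M (\<lambda>x. c *\<^sub>R f x) h = c * ip M f h"
  unfolding ip_def by simp

lemma ip_nonneg: "0 \<le> ip M f f"
  unfolding ip_def by (rule Bochner_Integration.integral_nonneg) simp

lemma ip_self_add:
  assumes "sqint M f" "sqint M g"
  shows "ip M (\<lambda>x. f x + c *\<^sub>R g x) (\<lambda>x. f x + c *\<^sub>R g x) = ip M f f + 2 * c * ip M f g + c\<^sup>2 * ip M g g"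
proof -
  let ?h = "\<lambda>x. f x + c *\<^sub>R g x"
  have h: "sqint M ?h" by (intro sqint_add sqint_scale assms)
  have s: "sqint M (\<lambda>x. c *\<^sub>R g x)" by (intro sqint_scale assms)
  have "ip M ?h ?h = ip M f ?h + c * ip M g ?h"
    using ip_add_left[OF assms(1) s h] by (simp add: ip_scale_left)
  also have "ip M f ?h = ip M f f + c * ip M g f"
    using ip_add_left[OF assms(1) s assms(1)] ip_commute[of M f ?h] by (simp add: ip_scale_left)
  also have "ip M g ?h = ip M f g + c * ip M g g"
    using ip_add_left[OF assms(1) s assms(2)] ip_commute[of M g ?h] by (simp add: ip_scale_left)
  finally show ?thesis using ip_commute[of M g f] by (simp add: power2_eq_square algebra_simps)
qed

text \<open>A quadratic in \<open>c\<close> that is nonnegative everywhere has a nonpositive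
  discriminant, read off at its minimum \<open>c = - b / a\<close>. It serves twice: for
  Cauchy-Schwarz, and to turn near-maximality into a near Euler-Lagrange equation.\<close>

lemma discriminant_le:
  fixes a b d :: real
  assumes "0 \<le> a" and pos: "\<And>c. 0 \<le> d + 2 * c * b + c\<^sup>2 * a"
  shows "b\<^sup>2 \<le> a * d"
proof (cases "a = 0")
  case True
  have "b = 0"
  proof (rule ccontr)
    assume b: "b \<noteq> 0"
    \<comment> \<open>With \<open>a = 0\<close> the expression is affine in \<open>c\<close>; this
      \<open>c\<close> gives it the value -1.\<close>
    have "0 \<le> d + 2 * (- (d + 1) / (2 * b)) * b" using pos[of "- (d + 1) / (2 * b)"] True by simp
    also have "\<dots> = -1" using b by (simp add: field_simps)
    finally show False by simp
  qed
  then show ?thesis using True by simp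
next
  case False
  then have a: "a > 0" using assms by simp
  have "0 \<le> a * (d + 2 * (- b / a) * b + (- b / a)\<^sup>2 * a)"
    using pos[of "- b / a"] a by (intro mult_nonneg_nonneg) auto
  also have "\<dots> = a * d - b\<^sup>2" using a by (simp add: field_simps power2_eq_square)
  finally show ?thesis by simp
qed

lemma ip_Cauchy_Schwarz:
  assumes "sqint M f" "sqint M g"
  shows "\<bar>ip M f g\<bar> \<le> sqrt (ip M f f) * sqrt (ip M g g)"
proof -
  have "(ip M f g)\<^sup>2 \<le> ip M g g * ip M f f"
  proof (rule discriminant_le)
    fix c
    show "0 \<le> ip M f f + 2 * c * ip M f g + c\<^sup>2 * ip M g g"
      using ip_self_add[OF assms, of c] ip_nonneg[of M "\<lambda>x. f x + c *\<^sub>R g x"] by simp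
  qed (rule ip_nonneg)
  then have "sqrt ((ip M f g)\<^sup>2) \<le> sqrt (ip M f f * ip M g g)"
    by (intro real_sqrt_le_mono) (simp add: mult.commute)
  then show ?thesis by (simp add: real_sqrt_mult)
qed

lemma ip_triangle:
  assumes "sqint M f" "sqint M g"
  shows "sqrt (ip M (\<lambda>x. f x + g x) (\<lambda>x. f x + g x)) \<le> sqrt (ip M f f) + sqrt (ip M g g)"
proof (rule real_le_lsqrt)
  have "ip M (\<lambda>x. f x + g x) (\<lambda>x. f x + g x) = ip M f f + 2 * ip M f g + ip M g g"
    using ip_self_add[OF assms, of 1] by simp
  also have "\<dots> \<le> ip M f f + 2 * (sqrt (ip M f f) * sqrt (ip M g g)) + ip M g g"
    using ip_Cauchy_Schwarz[OF assms] by linarith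
  also have "\<dots> = (sqrt (ip M f f) + sqrt (ip M g g))\<^sup>2"
    by (simp add: power2_sum ip_nonneg)
  finally show "ip M (\<lambda>x. f x + g x) (\<lambda>x. f x + g x) \<le> (sqrt (ip M f f) + sqrt (ip M g g))\<^sup>2" .
qed (auto simp: ip_nonneg)

text \<open>The two codomains may differ, so this passes from a vector field to its components and
  from a coefficient to its multiple of a basis vector.\<close>

lemma ip_mono:
  fixes f :: "'a \<Rightarrow> 'b::euclidean_space" and g :: "'a \<Rightarrow> 'c::euclidean_space"
  assumes "sqint M g" "f \<in> borel_measurable M" "\<And>x. norm (f x) \<le> norm (g x)"
  shows "sqint M f" "ip M f f \<le> ip M g g"
proof -
  have le: "(norm (f x))\<^sup>2 \<le> (norm (g x))\<^sup>2" for x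
    by (rule power_mono[OF assms(3)]) simp
  show f: "sqint M f" unfolding sqint_def
  proof
    show "integrable M (\<lambda>x. (norm (f x))\<^sup>2)"
      by (rule Bochner_Integration.integrable_bound[of _ "\<lambda>x. (norm (g x))\<^sup>2"])
         (use assms le in \<open>auto simp: sqint_def\<close>)
  qed fact
  show "ip M f f \<le> ip M g g"
    unfolding ip_def power2_norm_eq_inner[symmetric]
    by (rule integral_mono) (use f assms le in \<open>auto simp: sqint_def\<close>)
qed

subsection \<open>The spaces H and V\<close>

lemma set_integrable_lebesgue_on:
  fixes f :: "'a::euclidean_space \<Rightarrow> 'b::{banach, second_countable_topology}"
  assumes "open D"
  shows "set_integrable lebesgue D f \<longleftrightarrow> integrable (lebesgue_on D) f"
    and "set_borel_measurable lebesgue D f \<longleftrightarrow> f \<in> borel_measurable (lebesgue_on D)"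
    and "(LINT x:D|lebesgue. f x) = (\<integral>x. f x \<partial>lebesgue_on D)"
proof -
  have D: "D \<inter> space lebesgue \<in> sets lebesgue" using assms by simp
  show "set_integrable lebesgue D f \<longleftrightarrow> integrable (lebesgue_on D) f"
    by (simp only: integrable_restrict_space[OF D] set_integrable_def)
  show "set_borel_measurable lebesgue D f \<longleftrightarrow> f \<in> borel_measurable (lebesgue_on D)"
    by (simp only: borel_measurable_restrict_space_iff[OF D] set_borel_measurable_def)
  show "(LINT x:D|lebesgue. f x) = (\<integral>x. f x \<partial>lebesgue_on D)"
    by (simp only: integral_restrict_space[OF D] set_lebesgue_integral_def)
qed

lemma L2_iff_sqint: "open D \<Longrightarrow> L2 D u \<longleftrightarrow> sqint (lebesgue_on D) u"
  by (simp add: L2_def sqint_def set_integrable_lebesgue_on)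

lemma l2inner_eq_ip: "open D \<Longrightarrow> l2inner D u v = ip (lebesgue_on D) u v"
  by (simp add: l2inner_def ip_def set_integrable_lebesgue_on)

lemma l2norm_eq_ip: "open D \<Longrightarrow> l2norm D u = sqrt (ip (lebesgue_on D) u u)"
  by (simp add: l2norm_def ip_def set_integrable_lebesgue_on power2_eq_square)

lemma finite_measure_lebesgue_on:
  assumes "open D" "bounded D"
  shows "finite_measure (lebesgue_on D)"
proof
  have "emeasure lebesgue D < \<infinity>"
    using emeasure_bounded_finite[OF assms(2)] assms(1) by (simp add: emeasure_completion)
  then show "emeasure (lebesgue_on D) (space (lebesgue_on D)) \<noteq> \<infinity>"
    using assms by (simp add: emeasure_restrict_space)
qed

lemma sqint_bounded:
  fixes g :: "'a::euclidean_space \<Rightarrow> 'b::euclidean_space"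
  assumes "open D" "bounded D" "g \<in> borel_measurable (lebesgue_on D)" "\<And>x. norm (g x) \<le> B"
  shows "sqint (lebesgue_on D) g"
proof -
  interpret finite_measure "lebesgue_on D" by (rule finite_measure_lebesgue_on) fact+
  have "integrable (lebesgue_on D) (\<lambda>x. (norm (g x))\<^sup>2)"
  proof (rule integrable_const_bound[of _ "B\<^sup>2"])
    show "AE x in lebesgue_on D. norm ((norm (g x))\<^sup>2) \<le> B\<^sup>2"
      by (rule AE_I2) (simp add: assms(4) power_mono)
  qed (use assms in \<open>auto simp: sqint_def\<close>)
  then show ?thesis using assms by (simp add: sqint_def)
qed

lemma continuous_lebesgue_on:
  fixes g :: "'a::euclidean_space \<Rightarrow> 'b::euclidean_space"
  assumes "continuous_on UNIV g"
  shows "g \<in> borel_measurable (lebesgue_on D)"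
proof -
  have "g \<in> borel_measurable borel" by (rule borel_measurable_continuous_onI) fact
  then have "g \<in> borel_measurable lebesgue" by (simp add: measurable_completion)
  then show ?thesis by (rule measurable_restrict_space1)
qed

subsection \<open>Test functions\<close>

text \<open>The recursion of \<open>Ck_on\<close> descends through derivatives in all directions, so
  a class \<open>Q\<close> of differentiable functions closed under directional derivatives has all
  orders of smoothness at once.\<close>

lemma smooth_coinduct:
  assumes "Q f" and "\<And>f x. Q f \<Longrightarrow> f differentiable (at x)"
    and "\<And>f v. Q f \<Longrightarrow> Q (\<lambda>x. frechet_derivative f (at x) v)"
  shows "Ck_on k UNIV f"
  using assms(1)
proof (induction k arbitrary: f)
  case 0
  then show ?case using assms(2)
    by (auto intro!: continuous_at_imp_continuous_on differentiable_imp_continuous_within)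
next
  case (Suc k)
  then show ?case using assms by auto
qed

text \<open>The derivatives of \<open>exp (- 1 / t)\<close>, extended by zero to \<open>t \<le> 0\<close>, are linear
  combinations of the functions below, so that the algebra \<open>smooth_alg\<close> is closed under
  directional derivatives.\<close>

definition expq :: "nat \<Rightarrow> real \<Rightarrow> real" where
  "expq n t = (if t > 0 then exp (- 1 / t) / t ^ n else 0)"

text \<open>With \<open>s = 1 / t\<close> the right-hand limit is that of
  \<open>s ^ n / exp s\<close> at infinity; on the left the function vanishes.\<close>

lemma expq_tendsto_0: "(expq n \<longlongrightarrow> 0) (at 0)"
proof -
  have "((\<lambda>t. inverse t ^ n / exp (inverse t)) \<longlongrightarrow> 0) (at_right (0::real))"
    by (rule filterlim_compose[OF tendsto_power_div_exp_0 filterlim_inverse_at_top_right])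
  moreover have "\<forall>\<^sub>F t in at_right (0::real). inverse t ^ n / exp (inverse t) = expq n t"
    using eventually_at_right_less[of 0]
    by eventually_elim (simp add: expq_def exp_minus field_simps)
  ultimately have right: "(expq n \<longlongrightarrow> 0) (at_right 0)"
    using Lim_transform_eventually by blast
  have left: "(expq n \<longlongrightarrow> 0) (at_left 0)"
  proof (rule tendsto_eventually)
    have "\<forall>\<^sub>F t in at_left (0::real). t < 0" by (simp add: eventually_at_left_field) (meson lt_ex)
    then show "\<forall>\<^sub>F t in at_left 0. expq n t = 0"
      by eventually_elim (simp add: expq_def)
  qed
  show ?thesis using left right by (simp add: filterlim_split_at)
qed

lemma expq_has_real_derivative:
  "(expq n has_real_derivative (- real n * expq (n + 1) t + expq (n + 2) t)) (at t)"
proof -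
  consider "t > 0" | "t < 0" | "t = 0" by linarith
  then show ?thesis
  proof cases
    case 1
    have "((\<lambda>t. exp (- 1 / t) / t ^ n) has_real_derivative (- real n * expq (n + 1) t + expq (n + 2) t)) (at t)"
      using 1
      by (auto intro!: derivative_eq_intros simp: expq_def, cases n)
         (auto simp: field_simps power2_eq_square)
    then show ?thesis
      by (rule has_field_derivative_transform_within_open[of _ _ _ "{0<..}"])
         (use 1 in \<open>auto simp: expq_def\<close>)
  next
    case 2
    have "((\<lambda>t. 0) has_real_derivative (- real n * expq (n + 1) t + expq (n + 2) t)) (at t)"
      using 2 by (auto simp: expq_def)
    then show ?thesis
      by (rule has_field_derivative_transform_within_open[of _ _ _ "{..<0}"])
         (use 2 in \<open>auto simp: expq_def\<close>)
  next
    \<comment> \<open>At 0 the difference quotient of \<open>expq n\<close> is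
      \<open>expq (n + 1)\<close> itself, whose limit is known.\<close>
    case 3
    have "((\<lambda>h. (expq n (0 + h) - expq n 0) / h) \<longlongrightarrow> 0) (at 0)"
    proof (rule Lim_transform_eventually[OF expq_tendsto_0[of "n + 1"]])
      show "\<forall>\<^sub>F h in at 0. expq (n + 1) h = (expq n (0 + h) - expq n 0) / h"
        by (rule always_eventually) (auto simp: expq_def)
    qed
    then show ?thesis using 3 by (simp add: DERIV_def expq_def)
  qed
qed

inductive smooth_alg :: "('a::euclidean_space \<Rightarrow> real) \<Rightarrow> bool" where
  smooth_const: "smooth_alg (\<lambda>x. c)"
| smooth_expq: "smooth_alg (\<lambda>x. expq n (c + x \<bullet> v))"
| smooth_add: "smooth_alg f \<Longrightarrow> smooth_alg g \<Longrightarrow> smooth_alg (\<lambda>x. f x + g x)"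
| smooth_mult: "smooth_alg f \<Longrightarrow> smooth_alg g \<Longrightarrow> smooth_alg (\<lambda>x. f x * g x)"

lemma smooth_alg_has_derivative:
  "smooth_alg f \<Longrightarrow> \<exists>g. (\<forall>x. (f has_derivative (\<lambda>v. g v x)) (at x)) \<and> (\<forall>v. smooth_alg (g v))"
proof (induction rule: smooth_alg.induct)
  case (smooth_const c)
  show ?case by (rule exI[of _ "\<lambda>v x. 0"]) (auto intro: smooth_alg.intros)
next
  case (smooth_expq n c v)
  let ?e = "\<lambda>x. - real n * expq (n + 1) (c + x \<bullet> v) + expq (n + 2) (c + x \<bullet> v)"
  have "((\<lambda>x. expq n (c + x \<bullet> v)) has_derivative (\<lambda>w. ?e x * (w \<bullet> v))) (at x)" for x
  proof -
    have A: "(expq n has_derivative (*) (?e x)) (at (c + x \<bullet> v))"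
      using expq_has_real_derivative has_field_derivative_def by blast
    have B: "((\<lambda>x. c + x \<bullet> v) has_derivative (\<lambda>w. w \<bullet> v)) (at x)"
      by (auto intro!: derivative_eq_intros)
    show ?thesis by (rule has_derivative_compose[OF B A])
  qed
  moreover have "smooth_alg (\<lambda>x. ?e x * (w \<bullet> v))" for w
    by (intro smooth_alg.intros)
  ultimately show ?case by (intro exI[of _ "\<lambda>w x. ?e x * (w \<bullet> v)"]) blast
next
  case (smooth_add f1 f2)
  then obtain g1 g2 where g:
    "\<And>x. (f1 has_derivative (\<lambda>v. g1 v x)) (at x)" "\<And>v. smooth_alg (g1 v)"
    "\<And>x. (f2 has_derivative (\<lambda>v. g2 v x)) (at x)" "\<And>v. smooth_alg (g2 v)" by blast
  show ?case
    by (rule exI[of _ "\<lambda>v x. g1 v x + g2 v x"])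
       (auto intro!: g has_derivative_add smooth_alg.intros)
next
  case (smooth_mult f1 f2)
  then obtain g1 g2 where g:
    "\<And>x. (f1 has_derivative (\<lambda>v. g1 v x)) (at x)" "\<And>v. smooth_alg (g1 v)"
    "\<And>x. (f2 has_derivative (\<lambda>v. g2 v x)) (at x)" "\<And>v. smooth_alg (g2 v)" by blast
  show ?case
    by (rule exI[of _ "\<lambda>v x. f1 x * g2 v x + g1 v x * f2 x"])
       (auto intro!: g has_derivative_mult smooth_alg.intros smooth_mult.hyps)
qed

lemma smooth_alg_Ck: "smooth_alg f \<Longrightarrow> Ck_on k UNIV f"
proof (erule smooth_coinduct[of smooth_alg])
  fix f :: "'a \<Rightarrow> real" assume f: "smooth_alg f"
  then obtain g where g: "\<And>x. (f has_derivative (\<lambda>v. g v x)) (at x)" "\<And>v. smooth_alg (g v)"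
    using smooth_alg_has_derivative by blast
  show "f differentiable (at x)" for x using g differentiable_def by blast
  have "(\<lambda>x. frechet_derivative f (at x) v) = g v" for v
    by (rule ext) (simp add: frechet_derivative_at[OF g(1), symmetric])
  then show "smooth_alg (\<lambda>x. frechet_derivative f (at x) v)" for v using g(2) by simp
qed

text \<open>The factors are \<open>exp (- 1 / (n * s))\<close> for the signed distances
  \<open>s\<close> of \<open>x\<close> to the faces of \<open>box a b\<close>, and 0 for
  \<open>s \<le> 0\<close>. As \<open>n\<close> grows the function tends to 1 inside the box while
  its support never leaves the closed box; this takes the place of mollification. The affine
  arguments are written to match \<open>smooth_expq\<close>.\<close>

definition bump :: "nat \<Rightarrow> 'a::euclidean_space \<Rightarrow> 'a \<Rightarrow> 'a \<Rightarrow> real" where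
  "bump n a b x = (\<Prod>i\<in>Basis. expq 0 (- real n * (a \<bullet> i) + x \<bullet> (real n *\<^sub>R i)) *
                               expq 0 (real n * (b \<bullet> i) + x \<bullet> (- real n *\<^sub>R i)))"

lemma smooth_alg_bump: "smooth_alg (bump n a b)"
proof -
  have "smooth_alg (\<lambda>x. \<Prod>i\<in>A. expq 0 (- real n * (a \<bullet> i) + x \<bullet> (real n *\<^sub>R i)) *
                               expq 0 (real n * (b \<bullet> i) + x \<bullet> (- real n *\<^sub>R i)))"
    if "finite A" for A
    using that
  proof induction
    case empty
    show ?case using smooth_const[of 1] by simp
  next
    case (insert j F)
    show ?case unfolding prod.insert[OF insert.hyps] by (intro smooth_alg.intros insert.IH)
  qed
  then show ?thesis unfolding bump_def by simp
qed

lemma expq_0_bounds: "0 \<le> expq 0 t" "expq 0 t \<le> 1"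
  by (auto simp: expq_def)

lemma bump_bounds: "0 \<le> bump n a b x" "bump n a b x \<le> 1"
  unfolding bump_def
  by (auto intro!: prod_nonneg prod_le_1 mult_le_one mult_nonneg_nonneg simp: expq_0_bounds)

lemma bump_outside:
  assumes "x \<notin> box a b" shows "bump n a b x = 0"
proof -
  obtain i where i: "i \<in> Basis" "x \<bullet> i \<le> a \<bullet> i \<or> b \<bullet> i \<le> x \<bullet> i"
    using assms by (force simp: mem_box)
  then have "\<not> 0 < - real n * (a \<bullet> i) + x \<bullet> (real n *\<^sub>R i) \<or> \<not> 0 < real n * (b \<bullet> i) + x \<bullet> (- real n *\<^sub>R i)"
    using mult_left_mono[of "x \<bullet> i" "a \<bullet> i" "real n"] mult_left_mono[of "b \<bullet> i" "x \<bullet> i" "real n"]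
    by auto
  then show ?thesis using i(1) unfolding bump_def
    by (intro prod_zero) (auto simp: expq_def intro!: bexI[of _ i])
qed

lemma expq_0_tendsto_1:
  assumes "c > 0"
  shows "(\<lambda>n. expq 0 (real n * c)) \<longlonglongrightarrow> 1"
proof -
  have "(\<lambda>n. exp (- inverse (real n) / c)) \<longlonglongrightarrow> exp (- 0 / c)"
    using assms by (intro tendsto_intros lim_inverse_n) auto
  moreover have "\<forall>\<^sub>F n in sequentially. exp (- inverse (real n) / c) = expq 0 (real n * c)"
    using eventually_gt_at_top[of 0]
    by eventually_elim (use assms in \<open>auto simp: expq_def field_simps\<close>)
  ultimately show ?thesis using Lim_transform_eventually by fastforce
qed

lemma bump_tendsto: "(\<lambda>n. bump n a b x) \<longlonglongrightarrow> indicator (box a b) x"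
proof (cases "x \<in> box a b")
  case True
  have "(\<lambda>n. \<Prod>i\<in>Basis. expq 0 (real n * (x \<bullet> i - a \<bullet> i)) * expq 0 (real n * (b \<bullet> i - x \<bullet> i)))
     \<longlonglongrightarrow> (\<Prod>i\<in>(Basis::'a set). 1 * 1)"
    by (intro tendsto_prod tendsto_mult expq_0_tendsto_1) (use True in \<open>auto simp: mem_box\<close>)
  then show ?thesis using True by (simp add: bump_def algebra_simps)
qed (simp add: bump_outside)

lemma test_fun_bump:
  assumes "cbox a b \<subseteq> D"
  shows "test_fun D (bump n a b)"
proof -
  have "{x. bump n a b x \<noteq> 0} \<subseteq> cbox a b"
    using bump_outside[of _ a b n] box_subset_cbox by blast
  then have "closure {x. bump n a b x \<noteq> 0} \<subseteq> cbox a b"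
    by (rule closure_minimal) (rule closed_cbox)
  moreover have "compact (closure {x. bump n a b x \<noteq> 0})"
    using calculation compact_cbox by (metis closed_closure compact_Int_closed inf.absorb_iff2)
  ultimately show ?thesis
    using assms smooth_alg_Ck[OF smooth_alg_bump] by (auto simp: test_fun_def)
qed

text \<open>Dynkin's argument: open boxes generate the Borel sets and are stable under intersection,
  and the sets with integral zero are closed under complements and countable disjoint unions. A
  function whose integrals over all Borel sets agree with those of 0 is 0 almost everywhere.\<close>

lemma AE_zero_if_box_integrals_zero:
  fixes f :: "'a::euclidean_space \<Rightarrow> real"
  assumes f: "integrable lborel f"
    and box: "\<And>a b. (LINT x:box a b|lborel. f x) = 0"
  shows "AE x in lborel. f x = 0"
proof -
  have si: "set_integrable lborel A f" if "A \<in> sets borel" for A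
    unfolding set_integrable_def by (rule integrable_mult_indicator) (use f that in auto)
  \<comment> \<open>The complement case needs the integral over the whole space, obtained by
    exhausting it with boxes.\<close>
  have all: "(LINT x|lborel. f x) = 0"
  proof -
    let ?B = "\<lambda>n::nat. box (- (real n *\<^sub>R One)) (real n *\<^sub>R One) :: 'a set"
    have "(\<lambda>n. LINT x:?B n|lborel. f x) \<longlonglongrightarrow> (LINT x:(\<Union>n. ?B n)|lborel. f x)"
    proof (rule set_integral_cont_up)
      show "incseq ?B" by (rule incseq_SucI) (auto simp: mem_box dest!: bspec)
    qed (auto intro!: si)
    then have "(LINT x:(\<Union>n. ?B n)|lborel. f x) = 0"
      unfolding box using LIMSEQ_unique tendsto_const by blast
    then show ?thesis by (simp add: UN_box_eq_UNIV set_lebesgue_integral_def)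
  qed
  have "(LINT x:A|lborel. f x) = 0" if "A \<in> sets borel" for A :: "'a set"
  proof -
    let ?E = "range (\<lambda>(a, b). box a b::'a set)"
    have E: "Int_stable ?E" by (auto simp: Int_stable_def box_Int_box)
    have S: "sets borel = sigma_sets UNIV ?E" by (simp add: borel_eq_box)
    have "A \<in> sigma_sets UNIV ?E" using that S by simp
    have P: "?E \<subseteq> Pow UNIV" by simp
    from E P \<open>A \<in> sigma_sets UNIV ?E\<close> show ?thesis
    proof (induction rule: sigma_sets_induct_disjoint)
      case (compl A)
      then have A: "A \<in> sets borel" using S by simp
      have "(LINT x:UNIV - A|lborel. f x) = (LINT x|lborel. f x - indicator A x *\<^sub>R f x)"
        unfolding set_lebesgue_integral_def
        by (rule Bochner_Integration.integral_cong) (auto simp: indicator_def)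
      also have "\<dots> = (LINT x|lborel. f x) - (LINT x:A|lborel. f x)"
        unfolding set_lebesgue_integral_def
        by (rule Bochner_Integration.integral_diff) (use si[OF A] f in \<open>auto simp: set_integrable_def\<close>)
      finally show ?case using all compl by simp
    next
      case (union A)
      then have A: "A i \<in> sets borel" for i using S by auto
      have "(LINT x:(\<Union>i. A i)|lborel. f x) = (\<Sum>i. LINT x:A i|lborel. f x)"
        by (rule lebesgue_integral_countable_add)
           (use A union(1) in \<open>auto intro!: si simp: disjoint_family_on_def\<close>)
      then show ?case using union by simp
    next
      case empty
      show ?case by (simp add: set_lebesgue_integral_def)
    qed (auto simp: box)
  qed
  then show ?thesis
    by (intro density_unique_real[OF f, of "\<lambda>_. 0"]) (auto simp: set_lebesgue_integral_def)
qed

text \<open>Dominated convergence along \<open>bump\<close> makes the integral of \<open>h\<close>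
  vanish over every box whose closed version lies in \<open>D\<close>; countably many such closed
  boxes cover \<open>D\<close>.\<close>

lemma fundamental_lemma_variations:
  fixes h :: "'a::euclidean_space \<Rightarrow> real"
  assumes D: "open D" and h: "integrable (lebesgue_on D) h"
    and ort: "\<And>\<phi>. test_fun D \<phi> \<Longrightarrow> (\<integral>x. h x * \<phi> x \<partial>lebesgue_on D) = 0"
  shows "AE x in lebesgue_on D. h x = 0"
proof -
  have D': "D \<inter> space lebesgue \<in> sets lebesgue" using D by simp
  have hD: "integrable lebesgue (\<lambda>x. indicator D x * h x)"
    using h integrable_restrict_space[OF D', of h] by simp
  have box0: "(\<integral>x. h x * indicator (box a b) x \<partial>lebesgue_on D) = 0" if "cbox a b \<subseteq> D" for a b
  proof -
    have "(\<lambda>n. \<integral>x. h x * bump n a b x \<partial>lebesgue_on D) \<longlonglongrightarrow> (\<integral>x. h x * indicator (box a b) x \<partial>lebesgue_on D)"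
    proof (rule integral_dominated_convergence[where w = "\<lambda>x. norm (h x)"])
      show "(\<lambda>x. h x * indicator (box a b) x) \<in> borel_measurable (lebesgue_on D)"
      proof -
        have "(indicator (box a b) :: 'a \<Rightarrow> real) \<in> borel_measurable (lebesgue_on D)"
          by (intro measurable_restrict_space1 borel_measurable_indicator) auto
        then show ?thesis using h by measurable
      qed
      show "(\<lambda>x. h x * bump n a b x) \<in> borel_measurable (lebesgue_on D)" for n
      proof -
        have "bump n a b \<in> borel_measurable (lebesgue_on D)"
          using smooth_alg_Ck[OF smooth_alg_bump, of 0] by (auto intro: continuous_lebesgue_on)
        then show ?thesis using h by measurable
      qed
      show "AE x in lebesgue_on D. norm (h x * bump n a b x) \<le> norm (h x)" for n
        by (rule AE_I2) (simp add: abs_mult bump_bounds mult_left_le)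
      show "AE x in lebesgue_on D. (\<lambda>n. h x * bump n a b x) \<longlonglongrightarrow> h x * indicator (box a b) x"
        by (intro AE_I2 tendsto_intros bump_tendsto)
    qed (use h in auto)
    then show ?thesis
      unfolding ort[OF test_fun_bump[OF that]] using LIMSEQ_unique tendsto_const by blast
  qed
  have boxAE: "AE x in lebesgue. x \<in> box c d \<longrightarrow> h x = 0" if cd: "cbox c d \<subseteq> D" for c d
  proof -
    \<comment> \<open>Cutting down to \<open>box c d\<close> makes all boxes admissible: the
      intersection of \<open>box a b\<close> with it is again a box, and the closed one stays inside
      \<open>D\<close>.\<close>
    define f where "f = (\<lambda>x. indicator (box c d) x * (indicator D x * h x))"
    have fi: "integrable lebesgue f"
      unfolding f_def using integrable_mult_indicator[OF _ hD, of "box c d"] by simp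
    \<comment> \<open>The function is only Lebesgue measurable, whereas the box argument runs over
      Borel sets, so a Borel representative is taken.\<close>
    then obtain g where g: "g \<in> borel_measurable lborel" and fg: "AE x in lborel. f x = g x"
      using completion_ex_borel_measurable_real[of f lborel] by (auto dest: borel_measurable_integrable)
    have fg': "AE x in lebesgue. f x = g x" using fg by (rule AE_completion)
    have gl: "g \<in> borel_measurable lebesgue" using g by (simp add: measurable_completion)
    have "integrable lebesgue g"
      by (rule integrable_cong_AE_imp[OF fi gl]) fact
    then have gi: "integrable lborel g" using g integrable_completion by blast
    have "(LINT x:box a b|lborel. g x) = 0" for a b
    proof -
      have "(LINT x:box a b|lborel. g x) = (LINT x:box a b|lebesgue. g x)"
        unfolding set_lebesgue_integral_def by (rule integral_completion[symmetric]) (use g in measurable)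
      also have "\<dots> = (LINT x:box a b|lebesgue. f x)"
        unfolding set_lebesgue_integral_def
      proof (rule integral_cong_AE)
        show "AE x in lebesgue. indicator (box a b) x *\<^sub>R g x = indicator (box a b) x *\<^sub>R f x"
          using fg' by eventually_elim simp
        show "(\<lambda>x. indicator (box a b) x *\<^sub>R g x) \<in> borel_measurable lebesgue"
          using gl by (intro borel_measurable_scaleR borel_measurable_indicator) auto
        show "(\<lambda>x. indicator (box a b) x *\<^sub>R f x) \<in> borel_measurable lebesgue"
          using borel_measurable_integrable[OF fi]
          by (intro borel_measurable_scaleR borel_measurable_indicator) auto
      qed
      also have "\<dots> = (\<integral>x. h x * indicator (box a b \<inter> box c d) x \<partial>lebesgue_on D)"
        unfolding integral_restrict_space[OF D'] set_lebesgue_integral_def f_def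
        by (rule Bochner_Integration.integral_cong) (auto simp: indicator_def)
      also have "\<dots> = 0"
      proof (cases "box a b \<inter> box c d = {}")
        case False
        let ?a = "\<Sum>i\<in>Basis. max (a\<bullet>i) (c\<bullet>i) *\<^sub>R i" and ?b = "\<Sum>i\<in>Basis. min (b\<bullet>i) (d\<bullet>i) *\<^sub>R i"
        have "cbox ?a ?b \<subseteq> D" using cd Int_interval[of a b c d] by blast
        then show ?thesis using box0[of ?a ?b] box_Int_box[of a b c d] by simp
      qed simp
      finally show ?thesis .
    qed
    then have "AE x in lborel. g x = 0" by (rule AE_zero_if_box_integrals_zero[OF gi])
    then have "AE x in lebesgue. g x = 0" by (rule AE_completion)
    with fg' show ?thesis
      by eventually_elim (use cd box_subset_cbox[of c d] in \<open>auto simp: f_def indicator_def split: if_splits\<close>)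
  qed
  have cboxAE: "AE x in lebesgue. x \<in> cbox c d \<longrightarrow> h x = 0" if cd: "cbox c d \<subseteq> D" for c d
  proof -
    \<comment> \<open>\<open>D\<close> will be covered by closed boxes, so the faces, a null set,
      are added here.\<close>
    have "cbox c d - box c d \<in> null_sets lebesgue"
      using negligible_frontier_interval negligible_iff_null_sets by blast
    then have "AE x in lebesgue. x \<notin> cbox c d - box c d" by (rule AE_not_in)
    with boxAE[OF cd] show ?thesis by eventually_elim auto
  qed
  obtain C where C: "countable C" "C \<subseteq> Pow D" "\<And>X. X \<in> C \<Longrightarrow> \<exists>a b. X = cbox a b" "\<Union>C = D"
    using open_countable_Union_open_cbox[OF D] by metis
  have "AE x in lebesgue. \<forall>X\<in>C. x \<in> X \<longrightarrow> h x = 0"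
  proof (rule AE_ball_countable'[OF _ C(1)])
    fix X assume X: "X \<in> C"
    with C obtain a b where "X = cbox a b" by blast
    moreover have "X \<subseteq> D" using X C by auto
    ultimately show "AE x in lebesgue. x \<in> X \<longrightarrow> h x = 0" using cboxAE by simp
  qed
  then have "AE x in lebesgue. x \<in> D \<longrightarrow> h x = 0"
    by eventually_elim (use C(4) in auto)
  then show ?thesis using AE_restrict_space_iff[OF D'] by simp
qed

section \<open>Closure properties of test functions\<close>

lemma test_fun_continuous: "test_fun D \<phi> \<Longrightarrow> continuous_on UNIV \<phi>"
  unfolding test_fun_def by (metis Ck_on.simps(1))

lemma test_fun_differentiable: "test_fun D \<phi> \<Longrightarrow> \<phi> differentiable (at x)"
  unfolding test_fun_def by (metis Ck_on.simps(2) UNIV_I)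

lemma test_fun_support:
  assumes "test_fun D \<phi>" "{x. \<psi> x \<noteq> 0} \<subseteq> closure {x. \<phi> x \<noteq> 0}" "\<And>k. Ck_on k UNIV \<psi>"
  shows "test_fun D \<psi>"
proof -
  have sub: "closure {x. \<psi> x \<noteq> 0} \<subseteq> closure {x. \<phi> x \<noteq> 0}"
    by (rule closure_minimal[OF assms(2)]) simp
  then have "compact (closure {x. \<psi> x \<noteq> 0})"
    using assms(1) bounded_subset unfolding test_fun_def compact_eq_bounded_closed by blast
  then show ?thesis using sub assms unfolding test_fun_def by auto
qed

lemma test_fun_deriv:
  assumes "test_fun D \<phi>"
  shows "test_fun D (\<lambda>x. frechet_derivative \<phi> (at x) v)"
proof (rule test_fun_support[OF assms])
  show "Ck_on k UNIV (\<lambda>x. frechet_derivative \<phi> (at x) v)" for k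
    using assms unfolding test_fun_def by (metis Ck_on.simps(2))
  show "{x. frechet_derivative \<phi> (at x) v \<noteq> 0} \<subseteq> closure {x. \<phi> x \<noteq> 0}"
  proof
    fix x assume x: "x \<in> {x. frechet_derivative \<phi> (at x) v \<noteq> 0}"
    show "x \<in> closure {x. \<phi> x \<noteq> 0}"
    proof (rule ccontr)
      assume n: "x \<notin> closure {x. \<phi> x \<noteq> 0}"
      \<comment> \<open>Off the closed support \<open>\<phi>\<close> vanishes on an open set, so its
        derivative there is that of the zero function.\<close>
      have "frechet_derivative \<phi> (at x) = frechet_derivative (\<lambda>_. 0) (at x)"
        by (rule frechet_derivative_transform_within_open[OF test_fun_differentiable[OF assms],
              of "- closure {x. \<phi> x \<noteq> 0}"]) (use n closure_subset[of "{x. \<phi> x \<noteq> 0}"] in auto)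
      then show False using x by simp
    qed
  qed
qed

lemma frechet_derivative_lincomb:
  fixes \<phi> \<psi> :: "'a::euclidean_space \<Rightarrow> real"
  assumes "\<phi> differentiable (at x)" "\<psi> differentiable (at x)"
  shows "(\<lambda>x. a * \<phi> x + b * \<psi> x) differentiable (at x)"
    and "frechet_derivative (\<lambda>x. a * \<phi> x + b * \<psi> x) (at x) v =
         a * frechet_derivative \<phi> (at x) v + b * frechet_derivative \<psi> (at x) v"
proof -
  have d: "((\<lambda>x. a * \<phi> x + b * \<psi> x) has_derivative
      (\<lambda>v. a * frechet_derivative \<phi> (at x) v + b * frechet_derivative \<psi> (at x) v)) (at x)"
    using assms unfolding frechet_derivative_works
    by (intro has_derivative_add has_derivative_mult_right)
  show "(\<lambda>x. a * \<phi> x + b * \<psi> x) differentiable (at x)" using d by (rule differentiableI)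
  show "frechet_derivative (\<lambda>x. a * \<phi> x + b * \<psi> x) (at x) v =
         a * frechet_derivative \<phi> (at x) v + b * frechet_derivative \<psi> (at x) v"
    by (simp add: frechet_derivative_at[OF d, symmetric])
qed

text \<open>Coinduction with the class of combinations, for these fixed \<open>a\<close> and
  \<open>b\<close>, of two functions smooth to all orders: a derivative of such a function is the
  same combination of derivatives.\<close>

lemma Ck_on_lincomb:
  assumes "\<And>k. Ck_on k UNIV \<phi>" "\<And>k. Ck_on k UNIV \<psi>"
  shows "Ck_on k UNIV (\<lambda>x. a * \<phi> x + b * \<psi> x)"
proof (rule smooth_coinduct[where
    Q = "\<lambda>f. \<exists>\<phi> \<psi>. (\<forall>k. Ck_on k UNIV \<phi>) \<and> (\<forall>k. Ck_on k UNIV \<psi>) \<and> f = (\<lambda>x. a * \<phi> x + b * \<psi> x)"])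
  fix f :: "'a \<Rightarrow> real"
  assume "\<exists>\<phi> \<psi>. (\<forall>k. Ck_on k UNIV \<phi>) \<and> (\<forall>k. Ck_on k UNIV \<psi>) \<and> f = (\<lambda>x. a * \<phi> x + b * \<psi> x)"
  then obtain \<phi> \<psi> where s: "\<And>k. Ck_on k UNIV \<phi>" "\<And>k. Ck_on k UNIV \<psi>"
    and f: "f = (\<lambda>x. a * \<phi> x + b * \<psi> x)" by blast
  have d: "\<phi> differentiable (at x)" "\<psi> differentiable (at x)" for x
    using s[of "Suc 0"] by auto
  show "f differentiable (at x)" for x unfolding f by (rule frechet_derivative_lincomb[OF d])
  have "\<forall>k. Ck_on k UNIV (\<lambda>x. frechet_derivative \<phi> (at x) v)"
    "\<forall>k. Ck_on k UNIV (\<lambda>x. frechet_derivative \<psi> (at x) v)" for v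
    using s Ck_on.simps(2) by blast+
  then show "\<exists>\<phi> \<psi>. (\<forall>k. Ck_on k UNIV \<phi>) \<and> (\<forall>k. Ck_on k UNIV \<psi>) \<and>
      (\<lambda>x. frechet_derivative f (at x) v) = (\<lambda>x. a * \<phi> x + b * \<psi> x)" for v
    unfolding f frechet_derivative_lincomb(2)[OF d] by blast
qed (use assms in blast)

lemma test_fun_lincomb:
  assumes "test_fun D \<phi>" "test_fun D \<psi>"
  shows "test_fun D (\<lambda>x. a * \<phi> x + b * \<psi> x)"
proof -
  let ?S = "closure {x. \<phi> x \<noteq> 0} \<union> closure {x. \<psi> x \<noteq> 0}"
  have S: "compact ?S" "?S \<subseteq> D" using assms unfolding test_fun_def by auto
  have "{x. a * \<phi> x + b * \<psi> x \<noteq> 0} \<subseteq> {x. \<phi> x \<noteq> 0} \<union> {x. \<psi> x \<noteq> 0}" by auto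
  also have "\<dots> \<subseteq> ?S" by (intro Un_mono closure_subset)
  finally have sub: "closure {x. a * \<phi> x + b * \<psi> x \<noteq> 0} \<subseteq> ?S"
    by (rule closure_minimal) (intro closed_Un closed_closure)
  then have "compact (closure {x. a * \<phi> x + b * \<psi> x \<noteq> 0})"
    using bounded_subset[OF compact_imp_bounded[OF S(1)]] by (simp only: compact_eq_bounded_closed closed_closure)
  with sub S(2) show ?thesis
    using assms Ck_on_lincomb[of \<phi> \<psi>] unfolding test_fun_def by blast
qed

lemma test_fun_sqint:
  assumes "open D" "bounded D" "test_fun D \<phi>"
  shows "sqint (lebesgue_on D) \<phi>"
proof -
  have "compact (\<phi> ` closure {x. \<phi> x \<noteq> 0})"
    using assms(3) continuous_on_subset[OF test_fun_continuous[OF assms(3)] subset_UNIV]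
    by (intro compact_continuous_image) (simp_all add: test_fun_def)
  then obtain B where B: "\<And>y. y \<in> \<phi> ` closure {x. \<phi> x \<noteq> 0} \<Longrightarrow> norm y \<le> B"
    by (meson bounded_iff compact_imp_bounded)
  have "norm (\<phi> x) \<le> max B 0" for x
  proof (cases "\<phi> x = 0")
    case False
    then have "x \<in> closure {x. \<phi> x \<noteq> 0}" using closure_subset[of "{x. \<phi> x \<noteq> 0}"] by auto
    then show ?thesis using B[of "\<phi> x"] by auto
  qed simp
  then show ?thesis
    using sqint_bounded[OF assms(1,2) continuous_lebesgue_on[OF test_fun_continuous[OF assms(3)]]] by blast
qed

lemma sqint_sum: "finite A \<Longrightarrow> (\<And>i. i \<in> A \<Longrightarrow> sqint M (f i)) \<Longrightarrow> sqint M (\<lambda>x. \<Sum>i\<in>A. f i x)"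
proof (induction rule: finite_induct)
  case empty
  then show ?case by (simp add: sqint_def)
next
  case (insert j F)
  show ?case unfolding sum.insert[OF insert.hyps] by (intro sqint_add insert) auto
qed

lemma cgrad_sqint:
  assumes "open D" "bounded D" "test_fun D \<phi>"
  shows "sqint (lebesgue_on D) (cgrad \<phi>)"
proof -
  have "sqint (lebesgue_on D) (\<lambda>x. frechet_derivative \<phi> (at x) i *\<^sub>R i)" if "i \<in> Basis" for i
  proof -
    have s: "sqint (lebesgue_on D) (\<lambda>x. frechet_derivative \<phi> (at x) i)"
      by (rule test_fun_sqint[OF assms(1,2) test_fun_deriv[OF assms(3)]])
    show ?thesis
      by (rule ip_mono(1)[OF s]) (use s that in \<open>auto simp: sqint_def\<close>)
  qed
  then show ?thesis
    unfolding cgrad_def[abs_def] by (intro sqint_sum) auto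
qed

lemma cgrad_lincomb:
  assumes "test_fun D \<phi>" "test_fun D \<psi>"
  shows "cgrad (\<lambda>x. a * \<phi> x + b * \<psi> x) x = a *\<^sub>R cgrad \<phi> x + b *\<^sub>R cgrad \<psi> x"
  unfolding cgrad_def
    frechet_derivative_lincomb(2)[OF test_fun_differentiable[OF assms(1)] test_fun_differentiable[OF assms(2)]]
  by (simp add: scaleR_sum_right sum.distrib scaleR_add_left)

section \<open>Weak gradients, the space V and the Dirichlet form\<close>

lemma weak_grad_iff:
  assumes "open D"
  shows "weak_grad D u g \<longleftrightarrow> sqint (lebesgue_on D) g \<and>
     (\<forall>\<phi>. test_fun D \<phi> \<longrightarrow> (\<forall>i\<in>Basis.
        ip (lebesgue_on D) u (\<lambda>x. frechet_derivative \<phi> (at x) i) =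
        - ip (lebesgue_on D) (\<lambda>x. g x \<bullet> i) \<phi>))"
  unfolding weak_grad_def sqint_def ip_def set_integrable_lebesgue_on[OF assms] inner_real_def by simp

lemma sqint_component:
  fixes g :: "'a \<Rightarrow> 'b::euclidean_space"
  assumes "sqint M g" "i \<in> Basis"
  shows "sqint M (\<lambda>x. g x \<bullet> i)"
  by (rule ip_mono(1)[OF assms(1)]) (use assms in \<open>auto simp: sqint_def Basis_le_norm\<close>)

text \<open>Since \<open>wgrad\<close> is a choice, this is what makes \<open>dform\<close> and
  \<open>Vnorm\<close> independent of it. Each component of \<open>g - h\<close> is orthogonal to
  all test functions.\<close>

lemma weak_grad_unique:
  assumes D: "open D" "bounded D" and g: "weak_grad D u g" and h: "weak_grad D u h"
  shows "AE x in lebesgue_on D. g x = h x"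
proof -
  interpret finite_measure "lebesgue_on D" by (rule finite_measure_lebesgue_on) fact+
  have gs: "sqint (lebesgue_on D) g" and hs: "sqint (lebesgue_on D) h"
    using g h weak_grad_iff[OF D(1)] by blast+
  have "AE x in lebesgue_on D. \<forall>i\<in>Basis. g x \<bullet> i - h x \<bullet> i = 0"
  proof (rule AE_ball_countable')
    fix i :: 'a assume i: "i \<in> Basis"
    have gi: "sqint (lebesgue_on D) (\<lambda>x. g x \<bullet> i)" and hi: "sqint (lebesgue_on D) (\<lambda>x. h x \<bullet> i)"
      using sqint_component gs hs i by blast+
    \<comment> \<open>The constant 1 is square integrable because \<open>D\<close> is bounded;
      pairing with it turns square integrability of the difference into integrability.\<close>
    have one: "sqint (lebesgue_on D) (\<lambda>x. 1::real)"
      by (rule sqint_bounded[OF D]) auto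
    show "AE x in lebesgue_on D. g x \<bullet> i - h x \<bullet> i = 0"
    proof (rule fundamental_lemma_variations[OF D(1)])
      show "integrable (lebesgue_on D) (\<lambda>x. g x \<bullet> i - h x \<bullet> i)"
        using sqint_inner[OF sqint_diff[OF gi hi] one] by simp
      fix \<phi> assume \<phi>: "test_fun D \<phi>"
      have "ip (lebesgue_on D) (\<lambda>x. g x \<bullet> i) \<phi> = ip (lebesgue_on D) (\<lambda>x. h x \<bullet> i) \<phi>"
        using conjunct2[OF g[unfolded weak_grad_iff[OF D(1)]], rule_format, OF \<phi> i]
          conjunct2[OF h[unfolded weak_grad_iff[OF D(1)]], rule_format, OF \<phi> i] by linarith
      then have "ip (lebesgue_on D) (\<lambda>x. g x \<bullet> i - h x \<bullet> i) \<phi> = 0"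
        using ip_diff_left[OF gi hi test_fun_sqint[OF D \<phi>]] by simp
      then show "(\<integral>x. (g x \<bullet> i - h x \<bullet> i) * \<phi> x \<partial>lebesgue_on D) = 0" by (simp add: ip_def)
    qed
  qed (simp add: countable_finite)
  then show ?thesis by eventually_elim (auto intro: euclidean_eqI)
qed

lemma sqint_lincomb:
  "sqint M f \<Longrightarrow> sqint M g \<Longrightarrow> sqint M (\<lambda>x. a *\<^sub>R f x + b *\<^sub>R g x)"
  by (intro sqint_add sqint_scale)

lemma ip_lincomb_left:
  "sqint M f \<Longrightarrow> sqint M g \<Longrightarrow> sqint M h \<Longrightarrow>
    ip M (\<lambda>x. a *\<^sub>R f x + b *\<^sub>R g x) h = a * ip M f h + b * ip M g h"
  using ip_add_left[OF sqint_scale sqint_scale, of M f g h a b] by (simp add: ip_scale_left)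

lemma weak_grad_lincomb:
  assumes D: "open D" "bounded D" and u: "L2 D u" "L2 D v"
    and g: "weak_grad D u g" "weak_grad D v h"
  shows "weak_grad D (\<lambda>x. a * u x + b * v x) (\<lambda>x. a *\<^sub>R g x + b *\<^sub>R h x)"
proof -
  have gs: "sqint (lebesgue_on D) g" and hs: "sqint (lebesgue_on D) h"
    using g weak_grad_iff[OF D(1)] by blast+
  have us: "sqint (lebesgue_on D) u" and vs: "sqint (lebesgue_on D) v"
    using u L2_iff_sqint[OF D(1)] by blast+
  show ?thesis
    unfolding weak_grad_iff[OF D(1)]
  proof (intro conjI allI impI ballI)
    show "sqint (lebesgue_on D) (\<lambda>x. a *\<^sub>R g x + b *\<^sub>R h x)" by (rule sqint_lincomb[OF gs hs])
    fix \<phi> and i :: 'a assume \<phi>: "test_fun D \<phi>" and i: "i \<in> Basis"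
    have "ip (lebesgue_on D) (\<lambda>x. a * u x + b * v x) (\<lambda>x. frechet_derivative \<phi> (at x) i) =
      a * ip (lebesgue_on D) u (\<lambda>x. frechet_derivative \<phi> (at x) i) +
      b * ip (lebesgue_on D) v (\<lambda>x. frechet_derivative \<phi> (at x) i)"
      using ip_lincomb_left[OF us vs test_fun_sqint[OF D test_fun_deriv[OF \<phi>]], of a b i] by simp
    also have "\<dots> = - (a * ip (lebesgue_on D) (\<lambda>x. g x \<bullet> i) \<phi> + b * ip (lebesgue_on D) (\<lambda>x. h x \<bullet> i) \<phi>)"
      using g \<phi> i unfolding weak_grad_iff[OF D(1)] by simp
    also have "\<dots> = - ip (lebesgue_on D) (\<lambda>x. (a *\<^sub>R g x + b *\<^sub>R h x) \<bullet> i) \<phi>"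
      using ip_lincomb_left[OF sqint_component[OF gs i] sqint_component[OF hs i] test_fun_sqint[OF D \<phi>], of a b]
      by (simp add: inner_add_left)
    finally show "ip (lebesgue_on D) (\<lambda>x. a * u x + b * v x) (\<lambda>x. frechet_derivative \<phi> (at x) i) =
      - ip (lebesgue_on D) (\<lambda>x. (a *\<^sub>R g x + b *\<^sub>R h x) \<bullet> i) \<phi>" .
  qed
qed

lemma L2_lincomb:
  "open D \<Longrightarrow> L2 D u \<Longrightarrow> L2 D v \<Longrightarrow> L2 D (\<lambda>x. a * u x + b * v x)"
  using sqint_lincomb[of "lebesgue_on D" u v a b] by (simp add: L2_iff_sqint)

lemma sqint_lincomb_norm_tendsto:
  fixes f g :: "nat \<Rightarrow> 'a \<Rightarrow> 'b::euclidean_space"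
  assumes s: "\<And>n. sqint M (f n)" "\<And>n. sqint M (g n)"
    and "(\<lambda>n. sqrt (ip M (f n) (f n))) \<longlonglongrightarrow> 0" "(\<lambda>n. sqrt (ip M (g n) (g n))) \<longlonglongrightarrow> 0"
  shows "(\<lambda>n. sqrt (ip M (\<lambda>x. a *\<^sub>R f n x + b *\<^sub>R g n x) (\<lambda>x. a *\<^sub>R f n x + b *\<^sub>R g n x))) \<longlonglongrightarrow> 0"
proof (rule tendsto_sandwich[where f = "\<lambda>_. 0"])
  have sc: "sqrt (ip M (\<lambda>x. c *\<^sub>R h x) (\<lambda>x. c *\<^sub>R h x)) = \<bar>c\<bar> * sqrt (ip M h h)"
    for c and h :: "'a \<Rightarrow> 'b"
    unfolding ip_def by (simp add: real_sqrt_mult mult.assoc[symmetric])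
  show "\<forall>\<^sub>F n in sequentially. sqrt (ip M (\<lambda>x. a *\<^sub>R f n x + b *\<^sub>R g n x) (\<lambda>x. a *\<^sub>R f n x + b *\<^sub>R g n x))
      \<le> \<bar>a\<bar> * sqrt (ip M (f n) (f n)) + \<bar>b\<bar> * sqrt (ip M (g n) (g n))"
    using ip_triangle[OF sqint_scale[OF s(1)] sqint_scale[OF s(2)], of a _ b] by (simp add: sc)
  have "(\<lambda>n. \<bar>a\<bar> * sqrt (ip M (f n) (f n)) + \<bar>b\<bar> * sqrt (ip M (g n) (g n))) \<longlonglongrightarrow> \<bar>a\<bar> * 0 + \<bar>b\<bar> * 0"
    by (intro tendsto_intros assms)
  then show "(\<lambda>n. \<bar>a\<bar> * sqrt (ip M (f n) (f n)) + \<bar>b\<bar> * sqrt (ip M (g n) (g n))) \<longlonglongrightarrow> 0" by simp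
qed (auto simp: ip_nonneg)

lemma in_V_iff:
  fixes D :: "'a::euclidean_space set"
  assumes D: "open D"
  defines "M \<equiv> lebesgue_on D"
  shows "in_V D u \<longleftrightarrow> L2 D u \<and> (\<exists>g. weak_grad D u g \<and>
     (\<exists>\<phi>s. (\<forall>n. test_fun D (\<phi>s n)) \<and>
        (\<lambda>n. sqrt (ip M (\<lambda>x. \<phi>s n x - u x) (\<lambda>x. \<phi>s n x - u x))) \<longlonglongrightarrow> 0 \<and>
        (\<lambda>n. sqrt (ip M (\<lambda>x. cgrad (\<phi>s n) x - g x) (\<lambda>x. cgrad (\<phi>s n) x - g x))) \<longlonglongrightarrow> 0))"
  unfolding in_V_def l2norm_eq_ip[OF D] set_integrable_lebesgue_on[OF D] M_def
  by (simp add: ip_def power2_norm_eq_inner)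

lemma in_V_lincomb:
  fixes D :: "'a::euclidean_space set"
  assumes D: "open D" "bounded D" and u: "in_V D u" and v: "in_V D v"
  shows "in_V D (\<lambda>x. a * u x + b * v x)"
proof -
  let ?M = "lebesgue_on D"
  obtain g \<phi> where u': "L2 D u" "weak_grad D u g" and \<phi>: "\<And>n. test_fun D (\<phi> n)"
    "(\<lambda>n. sqrt (ip ?M (\<lambda>x. \<phi> n x - u x) (\<lambda>x. \<phi> n x - u x))) \<longlonglongrightarrow> 0"
    "(\<lambda>n. sqrt (ip ?M (\<lambda>x. cgrad (\<phi> n) x - g x) (\<lambda>x. cgrad (\<phi> n) x - g x))) \<longlonglongrightarrow> 0"
    using u unfolding in_V_iff[OF D(1)] by blast
  obtain h \<psi> where v': "L2 D v" "weak_grad D v h" and \<psi>: "\<And>n. test_fun D (\<psi> n)"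
    "(\<lambda>n. sqrt (ip ?M (\<lambda>x. \<psi> n x - v x) (\<lambda>x. \<psi> n x - v x))) \<longlonglongrightarrow> 0"
    "(\<lambda>n. sqrt (ip ?M (\<lambda>x. cgrad (\<psi> n) x - h x) (\<lambda>x. cgrad (\<psi> n) x - h x))) \<longlonglongrightarrow> 0"
    using v unfolding in_V_iff[OF D(1)] by blast
  have s: "sqint ?M u" "sqint ?M v" using u' v' L2_iff_sqint[OF D(1)] by blast+
  have sg: "sqint ?M g" "sqint ?M h" using u' v' weak_grad_iff[OF D(1)] by blast+
  note st = test_fun_sqint[OF D] cgrad_sqint[OF D]
  have A: "(\<lambda>n. sqrt (ip ?M (\<lambda>x. (a * \<phi> n x + b * \<psi> n x) - (a * u x + b * v x))
      (\<lambda>x. (a * \<phi> n x + b * \<psi> n x) - (a * u x + b * v x)))) \<longlonglongrightarrow> 0"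
    using sqint_lincomb_norm_tendsto[OF sqint_diff[OF st(1)[OF \<phi>(1)] s(1)] sqint_diff[OF st(1)[OF \<psi>(1)] s(2)]
        \<phi>(2) \<psi>(2), of a b] by (simp add: algebra_simps)
  have B: "(\<lambda>n. sqrt (ip ?M (\<lambda>x. cgrad (\<lambda>x. a * \<phi> n x + b * \<psi> n x) x - (a *\<^sub>R g x + b *\<^sub>R h x))
      (\<lambda>x. cgrad (\<lambda>x. a * \<phi> n x + b * \<psi> n x) x - (a *\<^sub>R g x + b *\<^sub>R h x)))) \<longlonglongrightarrow> 0"
    unfolding cgrad_lincomb[OF \<phi>(1) \<psi>(1)]
    using sqint_lincomb_norm_tendsto[OF sqint_diff[OF st(2)[OF \<phi>(1)] sg(1)] sqint_diff[OF st(2)[OF \<psi>(1)] sg(2)]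
        \<phi>(3) \<psi>(3), of a b] by (simp add: algebra_simps)
  show ?thesis
    unfolding in_V_iff[OF D(1)]
  proof (intro conjI exI)
    show "L2 D (\<lambda>x. a * u x + b * v x)" by (rule L2_lincomb[OF D(1) u'(1) v'(1)])
    show "weak_grad D (\<lambda>x. a * u x + b * v x) (\<lambda>x. a *\<^sub>R g x + b *\<^sub>R h x)"
      by (rule weak_grad_lincomb[OF D u'(1) v'(1) u'(2) v'(2)])
    show "\<forall>n. test_fun D ((\<lambda>n x. a * \<phi> n x + b * \<psi> n x) n)"
      using test_fun_lincomb[OF \<phi>(1) \<psi>(1)] by simp
  qed (use A B in simp_all)
qed

lemma in_V_L2: "in_V D u \<Longrightarrow> L2 D u"
  by (simp add: in_V_def)

lemma in_V_zero:
  assumes D: "open D" "bounded D"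
  shows "in_V D (\<lambda>x. 0)"
proof -
  have t: "test_fun D (\<lambda>x::'a. 0)"
    using smooth_alg_Ck[OF smooth_const[of 0]] by (auto simp: test_fun_def)
  show ?thesis
    unfolding in_V_iff[OF D(1)]
  proof (intro conjI exI)
    show "L2 D (\<lambda>x. 0)" by (simp add: L2_iff_sqint[OF D(1)] sqint_def)
    show "weak_grad D (\<lambda>x. 0) (\<lambda>x. 0)" by (simp add: weak_grad_iff[OF D(1)] sqint_def ip_def)
    show "\<forall>n. test_fun D ((\<lambda>_ _. 0) n)" using t by simp
  qed (simp_all add: ip_def cgrad_def)
qed

lemma wgrad_weak_grad: "in_V D u \<Longrightarrow> weak_grad D u (wgrad D u)"
  unfolding wgrad_def in_V_def by (metis someI)

lemma wgrad_sqint: "open D \<Longrightarrow> in_V D u \<Longrightarrow> sqint (lebesgue_on D) (wgrad D u)"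
  using wgrad_weak_grad weak_grad_iff by blast

lemma dform_eq_ip: "open D \<Longrightarrow> dform D u v = ip (lebesgue_on D) (wgrad D u) (wgrad D v)"
  by (simp add: dform_def ip_def set_integrable_lebesgue_on)

lemma Vnorm_eq_dform: "open D \<Longrightarrow> Vnorm D u = sqrt (dform D u u)"
  by (simp add: Vnorm_def dform_def power2_norm_eq_inner)

text \<open>The gradient chosen for the combination need not be the combination of the chosen
  gradients, but uniqueness makes them equal almost everywhere, which the integral cannot
  distinguish.\<close>

lemma dform_lincomb:
  assumes D: "open D" "bounded D" and u: "in_V D u" and v: "in_V D v" and w: "in_V D w"
  shows "dform D (\<lambda>x. a * u x + b * v x) w = a * dform D u w + b * dform D v w"
proof -
  let ?M = "lebesgue_on D" and ?l = "\<lambda>x. a * u x + b * v x"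
  let ?g = "\<lambda>x. a *\<^sub>R wgrad D u x + b *\<^sub>R wgrad D v x"
  have l: "in_V D ?l" by (rule in_V_lincomb) fact+
  have "weak_grad D ?l ?g"
    using weak_grad_lincomb[OF D in_V_L2[OF u] in_V_L2[OF v] wgrad_weak_grad[OF u] wgrad_weak_grad[OF v]] .
  then have AE: "AE x in ?M. wgrad D ?l x = ?g x" and gs: "sqint ?M ?g"
    using weak_grad_unique[OF D wgrad_weak_grad[OF l]] weak_grad_iff[OF D(1)] by blast+
  have "dform D ?l w = ip ?M ?g (wgrad D w)"
    unfolding dform_eq_ip[OF D(1)]
    by (rule ip_cong_AE) (use AE gs wgrad_sqint[OF D(1)] l w in auto)
  also have "\<dots> = a * dform D u w + b * dform D v w"
    unfolding dform_eq_ip[OF D(1)]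
    by (rule ip_lincomb_left) (use wgrad_sqint[OF D(1)] u v w in auto)
  finally show ?thesis .
qed

section \<open>The seminorms of H and V on a fixed bounded domain\<close>

locale bounded_domain =
  fixes D :: "'a::euclidean_space set"
  assumes opn: "open D" and bdd: "bounded D"
begin

lemma l2inner_commute: "l2inner D u v = l2inner D v u"
  by (simp add: l2inner_def mult.commute)

lemma dform_commute: "dform D u v = dform D v u"
  by (simp add: dform_def inner_commute)

lemma L2_add: "L2 D u \<Longrightarrow> L2 D v \<Longrightarrow> L2 D (\<lambda>x. u x + v x)"
  using L2_lincomb[OF opn, of u v 1 1] by simp

lemma L2_diff: "L2 D u \<Longrightarrow> L2 D v \<Longrightarrow> L2 D (\<lambda>x. u x - v x)"
  using L2_lincomb[OF opn, of u v 1 "-1"] by simp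

lemma L2_scale: "L2 D u \<Longrightarrow> L2 D (\<lambda>x. c * u x)"
  using L2_lincomb[OF opn, of u u c 0] by simp

lemma l2inner_lincomb:
  "L2 D u \<Longrightarrow> L2 D v \<Longrightarrow> L2 D w \<Longrightarrow>
    l2inner D (\<lambda>x. a * u x + b * v x) w = a * l2inner D u w + b * l2inner D v w"
  using ip_lincomb_left[of "lebesgue_on D" u v w a b] opn by (simp add: l2inner_eq_ip L2_iff_sqint)

lemma l2inner_diff:
  "L2 D u \<Longrightarrow> L2 D v \<Longrightarrow> L2 D w \<Longrightarrow>
    l2inner D (\<lambda>x. u x - v x) w = l2inner D u w - l2inner D v w"
  using l2inner_lincomb[of u v w 1 "-1"] by simp

lemma l2inner_add:
  "L2 D u \<Longrightarrow> L2 D v \<Longrightarrow> L2 D w \<Longrightarrow>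
    l2inner D (\<lambda>x. u x + v x) w = l2inner D u w + l2inner D v w"
  using l2inner_lincomb[of u v w 1 1] by simp

lemma l2inner_scale: "l2inner D (\<lambda>x. c * u x) w = c * l2inner D u w"
  using ip_scale_left[of "lebesgue_on D" c u w] opn by (simp add: l2inner_eq_ip)

lemma dform_diff:
  "in_V D u \<Longrightarrow> in_V D v \<Longrightarrow> in_V D w \<Longrightarrow>
    dform D (\<lambda>x. u x - v x) w = dform D u w - dform D v w"
  using dform_lincomb[OF opn bdd, of u v w 1 "-1"] by simp

lemma dform_scale:
  "in_V D u \<Longrightarrow> in_V D w \<Longrightarrow> dform D (\<lambda>x. c * u x) w = c * dform D u w"
  using dform_lincomb[OF opn bdd, of u u w c 0] by simp

lemma in_V_scale: "in_V D u \<Longrightarrow> in_V D (\<lambda>x. c * u x)"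
  using in_V_lincomb[OF opn bdd, of u u c 0] by simp

lemma in_V_diff: "in_V D u \<Longrightarrow> in_V D v \<Longrightarrow> in_V D (\<lambda>x. u x - v x)"
  using in_V_lincomb[OF opn bdd, of u v 1 "-1"] by simp

lemma l2norm_nonneg: "0 \<le> l2norm D u"
  using opn by (simp add: l2norm_eq_ip ip_nonneg)

lemma l2norm_square: "(l2norm D u)\<^sup>2 = l2inner D u u"
  using opn by (simp add: l2norm_eq_ip l2inner_eq_ip ip_nonneg)

lemma Vnorm_nonneg: "0 \<le> Vnorm D u"
  using opn by (simp add: Vnorm_eq_dform dform_eq_ip ip_nonneg)

lemma Vnorm_square: "(Vnorm D u)\<^sup>2 = dform D u u"
  using opn by (simp add: Vnorm_eq_dform dform_eq_ip ip_nonneg)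

lemma l2inner_self_nonneg: "0 \<le> l2inner D u u"
  using l2norm_square[of u] by (metis zero_le_power2)

lemma dform_self_nonneg: "0 \<le> dform D u u"
  using Vnorm_square[of u] by (metis zero_le_power2)

lemma l2inner_Cauchy_Schwarz:
  "L2 D u \<Longrightarrow> L2 D v \<Longrightarrow> \<bar>l2inner D u v\<bar> \<le> l2norm D u * l2norm D v"
  using ip_Cauchy_Schwarz[of "lebesgue_on D" u v] opn by (simp add: l2norm_eq_ip l2inner_eq_ip L2_iff_sqint)

lemma dform_Cauchy_Schwarz:
  "in_V D u \<Longrightarrow> in_V D v \<Longrightarrow> \<bar>dform D u v\<bar> \<le> Vnorm D u * Vnorm D v"
  using ip_Cauchy_Schwarz[of "lebesgue_on D" "wgrad D u" "wgrad D v"] wgrad_sqint[OF opn] opn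
  by (simp add: Vnorm_eq_dform dform_eq_ip)

lemma l2norm_scale: "l2norm D (\<lambda>x. c * u x) = \<bar>c\<bar> * l2norm D u"
proof -
  have "l2inner D (\<lambda>x. c * u x) (\<lambda>x. c * u x) = c\<^sup>2 * l2inner D u u"
    using l2inner_commute[of u "\<lambda>x. c * u x"] by (simp add: l2inner_scale power2_eq_square)
  then have "(l2norm D (\<lambda>x. c * u x))\<^sup>2 = (\<bar>c\<bar> * l2norm D u)\<^sup>2"
    by (simp add: l2norm_square power_mult_distrib)
  then show ?thesis by (metis abs_ge_zero l2norm_nonneg mult_nonneg_nonneg power2_eq_iff_nonneg)
qed

lemma l2norm_triangle:
  "L2 D u \<Longrightarrow> L2 D v \<Longrightarrow> l2norm D (\<lambda>x. u x + v x) \<le> l2norm D u + l2norm D v"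
  using ip_triangle[of "lebesgue_on D" u v] opn by (simp add: l2norm_eq_ip L2_iff_sqint)

lemma l2norm_minus_commute: "l2norm D (\<lambda>x. u x - v x) = l2norm D (\<lambda>x. v x - u x)"
  unfolding l2norm_def by (simp add: power2_commute)

lemma l2norm_diff_triangle:
  assumes "L2 D u" "L2 D v" "L2 D w"
  shows "l2norm D (\<lambda>x. u x - w x) \<le> l2norm D (\<lambda>x. u x - v x) + l2norm D (\<lambda>x. v x - w x)"
  using l2norm_triangle[OF L2_diff L2_diff, of u v v w] assms by simp

lemma l2norm_le_diff:
  assumes "L2 D u" "L2 D v"
  shows "l2norm D u \<le> l2norm D (\<lambda>x. u x - v x) + l2norm D v"
  using l2norm_triangle[OF L2_diff, of u v v] assms by simp

lemma l2norm_triangle_diff: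
  assumes "L2 D u" "L2 D v"
  shows "l2norm D (\<lambda>x. u x - v x) \<le> l2norm D u + l2norm D v"
  using l2norm_triangle[OF assms(1) L2_scale[OF assms(2)], of "-1"] l2norm_scale[of "-1" v] by simp

lemma Vnorm_triangle_diff:
  assumes "in_V D u" "in_V D v"
  shows "Vnorm D (\<lambda>x. u x - v x) \<le> Vnorm D u + Vnorm D v"
proof (rule power2_le_imp_le)
  have "(Vnorm D (\<lambda>x. u x - v x))\<^sup>2 = dform D u u - 2 * dform D u v + dform D v v"
    using assms by (simp add: Vnorm_square dform_diff in_V_diff dform_commute[of u "\<lambda>x. u x - v x"]
        dform_commute[of v "\<lambda>x. u x - v x"] dform_commute[of v u])
  also have "\<dots> \<le> (Vnorm D u)\<^sup>2 + 2 * (Vnorm D u * Vnorm D v) + (Vnorm D v)\<^sup>2"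
    using dform_Cauchy_Schwarz[OF assms] by (simp add: Vnorm_square)
  finally show "(Vnorm D (\<lambda>x. u x - v x))\<^sup>2 \<le> (Vnorm D u + Vnorm D v)\<^sup>2"
    by (simp add: power2_sum)
qed (simp add: Vnorm_nonneg)

subsection \<open>A regularisation of the square of the norm of H\<close>

text \<open>With \<open>lam > 0\<close>, near-maximisers \<open>z\<close> of \<open>reg_fun lam y\<close> play the role of the resolvent
  \<open>(1 - lam Laplace)\<^sup>-\<^sup>1 y\<close>: up to the tolerance, they depend continuously on \<open>y\<close> as elements of \<open>V\<close>, and no
  completeness of \<open>V\<close> is needed for their existence.\<close>

definition reg_fun :: "real \<Rightarrow> ('a \<Rightarrow> real) \<Rightarrow> ('a \<Rightarrow> real) \<Rightarrow> real" where
  "reg_fun lam y z = 2 * l2inner D y z - l2inner D z z - lam * dform D z z"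

text \<open>By completing the square, this is \<open>|y|^2\<close> minus the infimum over
  \<open>z\<close> in V of \<open>|y - z|^2 + lam * \<parallel>z\<parallel>^2\<close>, a Moreau
  envelope of the Dirichlet energy. Formally it is the pairing of \<open>y\<close> with its
  resolvent image.\<close>

definition reg :: "real \<Rightarrow> ('a \<Rightarrow> real) \<Rightarrow> real" where
  "reg lam y = (SUP z\<in>{z. in_V D z}. reg_fun lam y z)"

lemma reg_fun_le:
  assumes "L2 D y" "in_V D z" "0 \<le> lam"
  shows "reg_fun lam y z \<le> (l2norm D y)\<^sup>2"
proof -
  have z: "L2 D z" by (rule in_V_L2) fact
  have "0 \<le> l2inner D (\<lambda>x. y x - z x) (\<lambda>x. y x - z x)" by (rule l2inner_self_nonneg)
  also have "\<dots> = l2inner D y y - 2 * l2inner D y z + l2inner D z z"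
    using assms z by (simp add: l2inner_diff L2_diff l2inner_commute[of y "\<lambda>x. y x - z x"]
        l2inner_commute[of z "\<lambda>x. y x - z x"] l2inner_commute[of z y])
  finally show ?thesis
    using mult_nonneg_nonneg[OF assms(3) dform_self_nonneg[of z]] by (simp add: reg_fun_def l2norm_square)
qed

lemma bdd_above_reg:
  assumes "L2 D y" "0 \<le> lam"
  shows "bdd_above (reg_fun lam y ` {z. in_V D z})"
  using reg_fun_le[OF assms(1) _ assms(2)] by (intro bdd_aboveI[of _ "(l2norm D y)\<^sup>2"]) auto

lemma reg_upper:
  "L2 D y \<Longrightarrow> 0 \<le> lam \<Longrightarrow> in_V D z \<Longrightarrow> reg_fun lam y z \<le> reg lam y"
  unfolding reg_def by (rule cSUP_upper) (auto intro: bdd_above_reg)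

lemma reg_le: "L2 D y \<Longrightarrow> 0 \<le> lam \<Longrightarrow> reg lam y \<le> (l2norm D y)\<^sup>2"
  unfolding reg_def by (rule cSUP_least) (use in_V_zero[OF opn bdd] reg_fun_le in auto)

lemma reg_near_maximiser:
  assumes "L2 D y" "0 \<le> lam" "0 < e"
  obtains z where "in_V D z" "reg lam y \<le> reg_fun lam y z + e"
proof -
  have "\<exists>x\<in>reg_fun lam y ` {z. in_V D z}. reg lam y - e < x"
    unfolding reg_def
    by (subst less_cSup_iff[symmetric]) (use in_V_zero[OF opn bdd] bdd_above_reg assms in auto)
  then obtain z where "in_V D z" "reg lam y - e < reg_fun lam y z" by auto
  then show ?thesis using that[of z] by simp
qed

text \<open>Moving from \<open>z\<close> to \<open>z + c \<phi>\<close> changes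
  \<open>reg_fun\<close> by \<open>2 * c * R - c\<^sup>2 * N\<close>, where \<open>R\<close> is the
  Euler-Lagrange residual and \<open>N\<close> the weighted square of \<open>\<phi>\<close>.
  Near-maximality allows a gain of at most \<open>e\<close> for every \<open>c\<close>, so the
  discriminant bounds \<open>R\<^sup>2\<close> by \<open>N * e\<close>.\<close>

lemma reg_near_Euler_Lagrange:
  assumes y: "L2 D y" and lam: "0 \<le> lam" and z: "in_V D z" and \<phi>: "in_V D \<phi>"
    and max: "reg lam y \<le> reg_fun lam y z + e"
  shows "(l2inner D y \<phi> - l2inner D z \<phi> - lam * dform D z \<phi>)\<^sup>2
     \<le> (l2inner D \<phi> \<phi> + lam * dform D \<phi> \<phi>) * e"
proof -
  let ?R = "l2inner D y \<phi> - l2inner D z \<phi> - lam * dform D z \<phi>"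
  let ?N = "l2inner D \<phi> \<phi> + lam * dform D \<phi> \<phi>"
  have L: "L2 D z" "L2 D \<phi>" using z \<phi> in_V_L2 by auto
  have "0 \<le> e + 2 * c * (- ?R) + c\<^sup>2 * ?N" for c
  proof -
    let ?w = "\<lambda>x. 1 * z x + c * \<phi> x"
    have w: "in_V D ?w" by (rule in_V_lincomb[OF opn bdd z \<phi>])
    have wL: "L2 D ?w" using w in_V_L2 by blast
    note lin = l2inner_lincomb[OF L] dform_lincomb[OF opn bdd z \<phi>]
    have yw: "l2inner D y ?w = l2inner D y z + c * l2inner D y \<phi>"
      using lin(1)[OF y, of 1 c] l2inner_commute[of y ?w] l2inner_commute[of y z] l2inner_commute[of y \<phi>] by simp
    have zw: "l2inner D z ?w = l2inner D z z + c * l2inner D z \<phi>"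
      and fw: "l2inner D \<phi> ?w = l2inner D z \<phi> + c * l2inner D \<phi> \<phi>"
      using lin(1)[OF L(1), of 1 c] lin(1)[OF L(2), of 1 c]
        l2inner_commute[of z ?w] l2inner_commute[of \<phi> ?w] l2inner_commute[of \<phi> z] by simp_all
    have dzw: "dform D z ?w = dform D z z + c * dform D z \<phi>"
      and dfw: "dform D \<phi> ?w = dform D z \<phi> + c * dform D \<phi> \<phi>"
      using lin(2)[OF z, of 1 c] lin(2)[OF \<phi>, of 1 c]
        dform_commute[of z ?w] dform_commute[of \<phi> ?w] dform_commute[of \<phi> z] by simp_all
    have ww: "l2inner D ?w ?w = l2inner D z z + 2 * c * l2inner D z \<phi> + c\<^sup>2 * l2inner D \<phi> \<phi>"
      unfolding lin(1)[OF wL] zw fw by (simp add: algebra_simps power2_eq_square)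
    have dww: "dform D ?w ?w = dform D z z + 2 * c * dform D z \<phi> + c\<^sup>2 * dform D \<phi> \<phi>"
      unfolding lin(2)[OF w] dzw dfw by (simp add: algebra_simps power2_eq_square)
    have "reg_fun lam y ?w \<le> reg_fun lam y z + e"
      using reg_upper[OF y lam w] max by linarith
    then show ?thesis unfolding reg_fun_def yw ww dww by (simp add: algebra_simps)
  qed
  moreover have "0 \<le> ?N" using l2inner_self_nonneg dform_self_nonneg lam by simp
  ultimately have "(- ?R)\<^sup>2 \<le> ?N * e" by (intro discriminant_le)
  then show ?thesis by (simp only: power2_minus)
qed

text \<open>Only a residual bound \<open>k\<close> enters, not maximality: \<open>z\<close> is
  chosen for one time, and the estimates are wanted for \<open>y\<close> at neighbouring times.
  Testing with \<open>z\<close> gives the first claim, testing with \<open>y - z\<close> the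
  second.\<close>

lemma near_Euler_Lagrange_estimates:
  assumes y: "L2 D y" and lam: "0 < lam" and z: "in_V D z" and k: "0 \<le> k"
    and EL: "\<And>\<phi>. in_V D \<phi> \<Longrightarrow> \<bar>l2inner D y \<phi> - l2inner D z \<phi> - lam * dform D z \<phi>\<bar>
        \<le> k * sqrt (l2inner D \<phi> \<phi> + lam * dform D \<phi> \<phi>)"
  shows "l2norm D z \<le> l2norm D y + k"
    and "in_V D y \<Longrightarrow> - dform D y z \<le> - dform D z z +
      k / lam * (3 * l2norm D y + 2 * k + sqrt lam * Vnorm D y)"
proof -
  define N where "N \<phi> = sqrt (l2inner D \<phi> \<phi> + lam * dform D \<phi> \<phi>)" for \<phi>
  have L: "L2 D z" using z in_V_L2 by auto
  have pos: "0 \<le> l2inner D \<phi> \<phi> + lam * dform D \<phi> \<phi>" for \<phi>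
    using l2inner_self_nonneg dform_self_nonneg lam by simp
  have N2: "(N \<phi>)\<^sup>2 = l2inner D \<phi> \<phi> + lam * dform D \<phi> \<phi>" for \<phi>
    using pos by (simp add: N_def)
  have N0: "0 \<le> N \<phi>" for \<phi> using pos by (simp add: N_def)
  have zN: "l2norm D z \<le> N z" and vN: "sqrt lam * Vnorm D z \<le> N z"
  proof -
    show "l2norm D z \<le> N z"
      by (rule power2_le_imp_le) (use N0 N2 dform_self_nonneg lam in \<open>auto simp: l2norm_square\<close>)
    show "sqrt lam * Vnorm D z \<le> N z"
      by (rule power2_le_imp_le)
         (use N0 N2 l2inner_self_nonneg lam in \<open>auto simp: Vnorm_square power_mult_distrib\<close>)
  qed
  have "(N z)\<^sup>2 \<le> l2inner D y z + k * N z"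
    using EL[OF z] N2[of z] unfolding N_def by linarith
  also have "l2inner D y z \<le> l2norm D y * l2norm D z"
    using l2inner_Cauchy_Schwarz[OF y L] by linarith
  also have "\<dots> \<le> l2norm D y * N z"
    using zN by (intro mult_left_mono l2norm_nonneg)
  finally have "N z * N z \<le> (l2norm D y + k) * N z"
    by (simp add: algebra_simps power2_eq_square)
  then have Nz: "N z \<le> l2norm D y + k"
    using N0[of z] k l2norm_nonneg[of y] by (cases "N z = 0") auto
  then show "l2norm D z \<le> l2norm D y + k" using zN by linarith
  assume yV: "in_V D y"
  let ?\<phi> = "\<lambda>x. y x - z x"
  have \<phi>: "in_V D ?\<phi>" by (rule in_V_diff[OF yV z])
  have \<phi>L: "L2 D ?\<phi>" using \<phi> in_V_L2 by auto
  have d: "dform D z ?\<phi> = dform D y z - dform D z z"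
    using dform_diff[OF yV z z] dform_commute[of z ?\<phi>] by linarith
  \<comment> \<open>The square of \<open>y - z\<close> has the favourable sign and will be dropped.
    Dividing by \<open>lam\<close> then leaves the factor \<open>k / lam\<close>, so
    \<open>k\<close> has to become small with \<open>lam\<close> fixed.\<close>
  have R: "l2inner D y ?\<phi> - l2inner D z ?\<phi> - lam * dform D z ?\<phi>
      = l2inner D ?\<phi> ?\<phi> - lam * dform D y z + lam * dform D z z"
    using l2inner_diff[OF y L \<phi>L] unfolding d by (simp add: algebra_simps)
  have N\<phi>: "N ?\<phi> \<le> l2norm D ?\<phi> + sqrt lam * Vnorm D ?\<phi>"
  proof (rule power2_le_imp_le)
    show "(N ?\<phi>)\<^sup>2 \<le> (l2norm D ?\<phi> + sqrt lam * Vnorm D ?\<phi>)\<^sup>2"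
      unfolding N2 power2_sum using lam l2norm_nonneg[of ?\<phi>] Vnorm_nonneg[of ?\<phi>]
      by (simp add: l2norm_square Vnorm_square power_mult_distrib)
  qed (use lam l2norm_nonneg[of ?\<phi>] Vnorm_nonneg[of ?\<phi>] in simp)
  also have "\<dots> \<le> (l2norm D y + l2norm D z) + sqrt lam * (Vnorm D y + Vnorm D z)"
    using lam by (intro add_mono mult_left_mono l2norm_triangle_diff[OF y L] Vnorm_triangle_diff[OF yV z]) simp
  also have "\<dots> \<le> 3 * l2norm D y + 2 * k + sqrt lam * Vnorm D y"
    using zN vN Nz by (simp add: algebra_simps)
  finally have N\<phi>': "N ?\<phi> \<le> 3 * l2norm D y + 2 * k + sqrt lam * Vnorm D y" .
  have "l2inner D ?\<phi> ?\<phi> - lam * dform D y z + lam * dform D z z \<le> k * N ?\<phi>"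
    using EL[OF \<phi>] unfolding R N_def by linarith
  also have "\<dots> \<le> k * (3 * l2norm D y + 2 * k + sqrt lam * Vnorm D y)"
    using N\<phi>' k by (rule mult_left_mono)
  finally have "lam * (- dform D y z) \<le> lam * (- dform D z z) + k * (3 * l2norm D y + 2 * k + sqrt lam * Vnorm D y)"
    using l2inner_self_nonneg[of ?\<phi>] by (simp add: algebra_simps)
  then have "(lam * (- dform D y z)) / lam \<le>
     (lam * (- dform D z z) + k * (3 * l2norm D y + 2 * k + sqrt lam * Vnorm D y)) / lam"
    using lam by (intro divide_right_mono) auto
  then show "- dform D y z \<le> - dform D z z +
      k / lam * (3 * l2norm D y + 2 * k + sqrt lam * Vnorm D y)"
    using lam by (simp add: add_divide_distrib diff_divide_distrib)
qed

end

subsection \<open>From local to global estimates\<close>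

text \<open>The step length \<open>d / 2\<close> stays strictly below \<open>d\<close>, and
  induction over the number of steps walks from any point back to \<open>a\<close>.\<close>

lemma locally_antimono_imp_le:
  fixes \<Psi> :: "real \<Rightarrow> real"
  assumes "a \<le> b" "0 < d"
    and loc: "\<And>s t. a \<le> s \<Longrightarrow> s < t \<Longrightarrow> t \<le> b \<Longrightarrow> t - s < d \<Longrightarrow> \<Psi> t \<le> \<Psi> s"
  shows "\<Psi> b \<le> \<Psi> a"
proof -
  have step: "\<Psi> t \<le> \<Psi> a" if "a \<le> t" "t \<le> b" "t - a \<le> real n * (d / 2)" for t n
    using that
  proof (induction n arbitrary: t)
    case 0
    then show ?case by auto
  next
    case (Suc n)
    show ?case
    proof (cases "t = a")
      case False
      let ?s = "max a (t - d / 2)"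
      have "\<Psi> t \<le> \<Psi> ?s" using Suc.prems False \<open>0 < d\<close> by (intro loc) (auto simp: max_def)
      also have "\<dots> \<le> \<Psi> a"
        using Suc.prems \<open>0 < d\<close> by (intro Suc.IH) (auto simp: max_def field_simps)
      finally show ?thesis .
    qed simp
  qed
  obtain n :: nat where "(b - a) / (d / 2) \<le> real n" using real_arch_simple by blast
  then have "b - a \<le> real n * (d / 2)" using \<open>0 < d\<close> by (simp add: field_simps)
  then show ?thesis using step[of b n] \<open>a \<le> b\<close> by simp
qed

text \<open>The errors \<open>\<eta> * (H t - H s)\<close> telescope, so together they amount to
  \<open>\<eta>\<close> times the total increment of \<open>H\<close>, and \<open>\<eta>\<close>
  then tends to 0. The restriction \<open>\<eta> < 1\<close> lets an application bound stray
  multiples of \<open>\<eta>\<close> by constants.\<close>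

lemma local_to_global_le:
  fixes \<Phi> K H :: "real \<Rightarrow> real"
  assumes "a \<le> b"
    and loc: "\<And>\<eta>. 0 < \<eta> \<Longrightarrow> \<eta> < 1 \<Longrightarrow> \<exists>d>0. \<forall>s t. a \<le> s \<and> s < t \<and> t \<le> b \<and> t - s < d \<longrightarrow>
        \<Phi> t - \<Phi> s \<le> (K t - K s) + \<eta> * (H t - H s)"
  shows "\<Phi> b - \<Phi> a \<le> K b - K a"
proof -
  have *: "\<Phi> b - \<Phi> a \<le> (K b - K a) + \<eta> * (H b - H a)" if \<eta>: "0 < \<eta>" "\<eta> < 1" for \<eta>
  proof -
    obtain d where d: "d > 0" "\<And>s t. a \<le> s \<Longrightarrow> s < t \<Longrightarrow> t \<le> b \<Longrightarrow> t - s < d \<Longrightarrow>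
        \<Phi> t - \<Phi> s \<le> (K t - K s) + \<eta> * (H t - H s)" using loc[OF \<eta>] by blast
    have "\<Phi> b - K b - \<eta> * H b \<le> \<Phi> a - K a - \<eta> * H a"
      by (rule locally_antimono_imp_le[OF assms(1) d(1), of "\<lambda>t. \<Phi> t - K t - \<eta> * H t"])
         (drule d(2), auto simp: algebra_simps)
    then show ?thesis by (simp add: algebra_simps)
  qed
  have "((\<lambda>\<eta>. (K b - K a) + \<eta> * (H b - H a)) \<longlongrightarrow> (K b - K a) + 0 * (H b - H a)) (at_right 0)"
    by (intro tendsto_intros)
  moreover have "\<forall>\<^sub>F \<eta> in at_right 0. \<Phi> b - \<Phi> a \<le> (K b - K a) + \<eta> * (H b - H a)"
    using eventually_at_right_real[of 0 "1::real", OF zero_less_one] by eventually_elim (use * in auto)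
  ultimately have "\<Phi> b - \<Phi> a \<le> (K b - K a) + 0 * (H b - H a)"
    using tendsto_lowerbound trivial_limit_at_right_real by blast
  then show ?thesis by simp
qed

section \<open>Integrals over time intervals\<close>

lemma set_integrable_Icc_subset:
  assumes "set_integrable lborel {a..b::real} (f :: real \<Rightarrow> real)" "a \<le> c" "d \<le> b"
  shows "set_integrable lborel {c..d} f"
  by (rule set_integrable_subset[OF assms(1)]) (use assms in auto)

lemma set_integral_Icc_split:
  fixes f :: "real \<Rightarrow> real"
  assumes f: "set_integrable lborel {a..c} f" and "a \<le> b" "b \<le> c"
  shows "(LINT x:{a..c}|lborel. f x) = (LINT x:{a..b}|lborel. f x) + (LINT x:{b..c}|lborel. f x)"
proof -
  have i: "set_integrable lborel {a..b} f" "set_integrable lborel {b..c} f"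
    using set_integrable_Icc_subset[OF f] assms by auto
  have "AE x in lborel. x \<noteq> b" by (rule AE_lborel_singleton)
  then have "AE x in lborel. indicator {a..c} x *\<^sub>R f x = indicator {a..b} x *\<^sub>R f x + indicator {b..c} x *\<^sub>R f x"
    by eventually_elim (use assms in \<open>auto simp: indicator_def\<close>)
  then have "(LINT x:{a..c}|lborel. f x) = (\<integral>x. indicator {a..b} x *\<^sub>R f x + indicator {b..c} x *\<^sub>R f x \<partial>lborel)"
    unfolding set_lebesgue_integral_def
    by (intro integral_cong_AE)
       (use f i in \<open>auto simp: set_integrable_def dest!: borel_measurable_integrable\<close>)
  also have "\<dots> = (LINT x:{a..b}|lborel. f x) + (LINT x:{b..c}|lborel. f x)"
    unfolding set_lebesgue_integral_def
    by (rule Bochner_Integration.integral_add) (use i in \<open>simp_all add: set_integrable_def\<close>)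
  finally show ?thesis .
qed

lemma set_integral_mono_lborel_AE:
  fixes f g :: "real \<Rightarrow> real"
  assumes "set_integrable lborel A f" "set_integrable lborel A g"
    and "AE x in lborel. x \<in> A \<longrightarrow> f x \<le> g x"
  shows "(LINT x:A|lborel. f x) \<le> (LINT x:A|lborel. g x)"
  unfolding set_lebesgue_integral_def
proof (rule integral_mono_AE)
  show "AE x in lborel. indicator A x *\<^sub>R f x \<le> indicator A x *\<^sub>R g x"
    using assms(3) by eventually_elim (auto simp: indicator_def)
qed (use assms in \<open>simp_all add: set_integrable_def\<close>)

lemma set_integrable_continuous_Icc:
  fixes f :: "real \<Rightarrow> real"
  assumes "continuous_on {a..b} f"
  shows "set_integrable lborel {a..b} f"
  using borel_integrable_compact[OF compact_Icc assms]
  by (simp add: set_integrable_def)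

text \<open>A null set contains no interval of positive length. This carries inequalities from the
  times at which a path lies in V to all times.\<close>

lemma closure_AE_interval:
  fixes \<tau> T :: real
  assumes "\<tau> < T" and "AE t in lborel. t \<in> {\<tau>..T} \<longrightarrow> Q t"
  shows "closure {t \<in> {\<tau>..T}. Q t} = {\<tau>..T}"
proof
  show "closure {t \<in> {\<tau>..T}. Q t} \<subseteq> {\<tau>..T}" by (rule closure_minimal) auto
  show "{\<tau>..T} \<subseteq> closure {t \<in> {\<tau>..T}. Q t}"
  proof
    fix t assume t: "t \<in> {\<tau>..T}"
    show "t \<in> closure {t \<in> {\<tau>..T}. Q t}"
      unfolding closure_approachable
    proof (intro allI impI)
      fix e :: real assume e: "0 < e"
      let ?a = "max \<tau> (t - e)" and ?b = "min T (t + e)"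
      have ab: "?a < ?b" using t e assms(1) by auto
      show "\<exists>y\<in>{t \<in> {\<tau>..T}. Q t}. dist y t < e"
      proof (rule ccontr)
        assume n: "\<not> ?thesis"
        have n': "\<not> Q x" if "x \<in> {\<tau>..T}" "\<bar>x - t\<bar> < e" for x
          using n that by (auto simp: dist_real_def)
        have "AE x in lborel. x \<notin> {?a<..<?b}"
          using assms(2)
        proof eventually_elim
          case (elim x)
          show ?case
          proof
            assume "x \<in> {?a<..<?b}"
            then have "x \<in> {\<tau>..T}" "\<bar>x - t\<bar> < e" by (auto simp: abs_less_iff)
            then show False using n' elim by blast
          qed
        qed
        then have "emeasure lborel {?a<..<?b} = 0"
          using AE_iff_null_sets[of "{?a<..<?b}" lborel] null_setsD1 by auto
        moreover have "emeasure lborel {?a<..<?b} = ennreal (?b - ?a)"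
          by (rule emeasure_lborel_Ioo) (use ab in linarith)
        ultimately have "?b - ?a \<le> 0" by (metis ennreal_eq_0_iff)
        then show False using ab by linarith
      qed
    qed
  qed
qed

subsection \<open>The energy inequality\<close>

context bounded_domain
begin

lemma l2norm_zero [simp]: "l2norm D (\<lambda>x. 0) = 0"
  by (simp add: l2norm_def set_lebesgue_integral_def)

lemma l2_path_continuous_norm:
  assumes L: "\<And>t. t \<in> I \<Longrightarrow> L2 D (y t)"
    and cont: "\<And>t. t \<in> I \<Longrightarrow> ((\<lambda>s. l2norm D (\<lambda>x. y s x - y t x)) \<longlongrightarrow> 0) (at t within I)"
  shows "continuous_on I (\<lambda>t. l2norm D (y t))"
  unfolding continuous_on_def
proof
  fix t assume t: "t \<in> I"
  show "((\<lambda>t. l2norm D (y t)) \<longlongrightarrow> l2norm D (y t)) (at t within I)"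
  proof (rule Lim_transform_bound[OF _ cont[OF t], THEN LIM_zero_cancel])
    have "\<bar>l2norm D (y s) - l2norm D (y t)\<bar> \<le> \<bar>l2norm D (\<lambda>x. y s x - y t x)\<bar>" if "s \<in> I" for s
      using l2norm_le_diff[OF L[OF that] L[OF t]] l2norm_le_diff[OF L[OF t] L[OF that]]
        l2norm_minus_commute[of "y s" "y t"] by linarith
    then show "\<forall>\<^sub>F s in at t within I. norm (l2norm D (y s) - l2norm D (y t)) \<le> norm (l2norm D (\<lambda>x. y s x - y t x))"
      by (auto simp: eventually_at_filter)
  qed
qed

lemma l2_path_continuous_inner:
  assumes L: "\<And>t. t \<in> I \<Longrightarrow> L2 D (y t)"
    and cont: "\<And>t. t \<in> I \<Longrightarrow> ((\<lambda>s. l2norm D (\<lambda>x. y s x - y t x)) \<longlongrightarrow> 0) (at t within I)"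
    and z: "L2 D z"
  shows "continuous_on I (\<lambda>t. l2inner D (y t) z)"
  unfolding continuous_on_def
proof
  fix t assume t: "t \<in> I"
  have lim: "((\<lambda>s. l2norm D (\<lambda>x. y s x - y t x) * l2norm D z) \<longlongrightarrow> 0) (at t within I)"
    using tendsto_mult_left_zero[OF cont[OF t]] .
  show "((\<lambda>t. l2inner D (y t) z) \<longlongrightarrow> l2inner D (y t) z) (at t within I)"
  proof (rule Lim_transform_bound[OF _ lim, THEN LIM_zero_cancel])
    have "\<bar>l2inner D (y s) z - l2inner D (y t) z\<bar> \<le> \<bar>l2norm D (\<lambda>x. y s x - y t x) * l2norm D z\<bar>" if "s \<in> I" for s
      using l2inner_Cauchy_Schwarz[OF L2_diff[OF L[OF that] L[OF t]] z] l2inner_diff[OF L[OF that] L[OF t] z]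
      by linarith
    then show "\<forall>\<^sub>F s in at t within I. norm (l2inner D (y s) z - l2inner D (y t) z) \<le>
        norm (l2norm D (\<lambda>x. y s x - y t x) * l2norm D z)"
      by (auto simp: eventually_at_filter)
  qed
qed

text \<open>The path takes values in plain functions measured by the seminorm \<open>l2norm\<close>,
  so the Heine-Cantor argument is carried out by subsequences.\<close>

lemma l2_path_uniformly_continuous:
  fixes I :: "real set"
  assumes I: "compact I" and L: "\<And>t. t \<in> I \<Longrightarrow> L2 D (y t)"
    and cont: "\<And>t. t \<in> I \<Longrightarrow> ((\<lambda>s. l2norm D (\<lambda>x. y s x - y t x)) \<longlongrightarrow> 0) (at t within I)"
    and e: "0 < e"
  shows "\<exists>d>0. \<forall>s\<in>I. \<forall>t\<in>I. \<bar>s - t\<bar> < d \<longrightarrow> l2norm D (\<lambda>x. y s x - y t x) < e"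
proof (rule ccontr)
  assume n: "\<not> ?thesis"
  have "\<exists>s t. s \<in> I \<and> t \<in> I \<and> \<bar>s - t\<bar> < inverse (real (Suc n)) \<and> e \<le> l2norm D (\<lambda>x. y s x - y t x)" for n
  proof -
    have "0 < inverse (real (Suc n))" by simp
    with n show ?thesis by (meson not_less)
  qed
  then obtain p q where pq: "\<And>n. p n \<in> I" "\<And>n. q n \<in> I" "\<And>n. \<bar>p n - q n\<bar> < inverse (real (Suc n))"
    "\<And>n. e \<le> l2norm D (\<lambda>x. y (p n) x - y (q n) x)" by metis
  obtain r \<sigma> where r: "r \<in> I" "strict_mono \<sigma>" "(p \<circ> \<sigma>) \<longlonglongrightarrow> r"
    using I pq(1) unfolding compact_def by blast
  have "(\<lambda>n. p n - q n) \<longlonglongrightarrow> 0"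
    by (rule Lim_null_comparison[OF _ LIMSEQ_inverse_real_of_nat])
       (use pq(3) in \<open>auto intro!: always_eventually less_imp_le\<close>)
  then have "((\<lambda>n. p n - q n) \<circ> \<sigma>) \<longlonglongrightarrow> 0" using r(2) by (rule LIMSEQ_subseq_LIMSEQ)
  from tendsto_diff[OF r(3) this] have q: "(q \<circ> \<sigma>) \<longlonglongrightarrow> r" by (simp add: o_def)
  let ?N = "\<lambda>s. l2norm D (\<lambda>x. y s x - y r x)"
  have cN: "continuous (at r within I) ?N"
    using cont[OF r(1)] by (simp add: continuous_within)
  have "(?N \<circ> (p \<circ> \<sigma>)) \<longlonglongrightarrow> 0" "(?N \<circ> (q \<circ> \<sigma>)) \<longlonglongrightarrow> 0"
    using cN[unfolded continuous_within_sequentially, rule_format] r(3) q pq(1,2)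
    by auto
  then have "(\<lambda>n. ?N (p (\<sigma> n)) + ?N (q (\<sigma> n))) \<longlonglongrightarrow> 0 + 0"
    unfolding o_def by (rule tendsto_add)
  moreover have "e \<le> ?N (p (\<sigma> n)) + ?N (q (\<sigma> n))" for n
    using pq(4)[of "\<sigma> n"] l2norm_diff_triangle[OF L[OF pq(1)] L[OF r(1)] L[OF pq(2)], of "\<sigma> n" "\<sigma> n"]
      l2norm_minus_commute[of "y r" "y (q (\<sigma> n))"] by linarith
  ultimately have "e \<le> 0 + 0"
    by (intro tendsto_lowerbound[of _ _ sequentially]) auto
  then show False using e by simp
qed

end

lemma continuous_on_Icc_bounded:
  fixes f :: "real \<Rightarrow> real"
  assumes "continuous_on {a..b} f"
  shows "\<exists>M. \<forall>r\<in>{a..b}. f r \<le> M"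
proof -
  have "bounded (f ` {a..b})"
    by (rule compact_imp_bounded[OF compact_continuous_image[OF assms compact_Icc]])
  then obtain M where "\<forall>x\<in>f ` {a..b}. \<bar>x\<bar> \<le> M" unfolding bounded_real by blast
  then have "\<bar>f r\<bar> \<le> M" if "r \<in> {a..b}" for r using that by blast
  then have "\<forall>r\<in>{a..b}. f r \<le> M" by (meson abs_le_D1)
  then show ?thesis by blast
qed

context bounded_domain
begin

text \<open>\<open>G r z\<close> stands for the right-hand side of the equation tested with
  \<open>z\<close>. The dissipation is spent entirely on the \<open>\<beta>\<close> term, hence the
  quotient \<open>(\<beta> r)\<^sup>2 / (2 * m)\<close>. The integrable majorant \<open>h\<close>
  replaces the squared V-norm along the path, whose measurability is not assumed.\<close>

lemma energy_inequality:
  fixes y :: "real \<Rightarrow> 'a \<Rightarrow> real" and G :: "real \<Rightarrow> ('a \<Rightarrow> real) \<Rightarrow> real"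
    and \<beta> \<gamma> b h :: "real \<Rightarrow> real"
  assumes \<tau>T: "\<tau> < T"
    and L: "\<And>t. t \<in> {\<tau>..T} \<Longrightarrow> L2 D (y t)"
    and cont: "\<And>t. t \<in> {\<tau>..T} \<Longrightarrow> ((\<lambda>s. l2norm D (\<lambda>x. y s x - y t x)) \<longlongrightarrow> 0) (at t within {\<tau>..T})"
    and V: "AE t in lborel. t \<in> {\<tau>..T} \<longrightarrow> in_V D (y t) \<and> (Vnorm D (y t))\<^sup>2 \<le> h t"
    and h: "set_integrable lborel {\<tau>..T} h"
    and weak_int: "\<And>z s t. in_V D z \<Longrightarrow> \<tau> \<le> s \<Longrightarrow> s \<le> t \<Longrightarrow> t \<le> T \<Longrightarrow> set_integrable lborel {s..t} (\<lambda>r. G r z)"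
    and weak_eq: "\<And>z s t. in_V D z \<Longrightarrow> \<tau> \<le> s \<Longrightarrow> s \<le> t \<Longrightarrow> t \<le> T \<Longrightarrow>
       l2inner D (y t) z - l2inner D (y s) z = (LINT r:{s..t}|lborel. G r z)"
    and G: "AE r in lborel. r \<in> {\<tau>..T} \<longrightarrow> (\<forall>z. in_V D z \<longrightarrow>
       G r z \<le> - b r * dform D (y r) z + \<beta> r * Vnorm D z + \<gamma> r * l2norm D z)"
    and b: "0 < m" "\<And>r. r \<in> {\<tau>..T} \<Longrightarrow> m \<le> b r" "\<And>r. r \<in> {\<tau>..T} \<Longrightarrow> b r \<le> m'"
    and \<beta>: "continuous_on {\<tau>..T} \<beta>"
    and \<gamma>: "continuous_on {\<tau>..T} \<gamma>" "\<And>r. r \<in> {\<tau>..T} \<Longrightarrow> 0 \<le> \<gamma> r"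
    and t0: "t0 \<in> {\<tau>..T}"
  shows "(l2norm D (y t0))\<^sup>2 \<le> (l2norm D (y \<tau>))\<^sup>2 +
     integral {\<tau>..t0} (\<lambda>r. (\<beta> r)\<^sup>2 / (2 * m) + 2 * \<gamma> r * l2norm D (y r))"
proof -
  define Y where "Y r = l2norm D (y r)" for r
  define k where "k r = (\<beta> r)\<^sup>2 / (2 * m) + 2 * \<gamma> r * Y r" for r
  have Yc: "continuous_on {\<tau>..T} Y"
    unfolding Y_def by (rule l2_path_continuous_norm[OF L cont])
  have kc: "continuous_on {\<tau>..T} k"
    unfolding k_def using b(1) by (intro continuous_intros Yc \<beta> \<gamma>) auto
  have ki: "set_integrable lborel {\<tau>..T} k" by (rule set_integrable_continuous_Icc[OF kc])
  have Y0: "0 \<le> Y r" for r by (simp add: Y_def l2norm_nonneg)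
  obtain M where M: "\<And>r. r \<in> {\<tau>..T} \<Longrightarrow> Y r \<le> M"
    using continuous_on_Icc_bounded[OF Yc] by blast
  obtain \<Gamma> where \<Gamma>: "\<And>r. r \<in> {\<tau>..T} \<Longrightarrow> \<gamma> r \<le> \<Gamma>"
    using continuous_on_Icc_bounded[OF \<gamma>(1)] by blast
  have m': "0 < m'" using b(1) b(2)[of \<tau>] b(3)[of \<tau>] \<tau>T by auto
  have HK: "(LINT r:{\<tau>..t}|lborel. k r) = integral {\<tau>..t} k" if "t \<le> T" for t
    by (rule set_borel_integral_eq_integral(2)[OF set_integrable_Icc_subset[OF ki]]) (use that in auto)
  have reg_bound: "reg lam (y t) - reg lam (y \<tau>) \<le> (LINT r:{\<tau>..t}|lborel. k r)"
    if lam: "0 < lam" and t: "t \<in> {\<tau>..T}" for lam t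
  proof -
    \<comment> \<open>The error per unit of \<open>\<eta>\<close>. It blows up as \<open>lam\<close>
      tends to 0, which is harmless because \<open>lam\<close> is fixed until \<open>\<eta>\<close>
      has gone to 0. The bound \<open>\<Gamma>\<close> pays for replacing \<open>l2norm D z\<close>
      by \<open>Y r + \<eta>\<close>.\<close>
    define C where "C r = 2 * m' / lam * (3 * M + 2 + lam + h r) + 2 * \<Gamma>" for r
    have Ci: "set_integrable lborel {\<tau>..T} C"
    proof -
      have "set_integrable lborel {\<tau>..T} (\<lambda>r. (2 * m' / lam * (3 * M + 2 + lam) + 2 * \<Gamma>) + 2 * m' / lam * h r)"
        by (intro set_integral_add(1) set_integrable_mult_right h set_integrable_continuous_Icc continuous_on_const)
      then show ?thesis unfolding C_def by (simp add: algebra_simps)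
    qed
    let ?K = "\<lambda>t. LINT r:{\<tau>..t}|lborel. k r" and ?H = "\<lambda>t. (LINT r:{\<tau>..t}|lborel. C r) + t"
    have "reg lam (y t) - reg lam (y \<tau>) \<le> ?K t - ?K \<tau>"
    proof (rule local_to_global_le[where H = ?H])
      show "\<tau> \<le> t" using t by simp
      fix \<eta> :: real assume \<eta>: "0 < \<eta>" "\<eta> < 1"
      obtain d where d: "d > 0" "\<And>s t. s \<in> {\<tau>..T} \<Longrightarrow> t \<in> {\<tau>..T} \<Longrightarrow> \<bar>s - t\<bar> < d \<Longrightarrow>
          l2norm D (\<lambda>x. y s x - y t x) < \<eta> / 2"
        using l2_path_uniformly_continuous[OF compact_Icc L cont half_gt_zero[OF \<eta>(1)]] by blast
      show "\<exists>d>0. \<forall>s t'. \<tau> \<le> s \<and> s < t' \<and> t' \<le> t \<and> t' - s < d \<longrightarrow>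
        reg lam (y t') - reg lam (y s) \<le> (?K t' - ?K s) + \<eta> * (?H t' - ?H s)"
      proof (intro exI[of _ d] conjI allI impI)
        show "0 < d" by (rule d(1))
        fix s t' assume A: "\<tau> \<le> s \<and> s < t' \<and> t' \<le> t \<and> t' - s < d"
        then have st: "\<tau> \<le> s" "s < t'" "t' \<le> T" "t' - s < d" "s \<in> {\<tau>..T}" "t' \<in> {\<tau>..T}" using t by auto
        \<comment> \<open>The first entry makes the Euler-Lagrange residual at most
          \<open>\<eta> / 2\<close>; the second makes the additive error telescope, which is why
          \<open>?H\<close> contains the summand \<open>t\<close>.\<close>
        define e where "e = min ((\<eta> / 2)\<^sup>2) (\<eta> * (t' - s))"
        have e: "0 < e" using \<eta> st by (auto simp: e_def)
        obtain z where z: "in_V D z" "reg lam (y t') \<le> reg_fun lam (y t') z + e"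
          using reg_near_maximiser[OF L[OF st(6)] less_imp_le[OF lam] e] by blast
        have zL: "L2 D z" using z in_V_L2 by blast
        \<comment> \<open>The same \<open>z\<close> competes at time \<open>s\<close>, so the terms
          quadratic in \<open>z\<close> cancel and a pairing with a fixed test function
          remains.\<close>
        have "reg lam (y t') - reg lam (y s) \<le> reg_fun lam (y t') z + e - reg_fun lam (y s) z"
          using z(2) reg_upper[OF L[OF st(5)] less_imp_le[OF lam] z(1)] by linarith
        also have "\<dots> = 2 * (l2inner D (y t') z - l2inner D (y s) z) + e"
          by (simp add: reg_fun_def)
        also have "\<dots> = (LINT r:{s..t'}|lborel. 2 * G r z) + e"
          using weak_eq[OF z(1) st(1) _ st(3)] st(2) by simp
        also have "(LINT r:{s..t'}|lborel. 2 * G r z) \<le> (LINT r:{s..t'}|lborel. k r + \<eta> * C r)"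
        proof (rule set_integral_mono_lborel_AE)
          show "set_integrable lborel {s..t'} (\<lambda>r. 2 * G r z)"
            using weak_int[OF z(1) st(1) _ st(3)] st(2) by simp
          show "set_integrable lborel {s..t'} (\<lambda>r. k r + \<eta> * C r)"
            by (intro set_integral_add(1) set_integrable_mult_right set_integrable_Icc_subset[OF ki]
                set_integrable_Icc_subset[OF Ci]) (use st in auto)
          show "AE r in lborel. r \<in> {s..t'} \<longrightarrow> 2 * G r z \<le> k r + \<eta> * C r"
            using V G
          proof eventually_elim
            case (elim r)
            show ?case
            proof
              assume "r \<in> {s..t'}"
              then have r: "r \<in> {\<tau>..T}" "\<bar>r - t'\<bar> < d" using st by auto
              have yV: "in_V D (y r)" "(Vnorm D (y r))\<^sup>2 \<le> h r"
                and Gr: "G r z \<le> - b r * dform D (y r) z + \<beta> r * Vnorm D z + \<gamma> r * l2norm D z"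
                using elim r(1) z(1) by auto
              \<comment> \<open>Half of \<open>\<eta>\<close> comes from near-maximality at
                \<open>t'\<close>, the other half from moving from \<open>t'\<close> to
                \<open>r\<close> by uniform continuity of \<open>y\<close>.\<close>
              have EL: "\<bar>l2inner D (y r) \<phi> - l2inner D z \<phi> - lam * dform D z \<phi>\<bar>
                  \<le> \<eta> * sqrt (l2inner D \<phi> \<phi> + lam * dform D \<phi> \<phi>)" if \<phi>: "in_V D \<phi>" for \<phi>
              proof -
                let ?N = "l2inner D \<phi> \<phi> + lam * dform D \<phi> \<phi>"
                have \<phi>L: "L2 D \<phi>" using \<phi> in_V_L2 by blast
                have N0: "0 \<le> ?N" using l2inner_self_nonneg dform_self_nonneg lam by simp
                have le: "l2norm D \<phi> \<le> sqrt ?N"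
                  by (rule real_le_rsqrt) (use dform_self_nonneg lam in \<open>simp add: l2norm_square\<close>)
                have "(l2inner D (y t') \<phi> - l2inner D z \<phi> - lam * dform D z \<phi>)\<^sup>2 \<le> ?N * e"
                  by (rule reg_near_Euler_Lagrange[OF L[OF st(6)] less_imp_le[OF lam] z(1) \<phi> z(2)])
                also have "\<dots> \<le> ?N * (\<eta> / 2)\<^sup>2"
                  using N0 by (intro mult_left_mono) (auto simp: e_def)
                finally have "\<bar>l2inner D (y t') \<phi> - l2inner D z \<phi> - lam * dform D z \<phi>\<bar> \<le> sqrt (?N * (\<eta> / 2)\<^sup>2)"
                  using real_le_rsqrt by (metis power2_abs)
                also have "\<dots> = \<eta> / 2 * sqrt ?N" using \<eta> by (simp add: real_sqrt_mult)
                finally have 1: "\<bar>l2inner D (y t') \<phi> - l2inner D z \<phi> - lam * dform D z \<phi>\<bar> \<le> \<eta> / 2 * sqrt ?N" .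
                have "\<bar>l2inner D (y r) \<phi> - l2inner D (y t') \<phi>\<bar> \<le> l2norm D (\<lambda>x. y r x - y t' x) * l2norm D \<phi>"
                  using l2inner_Cauchy_Schwarz[OF L2_diff[OF L[OF r(1)] L[OF st(6)]] \<phi>L]
                    l2inner_diff[OF L[OF r(1)] L[OF st(6)] \<phi>L] by simp
                also have "\<dots> \<le> \<eta> / 2 * sqrt ?N"
                  by (rule mult_mono) (use d(2)[OF r(1) st(6) r(2)] le \<eta> in \<open>auto simp: l2norm_nonneg\<close>)
                finally have 2: "\<bar>l2inner D (y r) \<phi> - l2inner D (y t') \<phi>\<bar> \<le> \<eta> / 2 * sqrt ?N" .
                have "\<eta> * sqrt ?N = \<eta> / 2 * sqrt ?N + \<eta> / 2 * sqrt ?N" by simp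
                then show ?thesis using 1 2 by linarith
              qed
              note est = near_Euler_Lagrange_estimates[OF L[OF r(1)] lam z(1) less_imp_le[OF \<eta>(1)] EL]
              have dz: "- dform D (y r) z \<le> - dform D z z +
                  \<eta> / lam * (3 * Y r + 2 * \<eta> + sqrt lam * Vnorm D (y r))"
                using est(2) yV(1) by (simp add: Y_def)
              have zY: "l2norm D z \<le> Y r + \<eta>" using est(1) by (simp add: Y_def)
              \<comment> \<open>The arithmetic-geometric mean inequality trades the V-norm for its
                integrable majorant \<open>h\<close>.\<close>
              have "sqrt lam * Vnorm D (y r) \<le> lam + h r"
              proof -
                have "0 \<le> (sqrt lam - Vnorm D (y r))\<^sup>2" by simp
                then have "2 * (sqrt lam * Vnorm D (y r)) \<le> lam + (Vnorm D (y r))\<^sup>2"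
                  using lam by (simp add: power2_diff)
                moreover have "0 \<le> sqrt lam * Vnorm D (y r)" using lam Vnorm_nonneg by simp
                ultimately show ?thesis using yV(2) by linarith
              qed
              then have "3 * Y r + 2 * \<eta> + sqrt lam * Vnorm D (y r) \<le> 3 * M + 2 + lam + h r"
                using M[OF r(1)] \<eta> by linarith
              then have "\<eta> / lam * (3 * Y r + 2 * \<eta> + sqrt lam * Vnorm D (y r)) \<le> \<eta> / lam * (3 * M + 2 + lam + h r)"
                using \<eta> lam by (intro mult_left_mono) auto
              then have dz': "- dform D (y r) z \<le> - dform D z z + \<eta> / lam * (3 * M + 2 + lam + h r)"
                using dz by linarith
              have pos: "0 \<le> \<eta> / lam * (3 * M + 2 + lam + h r)"
                using \<eta> lam M[OF r(1)] Y0[of r] order_trans[OF zero_le_power2 yV(2)]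
                by (intro mult_nonneg_nonneg) auto
              have bpos: "0 \<le> b r" using b(1) b(2)[OF r(1)] by linarith
              have "- b r * dform D (y r) z \<le> b r * (- dform D z z + \<eta> / lam * (3 * M + 2 + lam + h r))"
                using mult_left_mono[OF dz' bpos] by simp
              also have "\<dots> = - (b r * dform D z z) + b r * (\<eta> / lam * (3 * M + 2 + lam + h r))"
                by (simp add: algebra_simps)
              also have "\<dots> \<le> - (m * dform D z z) + m' * (\<eta> / lam * (3 * M + 2 + lam + h r))"
                using mult_right_mono[OF b(2)[OF r(1)] dform_self_nonneg[of z]] mult_right_mono[OF b(3)[OF r(1)] pos]
                by linarith
              finally have t1: "- b r * dform D (y r) z \<le> - (m * (Vnorm D z)\<^sup>2) + m' * (\<eta> / lam * (3 * M + 2 + lam + h r))"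
                by (simp add: Vnorm_square)
              \<comment> \<open>Young's inequality, weighted so that the square cancels twice the
                dissipation in \<open>t1\<close> exactly.\<close>
              have t2: "2 * (\<beta> r * Vnorm D z) \<le> 2 * (m * (Vnorm D z)\<^sup>2) + (\<beta> r)\<^sup>2 / (2 * m)"
              proof -
                have "0 \<le> (2 * m * Vnorm D z - \<beta> r)\<^sup>2 / (2 * m)" using b(1) by simp
                also have "\<dots> = 2 * (m * (Vnorm D z)\<^sup>2) - 2 * (\<beta> r * Vnorm D z) + (\<beta> r)\<^sup>2 / (2 * m)"
                  using b(1) by (simp add: power2_diff field_simps power2_eq_square)
                finally show ?thesis by linarith
              qed
              have "\<gamma> r * l2norm D z \<le> \<gamma> r * (Y r + \<eta>)"
                using \<gamma>(2)[OF r(1)] zY by (rule mult_left_mono[rotated])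
              also have "\<dots> \<le> \<gamma> r * Y r + \<Gamma> * \<eta>"
                using mult_right_mono[OF \<Gamma>[OF r(1)], of \<eta>] \<eta> by (simp add: algebra_simps)
              finally have t3: "\<gamma> r * l2norm D z \<le> \<gamma> r * Y r + \<Gamma> * \<eta>" .
              have "2 * G r z \<le> 2 * (m' * (\<eta> / lam * (3 * M + 2 + lam + h r))) + (\<beta> r)\<^sup>2 / (2 * m)
                  + 2 * (\<gamma> r * Y r) + 2 * (\<Gamma> * \<eta>)"
                using Gr t1 t2 t3 by linarith
              also have "\<dots> = k r + \<eta> * C r" by (simp add: k_def C_def algebra_simps)
              finally show "2 * G r z \<le> k r + \<eta> * C r" .
            qed
          qed
        qed
        also have "(LINT r:{s..t'}|lborel. k r + \<eta> * C r) = (LINT r:{s..t'}|lborel. k r) + \<eta> * (LINT r:{s..t'}|lborel. C r)"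
          using set_integrable_Icc_subset[OF ki, of s t'] set_integrable_Icc_subset[OF Ci, of s t'] st
          by (simp add: set_integral_add)
        also have "(LINT r:{s..t'}|lborel. k r) = ?K t' - ?K s"
          using set_integral_Icc_split[OF set_integrable_Icc_subset[OF ki], of \<tau> t' s] st by simp
        also have "(LINT r:{s..t'}|lborel. C r) = (LINT r:{\<tau>..t'}|lborel. C r) - (LINT r:{\<tau>..s}|lborel. C r)"
          using set_integral_Icc_split[OF set_integrable_Icc_subset[OF Ci], of \<tau> t' s] st by simp
        finally have "reg lam (y t') - reg lam (y s) \<le> (?K t' - ?K s)
           + \<eta> * ((LINT r:{\<tau>..t'}|lborel. C r) - (LINT r:{\<tau>..s}|lborel. C r)) + e" by simp
        moreover have "e \<le> \<eta> * (t' - s)" by (simp add: e_def)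
        ultimately show "reg lam (y t') - reg lam (y s) \<le> (?K t' - ?K s) + \<eta> * (?H t' - ?H s)"
          by (simp add: algebra_simps)
      qed
    qed
    moreover have "?K \<tau> = 0" using HK[of \<tau>] \<tau>T by simp
    ultimately show ?thesis by simp
  qed
  \<comment> \<open>When \<open>y t\<close> lies in V it is itself a competitor, so
    \<open>reg\<close> recovers its squared norm up to \<open>lam\<close> times its Dirichlet
    energy. The integral on the right no longer depends on \<open>lam\<close>, so \<open>lam\<close>
    may tend to 0.\<close>
  have on_V: "(Y t)\<^sup>2 \<le> (Y \<tau>)\<^sup>2 + (LINT r:{\<tau>..t}|lborel. k r)" if t: "t \<in> {\<tau>..T}" and tV: "in_V D (y t)" for t
  proof -
    have *: "(Y t)\<^sup>2 - lam * dform D (y t) (y t) \<le> (Y \<tau>)\<^sup>2 + (LINT r:{\<tau>..t}|lborel. k r)" if "0 < lam" for lam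
    proof -
      have "(Y t)\<^sup>2 - lam * dform D (y t) (y t) = reg_fun lam (y t) (y t)"
        by (simp add: reg_fun_def Y_def l2norm_square)
      also have "\<dots> \<le> reg lam (y t)" using reg_upper[OF L[OF t] less_imp_le[OF that] tV] .
      also have "\<dots> \<le> reg lam (y \<tau>) + (LINT r:{\<tau>..t}|lborel. k r)" using reg_bound[OF that t] by simp
      also have "reg lam (y \<tau>) \<le> (Y \<tau>)\<^sup>2"
        unfolding Y_def using L[of \<tau>] \<tau>T that by (intro reg_le) auto
      finally show ?thesis by simp
    qed
    have "((\<lambda>lam. (Y t)\<^sup>2 - lam * dform D (y t) (y t)) \<longlongrightarrow> (Y t)\<^sup>2 - 0 * dform D (y t) (y t)) (at_right 0)"
      by (intro tendsto_intros)
    moreover have "\<forall>\<^sub>F lam in at_right 0. (Y t)\<^sup>2 - lam * dform D (y t) (y t) \<le> (Y \<tau>)\<^sup>2 + (LINT r:{\<tau>..t}|lborel. k r)"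
      using eventually_at_right_less[of 0] by eventually_elim (use * in auto)
    ultimately have "(Y t)\<^sup>2 - 0 * dform D (y t) (y t) \<le> (Y \<tau>)\<^sup>2 + (LINT r:{\<tau>..t}|lborel. k r)"
      using tendsto_upperbound trivial_limit_at_right_real by blast
    then show ?thesis by simp
  qed
  have cl: "closure {t \<in> {\<tau>..T}. in_V D (y t)} = {\<tau>..T}"
    by (rule closure_AE_interval[OF \<tau>T]) (use V in \<open>auto elim: eventually_mono\<close>)
  have "0 \<le> (Y \<tau>)\<^sup>2 + integral {\<tau>..t0} k - (Y t0)\<^sup>2"
  proof (rule continuous_ge_on_closure[where S = "{t \<in> {\<tau>..T}. in_V D (y t)}" and f = "\<lambda>t. (Y \<tau>)\<^sup>2 + integral {\<tau>..t} k - (Y t)\<^sup>2"])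
    show "continuous_on (closure {t \<in> {\<tau>..T}. in_V D (y t)}) (\<lambda>t. (Y \<tau>)\<^sup>2 + integral {\<tau>..t} k - (Y t)\<^sup>2)"
      unfolding cl
      by (intro continuous_intros Yc indefinite_integral_continuous_1 integrable_continuous_real kc)
    show "t0 \<in> closure {t \<in> {\<tau>..T}. in_V D (y t)}" using t0 cl by simp
    fix t assume "t \<in> {t \<in> {\<tau>..T}. in_V D (y t)}"
    then show "0 \<le> (Y \<tau>)\<^sup>2 + integral {\<tau>..t} k - (Y t)\<^sup>2" using on_V[of t] HK[of t] by simp
  qed
  then show ?thesis by (simp add: Y_def k_def[abs_def])
qed

end

subsection \<open>Calculus in time\<close>

lemma set_integrable_continuous_mult:
  fixes e G :: "real \<Rightarrow> real"
  assumes e: "continuous_on {a..b} e" and G: "set_integrable lborel {a..b} G"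
  shows "set_integrable lborel {a..b} (\<lambda>r. e r * G r)"
proof -
  obtain B where B: "\<forall>r\<in>{a..b}. \<bar>e r\<bar> \<le> B"
    using continuous_on_Icc_bounded[OF continuous_on_rabs[OF e]] by blast
  have em: "(\<lambda>r. indicator {a..b} r *\<^sub>R e r) \<in> borel_measurable lborel"
    using set_integrable_continuous_Icc[OF e] unfolding set_integrable_def
    by (rule borel_measurable_integrable)
  have Gm: "(\<lambda>r. indicator {a..b} r *\<^sub>R G r) \<in> borel_measurable lborel"
    using G unfolding set_integrable_def by (rule borel_measurable_integrable)
  have eq: "(\<lambda>r. indicator {a..b} r *\<^sub>R (e r * G r)) =
      (\<lambda>r. (indicator {a..b} r *\<^sub>R e r) * (indicator {a..b} r *\<^sub>R G r))"
    by (auto simp: indicator_def)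
  show ?thesis
    unfolding set_integrable_def
  proof (rule Bochner_Integration.integrable_bound)
    show "integrable lborel (\<lambda>r. B * (indicator {a..b} r *\<^sub>R G r))"
      using G unfolding set_integrable_def by (rule integrable_mult_right)
    show "(\<lambda>r. indicator {a..b} r *\<^sub>R (e r * G r)) \<in> borel_measurable lborel"
      unfolding eq using em Gm by (rule borel_measurable_times)
    show "AE r in lborel. norm (indicator {a..b} r *\<^sub>R (e r * G r)) \<le> norm (B * (indicator {a..b} r *\<^sub>R G r))"
    proof (rule AE_I2)
      fix r
      show "norm (indicator {a..b} r *\<^sub>R (e r * G r)) \<le> norm (B * (indicator {a..b} r *\<^sub>R G r))"
      proof (cases "r \<in> {a..b}")
        case True
        then have "\<bar>e r\<bar> \<le> \<bar>B\<bar>" using B abs_ge_self[of B] order_trans by blast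
        then show ?thesis using True by (simp add: abs_mult mult_right_mono)
      qed simp
    qed
  qed
qed

lemma local_to_global_eq:
  fixes \<Phi> K H :: "real \<Rightarrow> real"
  assumes "a \<le> b"
    and loc: "\<And>\<eta>. 0 < \<eta> \<Longrightarrow> \<eta> < 1 \<Longrightarrow> \<exists>d>0. \<forall>s t. a \<le> s \<and> s < t \<and> t \<le> b \<and> t - s < d \<longrightarrow>
        \<bar>(\<Phi> t - \<Phi> s) - (K t - K s)\<bar> \<le> \<eta> * (H t - H s)"
  shows "\<Phi> b - \<Phi> a = K b - K a"
proof (rule antisym)
  show "\<Phi> b - \<Phi> a \<le> K b - K a"
  proof (rule local_to_global_le[OF assms(1), where H = H])
    fix \<eta> :: real assume "0 < \<eta>" "\<eta> < 1"
    then obtain d where d: "d > 0" "\<And>s t. a \<le> s \<and> s < t \<and> t \<le> b \<and> t - s < d \<Longrightarrow>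
        \<bar>(\<Phi> t - \<Phi> s) - (K t - K s)\<bar> \<le> \<eta> * (H t - H s)" using loc by meson
    show "\<exists>d>0. \<forall>s t. a \<le> s \<and> s < t \<and> t \<le> b \<and> t - s < d \<longrightarrow>
        \<Phi> t - \<Phi> s \<le> (K t - K s) + \<eta> * (H t - H s)"
    proof (intro exI[of _ d] conjI allI impI d(1))
      fix s t assume "a \<le> s \<and> s < t \<and> t \<le> b \<and> t - s < d"
      from d(2)[OF this] show "\<Phi> t - \<Phi> s \<le> (K t - K s) + \<eta> * (H t - H s)" by linarith
    qed
  qed
  have "K b - K a \<le> \<Phi> b - \<Phi> a"
  proof (rule local_to_global_le[OF assms(1), where H = H])
    fix \<eta> :: real assume "0 < \<eta>" "\<eta> < 1"
    then obtain d where d: "d > 0" "\<And>s t. a \<le> s \<and> s < t \<and> t \<le> b \<and> t - s < d \<Longrightarrow>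
        \<bar>(\<Phi> t - \<Phi> s) - (K t - K s)\<bar> \<le> \<eta> * (H t - H s)" using loc by meson
    show "\<exists>d>0. \<forall>s t. a \<le> s \<and> s < t \<and> t \<le> b \<and> t - s < d \<longrightarrow>
        K t - K s \<le> (\<Phi> t - \<Phi> s) + \<eta> * (H t - H s)"
    proof (intro exI[of _ d] conjI allI impI d(1))
      fix s t assume "a \<le> s \<and> s < t \<and> t \<le> b \<and> t - s < d"
      from d(2)[OF this] show "K t - K s \<le> (\<Phi> t - \<Phi> s) + \<eta> * (H t - H s)" by linarith
    qed
  qed
  then show "K b - K a \<le> \<Phi> b - \<Phi> a" .
qed

text \<open>\<open>p\<close> is given only as an integral function and need not be differentiable.
  On a short interval the coefficients are frozen, with an error of at most \<open>\<eta>\<close>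
  times the integral of \<open>\<bar>G\<bar> + \<bar>e'\<bar>\<close>, which the passage from local
  to global removes.\<close>

lemma product_rule_integral:
  fixes e e' p G :: "real \<Rightarrow> real"
  assumes \<tau>T: "\<tau> \<le> T" and G: "set_integrable lborel {\<tau>..T} G"
    and p: "\<And>t. t \<in> {\<tau>..T} \<Longrightarrow> p t = p0 + (LINT r:{\<tau>..t}|lborel. G r)"
    and pc: "continuous_on {\<tau>..T} p"
    and e: "\<And>t. t \<in> {\<tau>..T} \<Longrightarrow> (e has_real_derivative e' t) (at t within {\<tau>..T})"
    and ec': "continuous_on {\<tau>..T} e'"
  shows "set_integrable lborel {\<tau>..T} (\<lambda>r. e' r * p r + e r * G r)"
    and "e T * p T - e \<tau> * p \<tau> = (LINT r:{\<tau>..T}|lborel. e' r * p r + e r * G r)"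
proof -
  have ec: "continuous_on {\<tau>..T} e" using e by (rule DERIV_continuous_on)
  show Ki: "set_integrable lborel {\<tau>..T} (\<lambda>r. e' r * p r + e r * G r)"
    by (intro set_integral_add(1) set_integrable_continuous_mult[OF ec G] set_integrable_continuous_Icc
        continuous_intros ec' pc)
  have Gabs: "set_integrable lborel {\<tau>..T} (\<lambda>r. \<bar>G r\<bar>)" using G by (rule set_integrable_abs)
  have Hi: "set_integrable lborel {\<tau>..T} (\<lambda>r. \<bar>G r\<bar> + \<bar>e' r\<bar>)"
    by (intro set_integral_add(1) Gabs set_integrable_continuous_Icc continuous_intros ec')
  let ?K = "\<lambda>t. LINT r:{\<tau>..t}|lborel. e' r * p r + e r * G r"
  let ?H = "\<lambda>t. LINT r:{\<tau>..t}|lborel. \<bar>G r\<bar> + \<bar>e' r\<bar>"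
  have "e T * p T - e \<tau> * p \<tau> = ?K T - ?K \<tau>"
  proof (rule local_to_global_eq[OF \<tau>T, where H = ?H])
    fix \<eta> :: real assume \<eta>: "0 < \<eta>" "\<eta> < 1"
    obtain d1 where d1: "d1 > 0" "\<And>s t. s \<in> {\<tau>..T} \<Longrightarrow> t \<in> {\<tau>..T} \<Longrightarrow> dist s t < d1 \<Longrightarrow> dist (e s) (e t) < \<eta>"
      using compact_uniformly_continuous[OF ec compact_Icc] \<eta>(1) unfolding uniformly_continuous_on_def by metis
    obtain d2 where d2: "d2 > 0" "\<And>s t. s \<in> {\<tau>..T} \<Longrightarrow> t \<in> {\<tau>..T} \<Longrightarrow> dist s t < d2 \<Longrightarrow> dist (p s) (p t) < \<eta>"
      using compact_uniformly_continuous[OF pc compact_Icc] \<eta>(1) unfolding uniformly_continuous_on_def by metis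
    show "\<exists>d>0. \<forall>s t. \<tau> \<le> s \<and> s < t \<and> t \<le> T \<and> t - s < d \<longrightarrow>
        \<bar>(e t * p t - e s * p s) - (?K t - ?K s)\<bar> \<le> \<eta> * (?H t - ?H s)"
    proof (intro exI[of _ "min d1 d2"] conjI allI impI)
      show "0 < min d1 d2" using d1 d2 by simp
      fix s t assume st: "\<tau> \<le> s \<and> s < t \<and> t \<le> T \<and> t - s < min d1 d2"
      then have st': "s \<in> {\<tau>..T}" "t \<in> {\<tau>..T}" "s \<le> t" "\<tau> \<le> s" "t \<le> T" "\<tau> \<le> t" by auto
      note sub = set_integrable_Icc_subset[OF _ st'(4,5)]
      note split = set_integral_Icc_split[OF set_integrable_Icc_subset[OF _ order_refl st'(5)] st'(4,3)]
      have Gst: "(LINT r:{s..t}|lborel. G r) = p t - p s"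
        using split[OF G] p[OF st'(1)] p[OF st'(2)] by linarith
      have ei: "set_integrable lborel {s..t} e'"
        using sub[OF set_integrable_continuous_Icc[OF ec']] .
      have e'st: "(LINT r:{s..t}|lborel. e' r) = e t - e s"
      proof -
        have "(e' has_integral (e t - e s)) {s..t}"
        proof (rule fundamental_theorem_of_calculus[OF st'(3)])
          fix x assume "x \<in> {s..t}"
          then have "(e has_real_derivative e' x) (at x within {s..t})"
            using e[of x] st' by (auto intro: DERIV_subset)
          then show "(e has_vector_derivative e' x) (at x within {s..t})"
            by (simp add: has_real_derivative_iff_has_vector_derivative)
        qed
        then show ?thesis using set_borel_integral_eq_integral(2)[OF ei] by (simp add: integral_unique)
      qed
      have i1: "set_integrable lborel {s..t} (\<lambda>r. e t * G r + p s * e' r)"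
        by (intro set_integral_add(1) set_integrable_mult_right ei sub[OF G])
      have i2: "set_integrable lborel {s..t} (\<lambda>r. e' r * p r + e r * G r)" by (rule sub[OF Ki])
      have i3: "set_integrable lborel {s..t} (\<lambda>r. \<eta> * (\<bar>G r\<bar> + \<bar>e' r\<bar>))"
        by (intro set_integrable_mult_right sub[OF Hi])
      \<comment> \<open>The discrete product rule is exact, with \<open>e\<close> frozen at the
        right end and \<open>p\<close> at the left.\<close>
      have "e t * p t - e s * p s = e t * (p t - p s) + p s * (e t - e s)" by (simp add: algebra_simps)
      also have "\<dots> = (LINT r:{s..t}|lborel. e t * G r + p s * e' r)"
        using sub[OF G] ei by (simp add: set_integral_add Gst e'st)
      finally have A: "e t * p t - e s * p s = (LINT r:{s..t}|lborel. e t * G r + p s * e' r)" .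
      have B: "?K t - ?K s = (LINT r:{s..t}|lborel. e' r * p r + e r * G r)"
        using split[OF Ki] by linarith
      have C: "\<eta> * (?H t - ?H s) = (LINT r:{s..t}|lborel. \<eta> * (\<bar>G r\<bar> + \<bar>e' r\<bar>))"
        using split[OF Hi] by simp
      have diff: "(e t * p t - e s * p s) - (?K t - ?K s)
         = (LINT r:{s..t}|lborel. (e t * G r + p s * e' r) - (e' r * p r + e r * G r))"
        unfolding A B by (rule set_integral_diff(2)[OF i1 i2, symmetric])
      have "\<bar>LINT r:{s..t}|lborel. (e t * G r + p s * e' r) - (e' r * p r + e r * G r)\<bar>
          \<le> (LINT r:{s..t}|lborel. \<bar>(e t * G r + p s * e' r) - (e' r * p r + e r * G r)\<bar>)"
        using set_integral_norm_bound[OF set_integral_diff(1)[OF i1 i2]] by simp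
      also have "\<dots> \<le> (LINT r:{s..t}|lborel. \<eta> * (\<bar>G r\<bar> + \<bar>e' r\<bar>))"
      proof (rule set_integral_mono)
        show "set_integrable lborel {s..t} (\<lambda>r. \<bar>(e t * G r + p s * e' r) - (e' r * p r + e r * G r)\<bar>)"
          by (rule set_integrable_abs[OF set_integral_diff(1)[OF i1 i2]])
        fix r assume r: "r \<in> {s..t}"
        then have "dist t r < d1" "dist s r < d2" "r \<in> {\<tau>..T}" using st by (auto simp: dist_real_def)
        then have "\<bar>e t - e r\<bar> \<le> \<eta>" "\<bar>p s - p r\<bar> \<le> \<eta>"
          using d1(2)[of t r] d2(2)[of s r] st' by (auto simp: dist_real_def)
        then have "\<bar>e t - e r\<bar> * \<bar>G r\<bar> \<le> \<eta> * \<bar>G r\<bar>" "\<bar>p s - p r\<bar> * \<bar>e' r\<bar> \<le> \<eta> * \<bar>e' r\<bar>"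
          by (auto intro: mult_right_mono)
        moreover have "(e t * G r + p s * e' r) - (e' r * p r + e r * G r) = (e t - e r) * G r + (p s - p r) * e' r"
          by (simp add: algebra_simps)
        moreover have "\<bar>(e t - e r) * G r + (p s - p r) * e' r\<bar> \<le> \<bar>e t - e r\<bar> * \<bar>G r\<bar> + \<bar>p s - p r\<bar> * \<bar>e' r\<bar>"
          by (metis abs_mult abs_triangle_ineq)
        ultimately show "\<bar>(e t * G r + p s * e' r) - (e' r * p r + e r * G r)\<bar> \<le> \<eta> * (\<bar>G r\<bar> + \<bar>e' r\<bar>)"
          by (simp add: distrib_left)
      qed (rule i3)
      finally show "\<bar>(e t * p t - e s * p s) - (?K t - ?K s)\<bar> \<le> \<eta> * (?H t - ?H s)" unfolding C diff .
    qed
  qed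
  moreover have "?K \<tau> = 0"
    using set_borel_integral_eq_integral(2)[OF set_integrable_Icc_subset[OF Ki order_refl \<tau>T]] by simp
  ultimately show "e T * p T - e \<tau> * p \<tau> = ?K T" by simp
qed

text \<open>The right-hand side \<open>X\<close> is differentiable although \<open>E\<close> is
  merely continuous, and \<open>X' = C * E \<le> C * X\<close> makes \<open>X\<close> times the
  decaying exponential nonincreasing.\<close>

lemma gronwall_integral:
  fixes E :: "real \<Rightarrow> real"
  assumes E: "continuous_on {\<tau>..T} E" and C: "0 \<le> C"
    and le: "\<And>t. t \<in> {\<tau>..T} \<Longrightarrow> E t \<le> A + integral {\<tau>..t} (\<lambda>r. C * E r)"
    and t: "t \<in> {\<tau>..T}"
  shows "E t \<le> A * exp (C * (t - \<tau>))"
proof -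
  define X where "X s = A + integral {\<tau>..s} (\<lambda>r. C * E r)" for s
  define g where "g s = X s * exp (- C * (s - \<tau>))" for s
  have X: "(X has_real_derivative C * E s) (at s within {\<tau>..T})" if "s \<in> {\<tau>..T}" for s
    unfolding X_def
    by (auto intro!: derivative_eq_intros integral_has_real_derivative continuous_intros E that)
  have g: "(g has_real_derivative (C * E s - C * X s) * exp (- C * (s - \<tau>))) (at s within {\<tau>..T})"
    if "s \<in> {\<tau>..T}" for s
    unfolding g_def
    by (rule derivative_eq_intros X[OF that] refl)+ (simp add: algebra_simps)
  have "g t \<le> g \<tau>"
  proof (rule DERIV_nonpos_imp_decreasing_open[of \<tau> t g])
    show "\<tau> \<le> t" using t by simp
    show "continuous_on {\<tau>..t} g"
      by (rule continuous_on_subset[OF DERIV_continuous_on[OF g]]) (use t in auto)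
    fix x assume x: "\<tau> < x" "x < t"
    then have "x \<in> {\<tau>..T}" "at x within {\<tau>..T} = at x" using t by (auto simp: at_within_Icc_at)
    then have "(g has_real_derivative (C * E x - C * X x) * exp (- C * (x - \<tau>))) (at x)"
      using g[of x] by simp
    moreover have "C * E x - C * X x \<le> 0"
      using le[OF \<open>x \<in> {\<tau>..T}\<close>] C by (simp add: X_def mult_left_mono)
    ultimately show "\<exists>y. (g has_real_derivative y) (at x) \<and> y \<le> 0"
      by (meson exp_ge_zero mult_nonpos_nonneg)
  qed
  then have "X t * exp (- C * (t - \<tau>)) \<le> A" by (simp add: g_def X_def)
  then have "X t * exp (- C * (t - \<tau>)) * exp (C * (t - \<tau>)) \<le> A * exp (C * (t - \<tau>))"
    by (rule mult_right_mono) simp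
  then have "X t \<le> A * exp (C * (t - \<tau>))" by (simp add: mult.assoc flip: exp_add)
  then show ?thesis using le[OF t] by (simp add: X_def)
qed

text \<open>\<open>oint\<close> changes its formula at 0. Starting the integral at a point left of
  both 0 and \<open>t\<close> gives one formula up to a constant, so \<open>t = 0\<close> is not a
  special case.\<close>

lemma oint_has_derivative:
  assumes g: "continuous_on UNIV g"
  shows "((\<lambda>t. oint 0 t g) has_real_derivative g t) (at t)"
proof -
  define a where "a = min t 0 - 1"
  define b where "b = max t 0 + 1"
  have ab: "a < t" "t < b" "a < 0" "0 < b" by (auto simp: a_def b_def)
  have gi: "g integrable_on {c..d}" for c d
    by (rule integrable_continuous_real) (rule continuous_on_subset[OF g subset_UNIV])
  have eq: "integral {a..s} g - integral {a..0} g = oint 0 s g" if s: "s \<in> {a<..<b}" for s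
  proof (cases "0 \<le> s")
    case True
    then show ?thesis
      using Henstock_Kurzweil_Integration.integral_combine[of a 0 s g] ab s gi by (simp add: oint_def)
  next
    case False
    then show ?thesis
      using Henstock_Kurzweil_Integration.integral_combine[of a s 0 g] ab s gi by (simp add: oint_def)
  qed
  have "((\<lambda>s. integral {a..s} g) has_real_derivative g t) (at t within {a..b})"
    by (rule integral_has_real_derivative) (use g ab continuous_on_subset in auto)
  then have "((\<lambda>s. integral {a..s} g) has_real_derivative g t) (at t)"
    using at_within_Icc_at[OF ab(1,2)] by simp
  then have "((\<lambda>s. integral {a..s} g - integral {a..0} g) has_real_derivative g t) (at t)"
    by (auto intro!: derivative_eq_intros)
  then show ?thesis
    by (rule has_field_derivative_transform_within_open[of _ _ _ "{a<..<b}"]) (use ab eq in auto)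
qed

lemma abs_exp_minus_one_le:
  fixes x q :: real
  assumes "\<bar>x\<bar> \<le> q" "q \<le> 1"
  shows "\<bar>exp x - 1\<bar> \<le> 2 * q"
proof (cases "0 \<le> x")
  case True
  have "exp x \<le> 1 + x + x\<^sup>2" using True assms by (intro exp_bound) auto
  also have "x\<^sup>2 \<le> x" using True assms by (simp add: power2_eq_square mult_left_le)
  finally show ?thesis using True assms by simp
next
  case False
  then have "exp x \<le> 1" by simp
  then show ?thesis using exp_ge_add_one_self[of x] False assms by linarith
qed

context bounded_domain
begin

subsection \<open>Comparison of two solutions\<close>

lemma L2_mono:
  assumes "L2 D g" "u \<in> borel_measurable (lebesgue_on D)" "\<And>x. \<bar>u x\<bar> \<le> \<bar>g x\<bar>"
  shows "L2 D u" "l2norm D u \<le> l2norm D g"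
  using ip_mono[of "lebesgue_on D" g u] assms by (simp_all add: L2_iff_sqint[OF opn] l2norm_eq_ip[OF opn])

lemma L2_measurable: "L2 D u \<Longrightarrow> u \<in> borel_measurable (lebesgue_on D)"
  by (simp add: L2_iff_sqint[OF opn] sqint_def)

lemma L2_const: "L2 D (\<lambda>x. c)"
  using sqint_bounded[OF opn bdd, of "\<lambda>x. c" "\<bar>c\<bar>"] by (simp add: L2_iff_sqint[OF opn])

lemma measurable_continuous_comp:
  assumes "continuous_on UNIV f" "L2 D w"
  shows "(\<lambda>x. f (w x)) \<in> borel_measurable (lebesgue_on D)"
  using measurable_compose[OF L2_measurable[OF assms(2)] borel_measurable_continuous_onI[OF assms(1)]] .

lemma L2_linear_growth:
  assumes f: "continuous_on UNIV f" "\<And>s. \<bar>f s\<bar> \<le> Cf * (\<bar>s\<bar> + 1)" and w: "L2 D w"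
  shows "L2 D (\<lambda>x. f (w x))"
    and "l2norm D (\<lambda>x. f (w x)) \<le> Cf * (l2norm D w + l2norm D (\<lambda>x. 1))"
proof -
  have Cf: "0 \<le> Cf" using f(2)[of 0] by (auto intro: order_trans[OF abs_ge_zero])
  have wa: "L2 D (\<lambda>x. \<bar>w x\<bar>)" "l2norm D (\<lambda>x. \<bar>w x\<bar>) \<le> l2norm D w"
    using L2_mono[OF w, of "\<lambda>x. \<bar>w x\<bar>"] L2_measurable[OF w] by auto
  have g: "L2 D (\<lambda>x. Cf * (\<bar>w x\<bar> + 1))" by (intro L2_scale L2_add wa L2_const)
  have le: "\<bar>f (w x)\<bar> \<le> \<bar>Cf * (\<bar>w x\<bar> + 1)\<bar>" for x using f(2)[of "w x"] by linarith
  note mono = L2_mono[OF g measurable_continuous_comp[OF f(1) w] le]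
  show "L2 D (\<lambda>x. f (w x))" by (rule mono)
  have "l2norm D (\<lambda>x. f (w x)) \<le> Cf * l2norm D (\<lambda>x. \<bar>w x\<bar> + 1)"
    using mono(2) Cf by (simp only: l2norm_scale abs_of_nonneg)
  also have "\<dots> \<le> Cf * (l2norm D w + l2norm D (\<lambda>x. 1))"
    using l2norm_triangle[OF wa(1) L2_const[of 1]] wa(2) by (intro mult_left_mono Cf) linarith
  finally show "l2norm D (\<lambda>x. f (w x)) \<le> Cf * (l2norm D w + l2norm D (\<lambda>x. 1))" .
qed

lemma l2norm_lipschitz_comp:
  assumes f: "continuous_on UNIV f" "\<And>s r. \<bar>f s - f r\<bar> \<le> \<eta> * \<bar>s - r\<bar>" and w: "L2 D w" "L2 D u"
  shows "l2norm D (\<lambda>x. f (w x) - f (u x)) \<le> \<eta> * l2norm D (\<lambda>x. w x - u x)"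
proof -
  have \<eta>: "0 \<le> \<eta>" using f(2)[of 1 0] by simp
  have "l2norm D (\<lambda>x. f (w x) - f (u x)) \<le> l2norm D (\<lambda>x. \<eta> * (w x - u x))"
  proof (rule L2_mono(2))
    show "L2 D (\<lambda>x. \<eta> * (w x - u x))" by (intro L2_scale L2_diff w)
    show "(\<lambda>x. f (w x) - f (u x)) \<in> borel_measurable (lebesgue_on D)"
      by (intro borel_measurable_diff measurable_continuous_comp f w)
    show "\<bar>f (w x) - f (u x)\<bar> \<le> \<bar>\<eta> * (w x - u x)\<bar>" for x
      using f(2)[of "w x" "u x"] \<eta> by (simp add: abs_mult)
  qed
  then show ?thesis using \<eta> by (simp add: l2norm_scale)
qed

lemma weak_sol_increment:
  assumes u: "weak_sol D A F \<tau> T u0 u" and z: "in_V D z" and st: "\<tau> \<le> s" "s \<le> t" "t \<le> T"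
  shows "set_integrable lborel {s..t} (\<lambda>r. - A r (u r) * dform D (u r) z + l2inner D (F r (u r)) z)"
    and "l2inner D (u t) z - l2inner D (u s) z =
      (LINT r:{s..t}|lborel. - A r (u r) * dform D (u r) z + l2inner D (F r (u r)) z)"
proof -
  let ?G = "\<lambda>r. - A r (u r) * dform D (u r) z + l2inner D (F r (u r)) z"
  have i: "set_integrable lborel {\<tau>..t'} ?G"
    and eq: "l2inner D (u t') z = l2inner D u0 z + (LINT r:{\<tau>..t'}|lborel. ?G r)" if "t' \<in> {\<tau>..T}" for t'
    using u z that unfolding weak_sol_def by blast+
  have it: "set_integrable lborel {\<tau>..t} ?G" using i st by auto
  show "set_integrable lborel {s..t} ?G" by (rule set_integrable_Icc_subset[OF it]) (use st in auto)
  show "l2inner D (u t) z - l2inner D (u s) z = (LINT r:{s..t}|lborel. ?G r)"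
    using set_integral_Icc_split[OF it st(1,2)] eq[of s] eq[of t] st by simp
qed

text \<open>The derivative of the factor \<open>exp (- g)\<close> contributes \<open>- g' v\<close>,
  which cancels the rescaled term \<open>g' w\<close> of the equation: the noise survives only
  through its primitive \<open>g\<close>. Membership of \<open>w t\<close> in V at every time makes
  \<open>dform\<close> homogeneous there.\<close>

lemma weak_sol_rescaled_increment:
  fixes g g' :: "real \<Rightarrow> real" and w :: "real \<Rightarrow> 'a \<Rightarrow> real"
  assumes f: "continuous_on UNIV f" "\<And>s. \<bar>f s\<bar> \<le> Cf * (\<bar>s\<bar> + 1)"
    and w: "weak_sol D A (\<lambda>s z x. f (z x) + g' s * z x) \<tau> T u0 w"
    and g: "\<And>t. (g has_real_derivative g' t) (at t)" and gc: "continuous_on UNIV g'"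
    and V: "\<And>t. t \<in> {\<tau>..T} \<Longrightarrow> in_V D (w t)"
    and z: "in_V D z" and st: "\<tau> \<le> s" "s \<le> t" "t \<le> T"
  defines "v \<equiv> \<lambda>t x. exp (- g t) * w t x"
  shows "set_integrable lborel {s..t} (\<lambda>r. - A r (w r) * dform D (v r) z +
         l2inner D (\<lambda>x. exp (- g r) * f (w r x)) z)" (is "set_integrable lborel {s..t} ?Gv")
    and "l2inner D (v t) z - l2inner D (v s) z =
      (LINT r:{s..t}|lborel. - A r (w r) * dform D (v r) z + l2inner D (\<lambda>x. exp (- g r) * f (w r x)) z)"
proof -
  have wL: "L2 D (w t)" if "t \<in> {\<tau>..T}" for t using V[OF that] in_V_L2 by blast
  have zL: "L2 D z" using z in_V_L2 by blast
  let ?G = "\<lambda>r. - A r (w r) * dform D (w r) z + l2inner D (\<lambda>x. f (w r x) + g' r * w r x) z"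
  define e where "e r = exp (- g r)" for r
  define e' where "e' r = - g' r * e r" for r
  define p where "p r = l2inner D (w r) z" for r
  have wc: "((\<lambda>s. l2norm D (\<lambda>x. w s x - w t x)) \<longlongrightarrow> 0) (at t within {\<tau>..T})" if "t \<in> {\<tau>..T}" for t
    using w that unfolding weak_sol_def by blast
  have sub: "{s..t} \<subseteq> {\<tau>..T}" using st by auto
  have gcont: "continuous_on UNIV g" using g by (rule DERIV_continuous_on)
  have Gi: "set_integrable lborel {s..t} ?G" by (rule weak_sol_increment(1)[OF w z st])
  have p: "p r = p s + (LINT r:{s..r}|lborel. ?G r)" if "r \<in> {s..t}" for r
    using weak_sol_increment(2)[OF w z st(1), of r] that st by (simp add: p_def)
  have pc: "continuous_on {s..t} p"
    unfolding p_def by (rule continuous_on_subset[OF l2_path_continuous_inner[OF wL wc zL] sub])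
  have e: "(e has_real_derivative e' r) (at r within {s..t})" for r
    unfolding e_def e'_def
    by (rule derivative_eq_intros has_field_derivative_at_within[OF g] refl)+ simp
  have ec': "continuous_on {s..t} e'"
    unfolding e'_def e_def
    by (rule continuous_on_subset[OF _ subset_UNIV]) (intro continuous_intros gc gcont)
  have eq: "e' r * p r + e r * ?G r = ?Gv r" if "r \<in> {s..t}" for r
  proof -
    have r: "r \<in> {\<tau>..T}" using that sub by auto
    have "l2inner D (\<lambda>x. f (w r x) + g' r * w r x) z = l2inner D (\<lambda>x. f (w r x)) z + g' r * p r"
      using l2inner_add[OF L2_linear_growth(1)[OF f wL[OF r]] L2_scale[OF wL[OF r]] zL]
      by (simp add: l2inner_scale p_def)
    moreover have "dform D (v r) z = e r * dform D (w r) z"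
      unfolding v_def e_def by (rule dform_scale[OF V[OF r] z])
    moreover have "l2inner D (\<lambda>x. exp (- g r) * f (w r x)) z = e r * l2inner D (\<lambda>x. f (w r x)) z"
      unfolding e_def by (rule l2inner_scale)
    ultimately show ?thesis by (simp add: e'_def algebra_simps)
  qed
  note pr = product_rule_integral[OF st(2) Gi p pc e ec']
  show "set_integrable lborel {s..t} ?Gv"
    using pr(1) set_integrable_cong[of lborel lborel "{s..t}" "{s..t}" "\<lambda>r. e' r * p r + e r * ?G r" ?Gv] eq by blast
  have "l2inner D (v t) z - l2inner D (v s) z = e t * p t - e s * p s"
    unfolding v_def by (simp add: l2inner_scale e_def p_def)
  also have "\<dots> = (LINT r:{s..t}|lborel. e' r * p r + e r * ?G r)" by (rule pr(2))
  also have "\<dots> = (LINT r:{s..t}|lborel. ?Gv r)"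
    by (rule set_lebesgue_integral_cong) (use eq in auto)
  finally show "l2inner D (v t) z - l2inner D (v s) z = (LINT r:{s..t}|lborel. ?Gv r)" .
qed

text \<open>The scalar inequality for \<open>C\<close> is left to the application, which separates
  the analysis from the arithmetic. In the result, \<open>4 * (l2norm D u0)\<^sup>2\<close> stems
  from the mismatch of the initial values, the summand 1 from the shift by \<open>q\<close> in
  Gronwall's lemma, and 18 and 8 from returning from \<open>v\<close> to \<open>w\<close>.\<close>

lemma weak_sol_difference_estimate:
  fixes a f g g' :: "real \<Rightarrow> real" and u w :: "real \<Rightarrow> 'a \<Rightarrow> real"
  assumes \<tau>T: "\<tau> < T"
    and a: "\<And>s r. \<bar>a s - a r\<bar> \<le> La * \<bar>s - r\<bar>" "0 < m" "\<And>s. m \<le> a s" "\<And>s. a s \<le> m'"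
    and f: "continuous_on UNIV f" "\<And>s. \<bar>f s\<bar> \<le> Cf * (\<bar>s\<bar> + 1)"
      "\<And>s r. \<bar>f s - f r\<bar> \<le> \<eta> * \<bar>s - r\<bar>"
    and l: "L2 D l" and u0: "L2 D u0"
    and u: "weak_sol D (\<lambda>s z. a (l2inner D l z)) (\<lambda>s z x. f (z x)) \<tau> T u0 u"
    and w: "weak_sol D (\<lambda>s z. a (l2inner D l z)) (\<lambda>s z x. f (z x) + g' s * z x) \<tau> T u0 w"
    and g: "\<And>t. (g has_real_derivative g' t) (at t)" and gc: "continuous_on UNIV g'"
    and q: "\<And>t. t \<in> {\<tau>..T} \<Longrightarrow> \<bar>g t\<bar> \<le> q" "q \<le> 1"
    and vV: "\<And>t. t \<in> {\<tau>..T} \<Longrightarrow> in_V D (\<lambda>x. exp (- g t) * w t x)"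
    and v\<alpha>: "\<And>t. t \<in> {\<tau>..T} \<Longrightarrow> (Vnorm D (\<lambda>x. exp (- g t) * w t x))\<^sup>2 \<le> \<alpha>"
    and M: "\<And>t. t \<in> {\<tau>..T} \<Longrightarrow> l2norm D (u t) \<le> M"
    and C: "0 \<le> C" "\<And>Y. 0 \<le> Y \<Longrightarrow>
      (La * l2norm D l * sqrt \<alpha> * (3 * Y + 2 * q * M))\<^sup>2 / (2 * m) +
       2 * (2 * q * (Cf * (3 * Y + 3 * M + l2norm D (\<lambda>x. 1))) + \<eta> * (3 * Y + 2 * q * M)) * Y
       \<le> C * (Y\<^sup>2 + q)"
    and t: "t \<in> {\<tau>..T}"
  shows "(l2norm D (\<lambda>x. w t x - u t x))\<^sup>2 \<le>
    q * (18 * ((4 * (l2norm D u0)\<^sup>2 + 1) * exp (C * (T - \<tau>))) + 8 * M\<^sup>2)"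
proof -
  have La: "0 \<le> La" using a(1)[of 1 0] by simp
  have \<eta>: "0 \<le> \<eta>" using f(3)[of 1 0] by simp
  have Cf: "0 \<le> Cf" using f(2)[of 0] by (auto intro: order_trans[OF abs_ge_zero])
  have q0: "0 \<le> q" using q(1)[of \<tau>] \<tau>T by auto
  have M0: "0 \<le> M" using M[of \<tau>] l2norm_nonneg[of "u \<tau>"] \<tau>T by auto
  have \<nu>0: "0 \<le> l2norm D (\<lambda>x. 1)" and Ln0: "0 \<le> l2norm D l" by (rule l2norm_nonneg)+
  have gcont: "continuous_on UNIV g" using g by (rule DERIV_continuous_on)
  define v where "v t = (\<lambda>x. exp (- g t) * w t x)" for t
  define y where "y t = (\<lambda>x. v t x - u t x)" for t
  define Y where "Y t = l2norm D (y t)" for t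
  have vV': "in_V D (v t)" and v\<alpha>': "(Vnorm D (v t))\<^sup>2 \<le> \<alpha>" if "t \<in> {\<tau>..T}" for t
    using vV[OF that] v\<alpha>[OF that] by (simp_all add: v_def)
  have \<alpha>0: "0 \<le> \<alpha>" using v\<alpha>'[of \<tau>] \<tau>T order_trans[OF zero_le_power2] by auto
  have vs: "Vnorm D (v t) \<le> sqrt \<alpha>" if "t \<in> {\<tau>..T}" for t
    using v\<alpha>'[OF that] by (rule real_le_rsqrt)
  have w_eq: "w t = (\<lambda>x. exp (g t) * v t x)" for t
    by (simp add: v_def mult.assoc[symmetric] flip: exp_add)
  have wV: "in_V D (w t)" if "t \<in> {\<tau>..T}" for t
    unfolding w_eq by (rule in_V_scale[OF vV'[OF that]])
  have uL: "L2 D (u t)" and wL: "L2 D (w t)" if "t \<in> {\<tau>..T}" for t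
    using u w that unfolding weak_sol_def by blast+
  have vL: "L2 D (v t)" if "t \<in> {\<tau>..T}" for t using vV'[OF that] in_V_L2 by blast
  have yL: "L2 D (y t)" if "t \<in> {\<tau>..T}" for t
    unfolding y_def by (rule L2_diff[OF vL[OF that] uL[OF that]])
  have uc: "((\<lambda>s. l2norm D (\<lambda>x. u s x - u t x)) \<longlongrightarrow> 0) (at t within {\<tau>..T})" if "t \<in> {\<tau>..T}" for t
    using u that unfolding weak_sol_def by blast
  have wc: "((\<lambda>s. l2norm D (\<lambda>x. w s x - w t x)) \<longlongrightarrow> 0) (at t within {\<tau>..T})" if "t \<in> {\<tau>..T}" for t
    using w that unfolding weak_sol_def by blast
  have exp1: "\<bar>exp (g t) - 1\<bar> \<le> 2 * q" "\<bar>exp (- g t) - 1\<bar> \<le> 2 * q" if "t \<in> {\<tau>..T}" for t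
    using q(1)[OF that] q(2) by (auto intro!: abs_exp_minus_one_le)
  have Y0: "0 \<le> Y t" for t by (simp add: Y_def l2norm_nonneg)
  have vn: "l2norm D (v t) \<le> Y t + M" if "t \<in> {\<tau>..T}" for t
    using l2norm_le_diff[OF vL[OF that] uL[OF that]] M[OF that] by (simp add: Y_def y_def)
  \<comment> \<open>The norm of \<open>w - v = (exp g - 1) v\<close> is at most
    \<open>2 * q * (Y + M)\<close>, and \<open>q \<le> 1\<close> turns this into
    \<open>2 * Y + 2 * q * M\<close>. The term with \<open>M\<close> keeps its factor
    \<open>q\<close>, so that it vanishes with the noise.\<close>
  have wu: "l2norm D (\<lambda>x. w t x - u t x) \<le> 3 * Y t + 2 * q * M" if "t \<in> {\<tau>..T}" for t
  proof -
    have "(\<lambda>x. w t x - v t x) = (\<lambda>x. (exp (g t) - 1) * v t x)"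
      by (simp add: w_eq algebra_simps)
    then have "l2norm D (\<lambda>x. w t x - v t x) = \<bar>exp (g t) - 1\<bar> * l2norm D (v t)"
      by (simp add: l2norm_scale)
    also have "\<dots> \<le> 2 * q * (Y t + M)"
      by (rule mult_mono) (use exp1[OF that] vn[OF that] q0 l2norm_nonneg in auto)
    also have "\<dots> \<le> 2 * Y t + 2 * q * M"
      using mult_right_mono[OF q(2) Y0[of t]] by (simp add: algebra_simps)
    finally show ?thesis
      using l2norm_diff_triangle[OF wL[OF that] vL[OF that] uL[OF that]] by (simp add: Y_def y_def)
  qed
  have wn: "l2norm D (w t) \<le> 3 * Y t + 3 * M" if "t \<in> {\<tau>..T}" for t
    using l2norm_le_diff[OF wL[OF that] uL[OF that]] wu[OF that] M[OF that]
      mult_right_mono[OF q(2) M0] by linarith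
  have yc: "((\<lambda>s. l2norm D (\<lambda>x. y s x - y t x)) \<longlongrightarrow> 0) (at t within {\<tau>..T})" if t: "t \<in> {\<tau>..T}" for t
  proof (rule Lim_null_comparison)
    let ?B = "\<lambda>s. exp (- g s) * l2norm D (\<lambda>x. w s x - w t x) + \<bar>exp (- g s) - exp (- g t)\<bar> * l2norm D (w t)
       + l2norm D (\<lambda>x. u s x - u t x)"
    have "norm (l2norm D (\<lambda>x. y s x - y t x)) \<le> ?B s" if s: "s \<in> {\<tau>..T}" for s
    proof -
      have d: "L2 D (\<lambda>x. exp (- g s) * (w s x - w t x))" "L2 D (\<lambda>x. (exp (- g s) - exp (- g t)) * w t x)"
        "L2 D (\<lambda>x. u s x - u t x)"
        by (intro L2_scale L2_diff wL uL s t)+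
      have "(\<lambda>x. y s x - y t x) = (\<lambda>x. (exp (- g s) * (w s x - w t x) + (exp (- g s) - exp (- g t)) * w t x)
          - (u s x - u t x))"
        by (auto simp: y_def v_def algebra_simps)
      then have "l2norm D (\<lambda>x. y s x - y t x) \<le> l2norm D (\<lambda>x. exp (- g s) * (w s x - w t x) + (exp (- g s) - exp (- g t)) * w t x)
          + l2norm D (\<lambda>x. u s x - u t x)"
        using l2norm_triangle_diff[OF L2_add[OF d(1,2)] d(3)] by simp
      also have "\<dots> \<le> ?B s"
        using l2norm_triangle[OF d(1,2)] by (simp add: l2norm_scale)
      finally show ?thesis by (simp add: l2norm_nonneg)
    qed
    then show "\<forall>\<^sub>F s in at t within {\<tau>..T}. norm (l2norm D (\<lambda>x. y s x - y t x)) \<le> ?B s"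
      by (auto simp: eventually_at_filter)
    have gl: "(g \<longlongrightarrow> g t) (at t within {\<tau>..T})"
      using gcont continuous_on_subset[OF gcont subset_UNIV, of "{\<tau>..T}"] t by (auto simp: continuous_on_def)
    have "(?B \<longlongrightarrow> exp (- g t) * 0 + \<bar>exp (- g t) - exp (- g t)\<bar> * l2norm D (w t) + 0) (at t within {\<tau>..T})"
      by (intro tendsto_intros gl uc[OF t] wc[OF t])
    then show "(?B \<longlongrightarrow> 0) (at t within {\<tau>..T})" by simp
  qed
  have Yc: "continuous_on {\<tau>..T} Y"
    unfolding Y_def by (rule l2_path_continuous_norm[OF yL yc])
  let ?\<beta> = "\<lambda>r. La * l2norm D l * sqrt \<alpha> * (3 * Y r + 2 * q * M)"
  let ?\<gamma> = "\<lambda>r. 2 * q * (Cf * (3 * Y r + 3 * M + l2norm D (\<lambda>x. 1))) + \<eta> * (3 * Y r + 2 * q * M)"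
  let ?Aw = "\<lambda>r. a (l2inner D l (w r))" and ?Au = "\<lambda>r. a (l2inner D l (u r))"
  let ?Fw = "\<lambda>r x. exp (- g r) * f (w r x)" and ?Fu = "\<lambda>r x. f (u r x)"
  let ?G = "\<lambda>r z. (- ?Aw r * dform D (v r) z + l2inner D (?Fw r) z) - (- ?Au r * dform D (u r) z + l2inner D (?Fu r) z)"
  have FwL: "L2 D (?Fw r)" and FuL: "L2 D (?Fu r)" if "r \<in> {\<tau>..T}" for r
    by (intro L2_scale L2_linear_growth(1)[OF f(1,2)] wL uL that)+
  have uV: "AE t in lborel. t \<in> {\<tau>..T} \<longrightarrow> in_V D (u t)"
    and uh: "set_integrable lborel {\<tau>..T} (\<lambda>t. (Vnorm D (u t))\<^sup>2)"
    using u unfolding weak_sol_def by blast+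
  have G_bound: "?G r z \<le> - ?Au r * dform D (y r) z + ?\<beta> r * Vnorm D z + ?\<gamma> r * l2norm D z"
    if r: "r \<in> {\<tau>..T}" and urV: "in_V D (u r)" and z: "in_V D z" for r z
  proof -
    have zL: "L2 D z" using z in_V_L2 by blast
    have "\<bar>?Aw r - ?Au r\<bar> \<le> La * \<bar>l2inner D l (w r) - l2inner D l (u r)\<bar>" by (rule a(1))
    also have "\<bar>l2inner D l (w r) - l2inner D l (u r)\<bar> = \<bar>l2inner D (\<lambda>x. w r x - u r x) l\<bar>"
      using l2inner_diff[OF wL[OF r] uL[OF r] l] by (simp add: l2inner_commute)
    also have "La * \<dots> \<le> La * ((3 * Y r + 2 * q * M) * l2norm D l)"
    proof (intro mult_left_mono La)
      have "\<bar>l2inner D (\<lambda>x. w r x - u r x) l\<bar> \<le> l2norm D (\<lambda>x. w r x - u r x) * l2norm D l"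
        by (rule l2inner_Cauchy_Schwarz[OF L2_diff[OF wL[OF r] uL[OF r]] l])
      also have "\<dots> \<le> (3 * Y r + 2 * q * M) * l2norm D l"
        by (rule mult_right_mono[OF wu[OF r] Ln0])
      finally show "\<bar>l2inner D (\<lambda>x. w r x - u r x) l\<bar> \<le> (3 * Y r + 2 * q * M) * l2norm D l" .
    qed
    finally have Ad: "\<bar>?Aw r - ?Au r\<bar> \<le> La * ((3 * Y r + 2 * q * M) * l2norm D l)" .
    have "\<bar>(?Aw r - ?Au r) * dform D (v r) z\<bar> \<le> La * ((3 * Y r + 2 * q * M) * l2norm D l) * (sqrt \<alpha> * Vnorm D z)"
      unfolding abs_mult
    proof (rule mult_mono[OF Ad])
      show "\<bar>dform D (v r) z\<bar> \<le> sqrt \<alpha> * Vnorm D z"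
        using dform_Cauchy_Schwarz[OF vV'[OF r] z] mult_right_mono[OF vs[OF r] Vnorm_nonneg[of z]] by linarith
      show "0 \<le> La * ((3 * Y r + 2 * q * M) * l2norm D l)"
        using La Y0[of r] q0 M0 Ln0 by simp
    qed simp
    then have 1: "- ((?Aw r - ?Au r) * dform D (v r) z) \<le> ?\<beta> r * Vnorm D z"
      by (simp add: abs_le_iff mult_ac)
    \<comment> \<open>The growth bound of \<open>f\<close> controls the first summand, which is
      small with \<open>q\<close>; the Lipschitz bound controls the second.\<close>
    have eq: "(\<lambda>x. ?Fw r x - ?Fu r x) = (\<lambda>x. (exp (- g r) - 1) * f (w r x) + (f (w r x) - f (u r x)))"
      by (auto simp: algebra_simps)
    have fwL: "L2 D (\<lambda>x. f (w r x))" by (rule L2_linear_growth(1)[OF f(1,2) wL[OF r]])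
    have "l2norm D (\<lambda>x. ?Fw r x - ?Fu r x) \<le> \<bar>exp (- g r) - 1\<bar> * l2norm D (\<lambda>x. f (w r x)) + l2norm D (\<lambda>x. f (w r x) - f (u r x))"
      unfolding eq l2norm_scale[symmetric]
      by (intro l2norm_triangle L2_scale L2_diff fwL FuL[OF r])
    also have "\<dots> \<le> ?\<gamma> r"
    proof (intro add_mono mult_mono exp1[OF r])
      have "l2norm D (\<lambda>x. f (w r x)) \<le> Cf * (l2norm D (w r) + l2norm D (\<lambda>x. 1))"
        by (rule L2_linear_growth(2)[OF f(1,2) wL[OF r]])
      also have "\<dots> \<le> Cf * (3 * Y r + 3 * M + l2norm D (\<lambda>x. 1))"
        using wn[OF r] by (intro mult_left_mono Cf) linarith
      finally show "l2norm D (\<lambda>x. f (w r x)) \<le> Cf * (3 * Y r + 3 * M + l2norm D (\<lambda>x. 1))" .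
      have "l2norm D (\<lambda>x. f (w r x) - f (u r x)) \<le> \<eta> * l2norm D (\<lambda>x. w r x - u r x)"
        by (rule l2norm_lipschitz_comp[OF f(1,3) wL[OF r] uL[OF r]])
      also have "\<dots> \<le> \<eta> * (3 * Y r + 2 * q * M)" by (rule mult_left_mono[OF wu[OF r] \<eta>])
      finally show "l2norm D (\<lambda>x. f (w r x) - f (u r x)) \<le> \<eta> * (3 * Y r + 2 * q * M)" .
    qed (use q0 l2norm_nonneg in auto)
    finally have F\<gamma>: "l2norm D (\<lambda>x. ?Fw r x - ?Fu r x) \<le> ?\<gamma> r" .
    have "l2inner D (?Fw r) z - l2inner D (?Fu r) z \<le> l2norm D (\<lambda>x. ?Fw r x - ?Fu r x) * l2norm D z"
      using l2inner_Cauchy_Schwarz[OF L2_diff[OF FwL[OF r] FuL[OF r]] zL] l2inner_diff[OF FwL[OF r] FuL[OF r] zL]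
      by linarith
    also have "\<dots> \<le> ?\<gamma> r * l2norm D z" by (rule mult_right_mono[OF F\<gamma> l2norm_nonneg])
    finally have 2: "l2inner D (?Fw r) z - l2inner D (?Fu r) z \<le> ?\<gamma> r * l2norm D z" .
    have dy: "dform D (y r) z = dform D (v r) z - dform D (u r) z"
      unfolding y_def by (rule dform_diff[OF vV'[OF r] urV z])
    \<comment> \<open>The difference of the coefficients is attached to \<open>v\<close>, whose
      V-norm is bounded uniformly in time, and not to \<open>u\<close>, whose V-norm is only known
      to be square integrable.\<close>
    have "?G r z = - ?Au r * dform D (y r) z - (?Aw r - ?Au r) * dform D (v r) z
        + (l2inner D (?Fw r) z - l2inner D (?Fu r) z)"
      unfolding dy by (simp add: algebra_simps)
    then show ?thesis using 1 2 by linarith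
  qed
  have energy: "(Y t)\<^sup>2 \<le> (Y \<tau>)\<^sup>2 + integral {\<tau>..t} (\<lambda>r. (?\<beta> r)\<^sup>2 / (2 * m) + 2 * ?\<gamma> r * Y r)"
    if t: "t \<in> {\<tau>..T}" for t
    unfolding Y_def
  proof (rule energy_inequality[where G = ?G and b = ?Au and h = "\<lambda>r. 2 * \<alpha> + 2 * (Vnorm D (u r))\<^sup>2" and m' = m',
        OF \<tau>T yL yc])
    show "AE t in lborel. t \<in> {\<tau>..T} \<longrightarrow> in_V D (y t) \<and> (Vnorm D (y t))\<^sup>2 \<le> 2 * \<alpha> + 2 * (Vnorm D (u t))\<^sup>2"
      using uV
    proof eventually_elim
      case (elim t)
      show ?case
      proof
        assume t: "t \<in> {\<tau>..T}"
        have yV: "in_V D (y t)" unfolding y_def by (rule in_V_diff[OF vV'[OF t]]) (use elim t in auto)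
        have "(Vnorm D (y t))\<^sup>2 \<le> (Vnorm D (v t) + Vnorm D (u t))\<^sup>2"
          using Vnorm_triangle_diff[OF vV'[OF t]] elim t
          by (intro power_mono Vnorm_nonneg) (simp add: y_def)
        also have "\<dots> \<le> 2 * (Vnorm D (v t))\<^sup>2 + 2 * (Vnorm D (u t))\<^sup>2"
          using zero_le_power2[of "Vnorm D (v t) - Vnorm D (u t)"] by (simp add: power2_sum power2_diff del: zero_le_power2)
        finally show "in_V D (y t) \<and> (Vnorm D (y t))\<^sup>2 \<le> 2 * \<alpha> + 2 * (Vnorm D (u t))\<^sup>2"
          using yV v\<alpha>'[OF t] by auto
      qed
    qed
    show "set_integrable lborel {\<tau>..T} (\<lambda>r. 2 * \<alpha> + 2 * (Vnorm D (u r))\<^sup>2)"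
      by (intro set_integral_add(1) set_integrable_mult_right uh set_integrable_continuous_Icc continuous_on_const)
    fix z s t assume z: "in_V D z" and st: "\<tau> \<le> s" "s \<le> t" "t \<le> T"
    have zL: "L2 D z" using z in_V_L2 by blast
    have iw: "set_integrable lborel {s..t} (\<lambda>r. - ?Aw r * dform D (v r) z + l2inner D (?Fw r) z)"
      "l2inner D (v t) z - l2inner D (v s) z = (LINT r:{s..t}|lborel. - ?Aw r * dform D (v r) z + l2inner D (?Fw r) z)"
      unfolding v_def using weak_sol_rescaled_increment[OF f(1,2) w g gc wV z st] by simp_all
    note iu = weak_sol_increment[OF u z st]
    show "set_integrable lborel {s..t} (\<lambda>r. ?G r z)"
      by (rule set_integral_diff(1)[OF iw(1) iu(1)])
    have "l2inner D (y t) z - l2inner D (y s) z =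
       (l2inner D (v t) z - l2inner D (v s) z) - (l2inner D (u t) z - l2inner D (u s) z)"
      unfolding y_def using l2inner_diff[OF vL uL zL, of t] l2inner_diff[OF vL uL zL, of s] st by simp
    also have "\<dots> = (LINT r:{s..t}|lborel. ?G r z)"
      unfolding iw(2) iu(2) by (rule set_integral_diff(2)[OF iw(1) iu(1), symmetric])
    finally show "l2inner D (y t) z - l2inner D (y s) z = (LINT r:{s..t}|lborel. ?G r z)" .
  next
    show "AE r in lborel. r \<in> {\<tau>..T} \<longrightarrow> (\<forall>z. in_V D z \<longrightarrow>
       ?G r z \<le> - ?Au r * dform D (y r) z + La * l2norm D l * sqrt \<alpha> * (3 * l2norm D (y r) + 2 * q * M) * Vnorm D z +
         (2 * q * (Cf * (3 * l2norm D (y r) + 3 * M + l2norm D (\<lambda>x. 1))) + \<eta> * (3 * l2norm D (y r) + 2 * q * M)) * l2norm D z)"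
      using uV by eventually_elim (use G_bound in \<open>auto simp only: Y_def\<close>)
    show "continuous_on {\<tau>..T} (\<lambda>r. La * l2norm D l * sqrt \<alpha> * (3 * l2norm D (y r) + 2 * q * M))"
      "continuous_on {\<tau>..T} (\<lambda>r. 2 * q * (Cf * (3 * l2norm D (y r) + 3 * M + l2norm D (\<lambda>x. 1))) + \<eta> * (3 * l2norm D (y r) + 2 * q * M))"
      using Yc unfolding Y_def by (auto intro!: continuous_intros)
    show "0 \<le> 2 * q * (Cf * (3 * l2norm D (y r) + 3 * M + l2norm D (\<lambda>x. 1))) + \<eta> * (3 * l2norm D (y r) + 2 * q * M)" for r
      using l2norm_nonneg[of "y r"] \<nu>0 q0 Cf M0 \<eta> by simp
  qed (use a t in auto)
  \<comment> \<open>The initial values differ: \<open>g\<close> need not vanish at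
    \<open>\<tau>\<close>, so up to null sets \<open>v\<close> starts at
    \<open>exp (- g \<tau>) u0\<close> and \<open>u\<close> at \<open>u0\<close>.\<close>
  have yt: "Y \<tau> \<le> 2 * q * l2norm D u0"
  proof -
    have \<tau>: "\<tau> \<in> {\<tau>..T}" using \<tau>T by simp
    have i: "l2norm D (\<lambda>x. u \<tau> x - u0 x) = 0" "l2norm D (\<lambda>x. w \<tau> x - u0 x) = 0"
      using u w unfolding weak_sol_def by blast+
    have d: "L2 D (\<lambda>x. exp (- g \<tau>) * (w \<tau> x - u0 x))" "L2 D (\<lambda>x. (exp (- g \<tau>) - 1) * u0 x)"
      "L2 D (\<lambda>x. u \<tau> x - u0 x)"
      by (intro L2_scale L2_diff wL[OF \<tau>] uL[OF \<tau>] u0)+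
    have "y \<tau> = (\<lambda>x. (exp (- g \<tau>) * (w \<tau> x - u0 x) + (exp (- g \<tau>) - 1) * u0 x) - (u \<tau> x - u0 x))"
      by (auto simp: y_def v_def algebra_simps)
    then have "Y \<tau> \<le> l2norm D (\<lambda>x. exp (- g \<tau>) * (w \<tau> x - u0 x) + (exp (- g \<tau>) - 1) * u0 x)"
      using l2norm_triangle_diff[OF L2_add[OF d(1,2)] d(3)] i by (simp add: Y_def)
    also have "\<dots> \<le> \<bar>exp (- g \<tau>) - 1\<bar> * l2norm D u0"
      using l2norm_triangle[OF d(1,2)] i by (simp add: l2norm_scale)
    also have "\<dots> \<le> 2 * q * l2norm D u0"
      by (rule mult_right_mono[OF exp1(2)[OF \<tau>] l2norm_nonneg])
    finally show ?thesis .
  qed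
  let ?U = "l2norm D u0"
  \<comment> \<open>Adding \<open>q\<close> to the unknown absorbs the inhomogeneity, so Gronwall's
    lemma applies with \<open>C\<close> alone.\<close>
  have "(Y t)\<^sup>2 + q \<le> ((Y \<tau>)\<^sup>2 + q) * exp (C * (t - \<tau>))"
  proof (rule gronwall_integral[OF _ C(1) _ t])
    show "continuous_on {\<tau>..T} (\<lambda>t. (Y t)\<^sup>2 + q)" by (intro continuous_intros Yc)
    fix s assume s: "s \<in> {\<tau>..T}"
    have sub: "{\<tau>..s} \<subseteq> {\<tau>..T}" using s by auto
    have "integral {\<tau>..s} (\<lambda>r. (?\<beta> r)\<^sup>2 / (2 * m) + 2 * ?\<gamma> r * Y r) \<le> integral {\<tau>..s} (\<lambda>r. C * ((Y r)\<^sup>2 + q))"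
    proof (rule integral_le)
      show "(\<lambda>r. (?\<beta> r)\<^sup>2 / (2 * m) + 2 * ?\<gamma> r * Y r) integrable_on {\<tau>..s}"
        using a(2) by (intro integrable_continuous_real continuous_on_subset[OF _ sub] continuous_intros Yc) auto
      show "(\<lambda>r. C * ((Y r)\<^sup>2 + q)) integrable_on {\<tau>..s}"
        by (intro integrable_continuous_real continuous_on_subset[OF _ sub] continuous_intros Yc)
    qed (rule C(2)[OF Y0])
    then show "(Y s)\<^sup>2 + q \<le> (Y \<tau>)\<^sup>2 + q + integral {\<tau>..s} (\<lambda>r. C * ((Y r)\<^sup>2 + q))"
      using energy[OF s] by linarith
  qed
  also have "\<dots> \<le> (q * (4 * ?U\<^sup>2 + 1)) * exp (C * (T - \<tau>))"
  proof (rule mult_mono)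
    have "(Y \<tau>)\<^sup>2 \<le> (2 * q * ?U)\<^sup>2" by (rule power_mono[OF yt Y0])
    also have "\<dots> = q * (q * (4 * ?U\<^sup>2))" by (simp add: power2_eq_square algebra_simps)
    also have "\<dots> \<le> q * (4 * ?U\<^sup>2)"
      using q q0 by (intro mult_left_mono mult_left_le_one_le) auto
    finally show "(Y \<tau>)\<^sup>2 + q \<le> q * (4 * ?U\<^sup>2 + 1)" by (simp add: algebra_simps)
    show "exp (C * (t - \<tau>)) \<le> exp (C * (T - \<tau>))" using t C(1) by (simp add: mult_left_mono)
    show "0 \<le> q * (4 * ?U\<^sup>2 + 1)" using q0 by simp
  qed simp
  finally have Yt: "(Y t)\<^sup>2 \<le> q * ((4 * ?U\<^sup>2 + 1) * exp (C * (T - \<tau>)))" using q0 by (simp add: mult.assoc)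
  have "(l2norm D (\<lambda>x. w t x - u t x))\<^sup>2 \<le> (3 * Y t + 2 * q * M)\<^sup>2"
    by (rule power_mono[OF wu[OF t] l2norm_nonneg])
  also have "\<dots> \<le> 18 * (Y t)\<^sup>2 + 8 * (q * q) * M\<^sup>2"
    using zero_le_power2[of "3 * Y t - 2 * q * M"]
    by (simp add: power2_sum power2_diff power_mult_distrib power2_eq_square algebra_simps del: zero_le_power2)
  also have "\<dots> \<le> 18 * (q * ((4 * ?U\<^sup>2 + 1) * exp (C * (T - \<tau>)))) + 8 * q * M\<^sup>2"
    using Yt mult_left_mono[OF q(2) q0] by (intro add_mono mult_left_mono mult_right_mono) auto
  finally show ?thesis by (simp add: algebra_simps)
qed

end

section \<open>Arithmetic of the coefficients, control of the noise, and the limit\<close>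

lemma energy_coefficient_bound:
  fixes A M \<nu> m q Y Cf \<eta> :: real
  assumes "0 \<le> M" "0 \<le> \<nu>" "0 < m" "0 \<le> q" "q \<le> 1" "0 \<le> Y" "0 \<le> Cf" "0 \<le> \<eta>"
  shows "(A * (3 * Y + 2 * q * M))\<^sup>2 / (2 * m) +
       2 * (2 * q * (Cf * (3 * Y + 3 * M + \<nu>)) + \<eta> * (3 * Y + 2 * q * M)) * Y
     \<le> (A\<^sup>2 / (2 * m) * (18 + 8 * M\<^sup>2) + 4 * Cf * (3 + 3 * M + \<nu>) + 2 * \<eta> * (3 + 2 * M)) * (Y\<^sup>2 + q)"
proof -
  have Y2: "0 \<le> Y\<^sup>2" by simp
  \<comment> \<open>The left side is bounded by multiples of \<open>Y\<^sup>2\<close>,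
    \<open>q * q\<close>, \<open>q * Y\<close> and \<open>q * Y\<^sup>2\<close>. Each of these is at
    most \<open>Y\<^sup>2 + q\<close> because \<open>q \<le> 1\<close>, so the constant stays free
    of \<open>q\<close>.\<close>
  have qq: "q * q \<le> q" using assms by (simp add: mult_left_le)
  have qY: "q * Y \<le> Y\<^sup>2 + q"
  proof (cases "Y \<le> 1")
    case True
    then have "q * Y \<le> q * 1" using assms by (intro mult_left_mono) auto
    then show ?thesis using Y2 by linarith
  next
    case False
    have "q * Y \<le> 1 * Y" using assms by (intro mult_right_mono) auto
    also have "1 * Y \<le> Y * Y" using False assms by (intro mult_right_mono) auto
    finally show ?thesis using assms by (simp add: power2_eq_square)
  qed
  have qY2: "q * Y\<^sup>2 \<le> Y\<^sup>2 + q"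
    using mult_right_mono[OF assms(5) Y2] assms(4) by linarith
  have "(3 * Y + 2 * q * M)\<^sup>2 \<le> 18 * Y\<^sup>2 + 8 * (q * q * M\<^sup>2)"
    using zero_le_power2[of "3 * Y - 2 * q * M"]
    by (simp add: power2_sum power2_diff power_mult_distrib power2_eq_square algebra_simps del: zero_le_power2)
  also have "\<dots> \<le> 18 * Y\<^sup>2 + 8 * (q * M\<^sup>2)"
    using mult_right_mono[OF qq, of "M\<^sup>2"] by simp
  also have "\<dots> \<le> (18 + 8 * M\<^sup>2) * (Y\<^sup>2 + q)"
    using assms by (simp add: algebra_simps)
  finally have "A\<^sup>2 / (2 * m) * (3 * Y + 2 * q * M)\<^sup>2 \<le> A\<^sup>2 / (2 * m) * ((18 + 8 * M\<^sup>2) * (Y\<^sup>2 + q))"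
    using assms by (intro mult_left_mono) auto
  then have 1: "(A * (3 * Y + 2 * q * M))\<^sup>2 / (2 * m) \<le> A\<^sup>2 / (2 * m) * (18 + 8 * M\<^sup>2) * (Y\<^sup>2 + q)"
    by (simp add: power_mult_distrib mult.assoc)
  have "q * (3 * Y + 3 * M + \<nu>) * Y = 3 * (q * Y\<^sup>2) + (3 * M + \<nu>) * (q * Y)"
    by (simp add: power2_eq_square algebra_simps)
  also have "\<dots> \<le> 3 * (Y\<^sup>2 + q) + (3 * M + \<nu>) * (Y\<^sup>2 + q)"
    using assms qY qY2 by (intro add_mono mult_left_mono) auto
  finally have "4 * Cf * (q * (3 * Y + 3 * M + \<nu>) * Y) \<le> 4 * Cf * ((3 + 3 * M + \<nu>) * (Y\<^sup>2 + q))"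
    using assms by (intro mult_left_mono) (auto simp: algebra_simps)
  moreover have "(3 * Y + 2 * q * M) * Y \<le> (3 + 2 * M) * (Y\<^sup>2 + q)"
  proof -
    have "(3 * Y + 2 * q * M) * Y = 3 * Y\<^sup>2 + 2 * M * (q * Y)"
      by (simp add: power2_eq_square algebra_simps)
    also have "\<dots> \<le> 3 * (Y\<^sup>2 + q) + 2 * M * (Y\<^sup>2 + q)"
      using assms qY by (intro add_mono mult_left_mono) auto
    finally show ?thesis by (simp add: algebra_simps)
  qed
  then have "2 * \<eta> * ((3 * Y + 2 * q * M) * Y) \<le> 2 * \<eta> * ((3 + 2 * M) * (Y\<^sup>2 + q))"
    using assms by (intro mult_left_mono) auto
  ultimately have 2: "2 * (2 * q * (Cf * (3 * Y + 3 * M + \<nu>)) + \<eta> * (3 * Y + 2 * q * M)) * Y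
     \<le> (4 * Cf * (3 + 3 * M + \<nu>) + 2 * \<eta> * (3 + 2 * M)) * (Y\<^sup>2 + q)"
    by (simp add: algebra_simps)
  show ?thesis using add_mono[OF 1 2] by (simp add: algebra_simps)
qed

text \<open>Of the convergence of the noise integrals only boundedness is kept, as the factor
  \<open>\<epsilon>\<close> will supply the smallness: for small \<open>\<delta>\<close> the
  integral stays within 1 of the continuous path \<open>\<omega>\<close>.\<close>

lemma noise_integral_bounded:
  assumes hyp: "hyp11 P \<zeta> K" and \<omega>: "\<omega> \<in> Omega"
  obtains W where "0 < W"
    "\<forall>\<^sub>F \<delta> in at_right 0. \<forall>t\<in>{\<tau>..T}. \<bar>oint 0 t (\<lambda>s. \<zeta> \<delta> (\<theta> s \<omega>))\<bar> \<le> W"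
proof -
  let ?Z = "\<lambda>\<delta> t. oint 0 t (\<lambda>s. \<zeta> \<delta> (\<theta> s \<omega>))"
  \<comment> \<open>The convergence is stated on symmetric intervals of positive radius; the added 1
    secures positivity.\<close>
  define S where "S = max \<bar>\<tau>\<bar> \<bar>T\<bar> + 1"
  have S: "0 < S" "{\<tau>..T} \<subseteq> {- S..S}" by (auto simp: S_def)
  have \<omega>c: "continuous_on A \<omega>" for A
    using \<omega> continuous_on_subset[OF _ subset_UNIV] unfolding Omega_def by blast
  obtain B where B: "\<forall>t\<in>{- S..S}. \<bar>\<omega> t\<bar> \<le> B"
    using continuous_on_Icc_bounded[OF continuous_on_rabs[OF \<omega>c]] by blast
  have B0: "0 \<le> B" using B S(1) by (auto intro: order_trans[OF abs_ge_zero[of "\<omega> 0"]])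
  have "((\<lambda>\<delta>. SUP t\<in>{-S..S}. \<bar>?Z \<delta> t - \<omega> t\<bar>) \<longlongrightarrow> 0) (at_right 0)"
    using hyp \<omega> S(1) unfolding hyp11_def by blast
  then have "\<forall>\<^sub>F \<delta> in at_right 0. (SUP t\<in>{-S..S}. \<bar>?Z \<delta> t - \<omega> t\<bar>) < 1"
    by (rule order_tendstoD(2)) simp
  moreover have "\<forall>\<^sub>F \<delta> in at_right (0::real). 0 < \<delta>" by (rule eventually_at_right_less)
  ultimately have "\<forall>\<^sub>F \<delta> in at_right 0. \<forall>t\<in>{\<tau>..T}. \<bar>?Z \<delta> t\<bar> \<le> B + 1"
  proof eventually_elim
    case (elim \<delta>)
    have "continuous_on UNIV (\<lambda>t. \<zeta> \<delta> (\<theta> t \<omega>))" using hyp \<omega> elim(2) unfolding hyp11_def by blast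
    then have Zc: "continuous_on UNIV (?Z \<delta>)"
      by (intro DERIV_continuous_on[OF oint_has_derivative])
    have "continuous_on {-S..S} (\<lambda>t. \<bar>?Z \<delta> t - \<omega> t\<bar>)"
      by (intro continuous_intros \<omega>c continuous_on_subset[OF Zc subset_UNIV])
    then obtain b where "\<forall>t\<in>{-S..S}. \<bar>?Z \<delta> t - \<omega> t\<bar> \<le> b"
      using continuous_on_Icc_bounded by blast
    \<comment> \<open>A real \<open>SUP\<close> is known to bound its members only over a bounded
      set, so boundedness is checked first.\<close>
    then have bdd: "bdd_above ((\<lambda>t. \<bar>?Z \<delta> t - \<omega> t\<bar>) ` {-S..S})" by (intro bdd_aboveI2) auto
    show ?case
    proof
      fix t assume "t \<in> {\<tau>..T}"
      then have t: "t \<in> {-S..S}" using S(2) by blast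
      have "\<bar>?Z \<delta> t - \<omega> t\<bar> \<le> (SUP t\<in>{-S..S}. \<bar>?Z \<delta> t - \<omega> t\<bar>)" by (rule cSUP_upper[OF t bdd])
      moreover have "\<bar>\<omega> t\<bar> \<le> B" using B t by blast
      ultimately show "\<bar>?Z \<delta> t\<bar> \<le> B + 1" using elim(1) by linarith
    qed
  qed
  then show ?thesis using that[of "B + 1"] B0 by simp
qed

theorem theorem5p3:
  fixes D :: "'n::euclidean_space set" and k :: nat
    and a f :: "real \<Rightarrow> real" and l u0 :: "'n \<Rightarrow> real"
    and m m' La \<eta> \<kappa> \<alpha>1 \<alpha>2 Cf \<tau> T \<alpha> :: real
    and P :: "(real \<Rightarrow> real) measure"
    and \<zeta> :: "real \<Rightarrow> (real \<Rightarrow> real) \<Rightarrow> real" and K :: "real \<Rightarrow> real"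
    and \<omega> :: "real \<Rightarrow> real"
    and u :: "real \<Rightarrow> 'n \<Rightarrow> real"
    and u0e :: "real \<Rightarrow> real \<Rightarrow> 'n \<Rightarrow> real"
    and ude :: "real \<Rightarrow> real \<Rightarrow> real \<Rightarrow> 'n \<Rightarrow> real"
  assumes dom: "open D" "bounded D" "k \<ge> 2" "Ck_boundary k D"
    and a_cont: "continuous_on UNIV a"
    and a_lip: "\<And>s r. \<bar>a s - a r\<bar> \<le> La * \<bar>s - r\<bar>"
    and a_bnd: "0 < m" "m \<le> m'" "\<And>s. m \<le> a s" "\<And>s. a s \<le> m'"
    and f_cont: "continuous_on UNIV f"
    and f_lip: "\<And>s r. \<bar>f s - f r\<bar> \<le> \<eta> * \<bar>s - r\<bar>"
    and f_diss: "\<And>s. - \<kappa> - \<alpha>1 * s^2 \<le> f s * s" "\<And>s. f s * s \<le> \<kappa> - \<alpha>2 * s^2"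
    and f_growth: "\<And>s. \<bar>f s\<bar> \<le> Cf * (\<bar>s\<bar> + 1)"
    and l_L2: "L2 D l"
    and wiener: "wiener_measure P"
    and hyp: "hyp11 P \<zeta> K"
    and times: "\<tau> < T" "0 < T"
    and \<omega>_in: "\<omega> \<in> Omega"
    and u0_H: "L2 D u0"
    and u_sol: "weak_sol D (\<lambda>s z. a (l2inner D l z)) (\<lambda>s z x. f (z x)) \<tau> T u0 u"
    and u0e_sol: "\<And>\<epsilon>. \<epsilon> > 0 \<Longrightarrow> strat_sol D a l f \<epsilon> \<omega> \<tau> T u0 (u0e \<epsilon>)"
    and ude_sol: "\<And>\<delta> \<epsilon>. \<delta> > 0 \<Longrightarrow> \<epsilon> > 0 \<Longrightarrow>
        weak_sol D (\<lambda>s z. a (l2inner D l z))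
          (\<lambda>s z x. f (z x) + \<epsilon> * \<zeta> \<delta> (\<theta> s \<omega>) * z x) \<tau> T u0 (ude \<delta> \<epsilon>)"
    and \<alpha>_pos: "\<alpha> > 0"
    and v0_bnd: "\<And>\<epsilon> t. \<epsilon> > 0 \<Longrightarrow> t \<in> {\<tau>..T} \<Longrightarrow>
        in_V D (\<lambda>x. exp (- \<epsilon> * \<omega> t) * u0e \<epsilon> t x) \<and>
        (Vnorm D (\<lambda>x. exp (- \<epsilon> * \<omega> t) * u0e \<epsilon> t x))^2 \<le> \<alpha>"
    and vd_bnd: "\<And>\<delta> \<epsilon> t. \<delta> > 0 \<Longrightarrow> \<epsilon> > 0 \<Longrightarrow> t \<in> {\<tau>..T} \<Longrightarrow>
        in_V D (\<lambda>x. exp (- \<epsilon> * oint 0 t (\<lambda>s. \<zeta> \<delta> (\<theta> s \<omega>))) * ude \<delta> \<epsilon> t x) \<and>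
        (Vnorm D (\<lambda>x. exp (- \<epsilon> * oint 0 t (\<lambda>s. \<zeta> \<delta> (\<theta> s \<omega>))) * ude \<delta> \<epsilon> t x))^2 \<le> \<alpha>"
    and m_big: "m > (\<alpha> + 2) * La * l2norm D l / lambda1 D + La * l2norm D l * (\<alpha> + 2)
                   + 4 * \<eta> / lambda1 D"
  shows "((\<lambda>(\<delta>, \<epsilon>). SUP t\<in>{\<tau>..T}. (l2norm D (\<lambda>x. ude \<delta> \<epsilon> t x - u t x))^2) \<longlongrightarrow> 0)
           (at_right 0 \<times>\<^sub>F at_right 0)"
proof -
  interpret bounded_domain D using dom by unfold_locales
  let ?Z = "\<lambda>\<delta> t. oint 0 t (\<lambda>s. \<zeta> \<delta> (\<theta> s \<omega>))"
  let ?f = "\<lambda>(\<delta>, \<epsilon>). SUP t\<in>{\<tau>..T}. (l2norm D (\<lambda>x. ude \<delta> \<epsilon> t x - u t x))\<^sup>2"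
  have "continuous_on {\<tau>..T} (\<lambda>t. l2norm D (u t))"
    by (rule l2_path_continuous_norm) (use u_sol in \<open>auto simp: weak_sol_def\<close>)
  then obtain M where M: "\<And>t. t \<in> {\<tau>..T} \<Longrightarrow> l2norm D (u t) \<le> M"
    using continuous_on_Icc_bounded by blast
  have M0: "0 \<le> M" using M[of \<tau>] l2norm_nonneg[of "u \<tau>"] times by auto
  have \<eta>: "0 \<le> \<eta>" using f_lip[of 1 0] by simp
  have Cf: "0 \<le> Cf" using f_growth[of 0] by (auto intro: order_trans[OF abs_ge_zero])
  let ?A = "La * l2norm D l * sqrt \<alpha>" and ?\<nu> = "l2norm D (\<lambda>x. 1)"
  \<comment> \<open>This constant depends on neither \<open>\<delta>\<close> nor
    \<open>\<epsilon>\<close>, and the same holds for \<open>B\<close> and \<open>W\<close>.\<close>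
  define C where "C = ?A\<^sup>2 / (2 * m) * (18 + 8 * M\<^sup>2) + 4 * Cf * (3 + 3 * M + ?\<nu>) + 2 * \<eta> * (3 + 2 * M)"
  have C0: "0 \<le> C"
    unfolding C_def using M0 \<eta> Cf a_bnd(1) l2norm_nonneg[of "\<lambda>x. 1"] by simp
  define B where "B = 18 * ((4 * (l2norm D u0)\<^sup>2 + 1) * exp (C * (T - \<tau>))) + 8 * M\<^sup>2"
  obtain W where W: "0 < W" "\<forall>\<^sub>F \<delta> in at_right 0. \<forall>t\<in>{\<tau>..T}. \<bar>?Z \<delta> t\<bar> \<le> W"
    using noise_integral_bounded[OF hyp \<omega>_in] .
  \<comment> \<open>With \<open>q = \<epsilon> * W\<close>, the condition
    \<open>\<epsilon> < 1 / W\<close> says \<open>q < 1\<close>. The resulting bound is uniform in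
    \<open>t\<close> and free of \<open>\<delta>\<close>.\<close>
  have bound: "(l2norm D (\<lambda>x. ude \<delta> \<epsilon> t x - u t x))\<^sup>2 \<le> \<epsilon> * W * B"
    if \<delta>: "0 < \<delta>" "\<forall>t\<in>{\<tau>..T}. \<bar>?Z \<delta> t\<bar> \<le> W" and \<epsilon>: "0 < \<epsilon>" "\<epsilon> < 1 / W" and t: "t \<in> {\<tau>..T}" for \<delta> \<epsilon> t
  proof -
    have \<zeta>c: "continuous_on UNIV (\<lambda>t. \<zeta> \<delta> (\<theta> t \<omega>))"
      using hyp \<omega>_in \<delta>(1) unfolding hyp11_def by blast
    have q: "0 \<le> \<epsilon> * W" "\<epsilon> * W \<le> 1" using \<epsilon> W(1) by (auto simp: field_simps)
    show ?thesis
      unfolding B_def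
    proof (rule weak_sol_difference_estimate[OF times(1) a_lip a_bnd(1,3,4) f_cont f_growth f_lip l_L2 u0_H u_sol
          ude_sol[OF \<delta>(1) \<epsilon>(1)], where g = "\<lambda>t. \<epsilon> * ?Z \<delta> t"])
      show "((\<lambda>t. \<epsilon> * ?Z \<delta> t) has_real_derivative \<epsilon> * \<zeta> \<delta> (\<theta> t \<omega>)) (at t)" for t
        by (rule DERIV_cmult[OF oint_has_derivative[OF \<zeta>c]])
      show "continuous_on UNIV (\<lambda>s. \<epsilon> * \<zeta> \<delta> (\<theta> s \<omega>))" by (intro continuous_intros \<zeta>c)
      show "\<bar>\<epsilon> * ?Z \<delta> t\<bar> \<le> \<epsilon> * W" if "t \<in> {\<tau>..T}" for t
        using \<delta>(2) that \<epsilon>(1) by (simp add: abs_mult)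
      show "in_V D (\<lambda>x. exp (- (\<epsilon> * ?Z \<delta> t)) * ude \<delta> \<epsilon> t x)" if "t \<in> {\<tau>..T}" for t
        using vd_bnd[OF \<delta>(1) \<epsilon>(1) that] by simp
      show "(Vnorm D (\<lambda>x. exp (- (\<epsilon> * ?Z \<delta> t)) * ude \<delta> \<epsilon> t x))\<^sup>2 \<le> \<alpha>" if "t \<in> {\<tau>..T}" for t
        using vd_bnd[OF \<delta>(1) \<epsilon>(1) that] by simp
      show "(?A * (3 * Y + 2 * (\<epsilon> * W) * M))\<^sup>2 / (2 * m) +
         2 * (2 * (\<epsilon> * W) * (Cf * (3 * Y + 3 * M + ?\<nu>)) + \<eta> * (3 * Y + 2 * (\<epsilon> * W) * M)) * Y
         \<le> C * (Y\<^sup>2 + \<epsilon> * W)" if "0 \<le> Y" for Y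
        unfolding C_def by (rule energy_coefficient_bound[OF M0 l2norm_nonneg a_bnd(1) q that Cf \<eta>])
    qed (use q M C0 t in auto)
  qed
  \<comment> \<open>The conditions on \<open>\<delta>\<close> and on \<open>\<epsilon>\<close> are
    separate, which is what the product filter demands of a joint limit.\<close>
  have ev: "\<forall>\<^sub>F p in at_right 0 \<times>\<^sub>F at_right 0.
     (0 < fst p \<and> (\<forall>t\<in>{\<tau>..T}. \<bar>?Z (fst p) t\<bar> \<le> W)) \<and> (snd p \<in> {0<..<1 / W})"
  proof (rule eventually_prodI)
    show "\<forall>\<^sub>F \<delta> in at_right 0. 0 < \<delta> \<and> (\<forall>t\<in>{\<tau>..T}. \<bar>?Z \<delta> t\<bar> \<le> W)"
      using eventually_at_right_less W(2) by (rule eventually_conj)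
    show "\<forall>\<^sub>F \<epsilon> in at_right 0. \<epsilon> \<in> {0<..<1 / W}"
      using W(1) by (intro eventually_at_right_real) simp
  qed
  have ne: "{\<tau>..T} \<noteq> {}" using times by simp
  show ?thesis
  proof (rule tendsto_sandwich[where f = "\<lambda>_. 0" and h = "\<lambda>p. snd p * W * B"])
    show "\<forall>\<^sub>F p in at_right 0 \<times>\<^sub>F at_right 0. 0 \<le> ?f p"
      using ev
    proof eventually_elim
      case (elim p)
      \<comment> \<open>Even the nonnegativity of the \<open>SUP\<close> is derived from
        boundedness, by comparison with its member at \<open>\<tau>\<close>.\<close>
      have "bdd_above ((\<lambda>t. (l2norm D (\<lambda>x. ude (fst p) (snd p) t x - u t x))\<^sup>2) ` {\<tau>..T})"
        using bound[of "fst p" "snd p"] elim by (intro bdd_aboveI2[of _ _ "snd p * W * B"]) auto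
      then show ?case
        using times by (auto simp: case_prod_unfold intro!: cSUP_upper2[of _ _ \<tau>])
    qed
    show "\<forall>\<^sub>F p in at_right 0 \<times>\<^sub>F at_right 0. ?f p \<le> snd p * W * B"
      using ev
    proof eventually_elim
      case (elim p)
      then show ?case
        using bound[of "fst p" "snd p"] ne by (auto simp: case_prod_unfold intro!: cSUP_least)
    qed
    have "filterlim snd (at_right 0) (at_right (0::real) \<times>\<^sub>F at_right (0::real))" by (rule filterlim_snd)
    then have "((\<lambda>p. snd p) \<longlongrightarrow> 0) (at_right (0::real) \<times>\<^sub>F at_right (0::real))"
      by (rule filterlim_mono) (auto simp: at_within_le_nhds)
    then have "((\<lambda>p. snd p * W * B) \<longlongrightarrow> 0 * W * B) (at_right (0::real) \<times>\<^sub>F at_right (0::real))"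
      by (intro tendsto_intros)
    then show "((\<lambda>p. snd p * W * B) \<longlongrightarrow> 0) (at_right (0::real) \<times>\<^sub>F at_right (0::real))" by simp
  qed simp
qed

end
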